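(* Let $\Omega\subset\mathbb R^N$ be a bounded domain with $C^{1,1}$ boundary, $\delta(x)=\mathrm{dist}(x,\Omega^c)$, $K>0$, and $u\in W^{s,p}_0(\Omega)$ satisfy $|(-\Delta)^s_pu|\le K$ weakly in $\Omega$. Then $$|u(x)|\le(C_\Omega K)^{\frac1{p-1}}\delta(x)^s\quad\text{for a.e. }x\in\Omega,$$ where $C_\Omega>0$ depends only on $N,p,s,\Omega$.
   Context: Fixed $s\in(0,1)$, $p\in(1,\infty)$. $a^q:=|a|^{q-1}a$. For $\varphi\in W^{s,p}_0(\Omega)$ let $\mathcal E(u,\varphi)=\int_{\mathbb R^N\times\mathbb R^N}\frac{(u(x)-u(y))^{p-1}(\varphi(x)-\varphi(y))}{|x-y|^{N+ps}}dxdy$. "$|(-\Delta)^s_pu|\le K$ weakly in $\Omega$" means $-K\int_\Omega\varphi\le\mathcal E(u,\varphi)\le K\int_\Omega\varphi$ for all $\varphi\in W^{s,p}_0(\Omega)$, $\varphi\ge0$. *)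

theory Defs
  imports "HOL-Analysis.Analysis"
begin

definition spow :: "real \<Rightarrow> real \<Rightarrow> real" where
  "spow a q = \<bar>a\<bar> powr (q - 1) * a"

definition Wsp0 :: "real \<Rightarrow> real \<Rightarrow> ('a::euclidean_space) set \<Rightarrow> ('a \<Rightarrow> real) set" where
  "Wsp0 s p \<Omega> = {u. u \<in> borel_measurable lebesgue
      \<and> integrable lebesgue (\<lambda>x. \<bar>u x\<bar> powr p)
      \<and> (\<integral>\<^sup>+ z. ennreal (\<bar>u (fst z) - u (snd z)\<bar> powr p
              / norm (fst z - snd z) powr (real DIM('a) + p * s)) \<partial>(lebesgue \<Otimes>\<^sub>M lebesgue)) < \<infinity>
      \<and> (AE x in lebesgue. x \<notin> \<Omega> \<longrightarrow> u x = 0)}"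

definition frac_energy :: "real \<Rightarrow> real \<Rightarrow> (('a::euclidean_space) \<Rightarrow> real) \<Rightarrow> ('a \<Rightarrow> real) \<Rightarrow> real" where
  "frac_energy s p u \<phi> = (\<integral> z. spow (u (fst z) - u (snd z)) (p - 1) * (\<phi> (fst z) - \<phi> (snd z))
        / norm (fst z - snd z) powr (real DIM('a) + p * s) \<partial>(lebesgue \<Otimes>\<^sub>M lebesgue))"

definition weak_bounded_fplap :: "real \<Rightarrow> real \<Rightarrow> ('a::euclidean_space) set \<Rightarrow> ('a \<Rightarrow> real) \<Rightarrow> real \<Rightarrow> bool" where
  "weak_bounded_fplap s p \<Omega> u K \<longleftrightarrow>
     (\<forall>\<phi> \<in> Wsp0 s p \<Omega>. (\<forall>x. \<phi> x \<ge> 0) \<longrightarrow>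
        - K * (\<integral>x\<in>\<Omega>. \<phi> x \<partial>lebesgue) \<le> frac_energy s p u \<phi>
        \<and> frac_energy s p u \<phi> \<le> K * (\<integral>x\<in>\<Omega>. \<phi> x \<partial>lebesgue))"

definition C11_on :: "('a::euclidean_space) set \<Rightarrow> ('a \<Rightarrow> 'b::euclidean_space) \<Rightarrow> bool" where
  "C11_on S f \<longleftrightarrow> (\<exists>f' L. (\<forall>x\<in>S. (f has_derivative f' x) (at x))
      \<and> (\<forall>x\<in>S. \<forall>y\<in>S. onorm (\<lambda>v. f' x v - f' y v) \<le> L * dist x y))"

text \<open>C^{1,1} boundary (Gilbarg--Trudinger): each boundary point has a ball B
  and a bijection psi of B onto D, psi and its inverse C^{1,1}, flattening the boundary.\<close>
definition C11_boundary :: "('a::euclidean_space) set \<Rightarrow> bool" where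
  "C11_boundary \<Omega> \<longleftrightarrow> (\<forall>x0 \<in> frontier \<Omega>. \<exists>r>0. \<exists>(\<psi>::'a \<Rightarrow> 'a) D e.
      norm e = 1 \<and> open D \<and> inj_on \<psi> (ball x0 r) \<and> \<psi> ` ball x0 r = D
      \<and> \<psi> ` (ball x0 r \<inter> \<Omega>) \<subseteq> {z. z \<bullet> e > 0}
      \<and> \<psi> ` (ball x0 r \<inter> frontier \<Omega>) \<subseteq> {z. z \<bullet> e = 0}
      \<and> C11_on (ball x0 r) \<psi> \<and> C11_on D (inv_into (ball x0 r) \<psi>))"

end

theory Submission
  imports Defs
begin

text \<open>
  Since the bound on the operator is two-sided, it suffices to bound \<open>u\<close> from above, by comparison with
  barriers. The \<open>C\<^bsup>1,1\<^esup>\<close> charts give, at every boundary point \<open>b\<close>, a paraboloid of uniform opening touching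
  \<open>\<Omega>\<close> from outside, \<open>{g < 0}\<close> with \<open>g y = (y - b) \<bullet> e + \<kappa> \<bar>y'\<bar>\<^sup>2\<close>, where \<open>y'\<close> is the part of \<open>y - b\<close> orthogonal
  to the unit vector \<open>e\<close>. The barrier is \<open>min g \<rho> ^ s\<close> for a small \<open>\<rho>\<close>, and \<open>\<rho> ^ s\<close> away from \<open>b\<close>.

  Principal values are avoided: the singular integral at a point of height \<open>d\<close> is truncated to the
  points of height outside \<open>((1 - \<epsilon>) d, d / (1 - \<epsilon>))\<close>, a condition symmetric in the two points.
  For the half-line profile \<open>h\<^sup>s\<close> the truncated integral is nonnegative by the substitution
  \<open>h \<mapsto> d\<^sup>2 / h\<close> and an explicit antiderivative. Cutting the profile off at height \<open>\<rho>\<close> gains a multiple of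
  \<open>\<rho> powr (-s)\<close>. The volume preserving shear along \<open>e\<close> that maps the paraboloid to a half-space costs
  only an error bounded independently of \<open>\<rho>\<close>, so a small \<open>\<rho>\<close> makes the barrier a strict supersolution.
  Testing with the positive part of \<open>u - \<lambda> W\<close> and letting \<open>\<epsilon>\<close> tend to 0 gives \<open>u \<le> \<lambda> W\<close>.
\<close>

subsection \<open>Lebesgue measure: scaling, shears and powers of the norm\<close>

text \<open>The lift \<open>\<tau>\<close> in the barrier answers an obstacle: the profile has
  unbounded slope at height 0, so the unlifted barrier need not be Lipschitz up to the touching
  point. With \<open>\<tau> > 0\<close> all heights over \<open>\<Omega>\<close> near
  \<open>b\<close> are at least \<open>\<tau>\<close>; the barrier is then Lipschitz on
  \<open>\<Omega>\<close>, and a point of \<open>\<Omega>\<close> near \<open>b\<close> stays at a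
  positive distance from all points that the truncation keeps. The lower bound in the supersolution
  estimate does not depend on \<open>\<tau>\<close>, which can therefore be sent to 0 at the end.

  The test function vanishes outside \<open>\<Omega>\<close>, so the seminorm of the barrier matters
  only over \<open>\<Omega> \<times> \<Omega>\<close>; elsewhere it suffices that the barrier is
  measurable, bounded and nonnegative. This is why it may jump across a sphere about
  \<open>b\<close>.

  Each comparison holds outside a null set that depends on \<open>b\<close> and
  \<open>\<tau>\<close>. Barriers are therefore used only for countably many of them, with
  \<open>b\<close> in a dense subset of the frontier, and the distance function appears in the
  limit.

  The exponent \<open>1 / (p - 1)\<close> is homogeneity: scaling the barrier by
  \<open>\<lambda>\<close> scales its operator by \<open>\<lambda> powr (p - 1)\<close>, which is
  balanced against \<open>K\<close>.\<close>

lemma nn_integral_lborel_translate: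
  fixes f :: "'a::euclidean_space \<Rightarrow> ennreal"
  assumes [measurable]: "f \<in> borel_measurable borel"
  shows "(\<integral>\<^sup>+z. f (a + z) \<partial>lborel) = (\<integral>\<^sup>+z. f z \<partial>lborel)"
proof -
  have "(\<integral>\<^sup>+z. f z \<partial>lborel) = (\<integral>\<^sup>+z. f z \<partial>distr lborel borel ((+) a))"
    by (subst lborel_distr_plus) simp
  also have "\<dots> = (\<integral>\<^sup>+z. f (a + z) \<partial>lborel)"
    by (subst nn_integral_distr) auto
  finally show ?thesis by simp
qed

lemma nn_integral_lborel_scale:
  fixes f :: "'a::euclidean_space \<Rightarrow> ennreal"
  assumes [measurable]: "f \<in> borel_measurable borel" and c: "c \<noteq> 0"
  shows "(\<integral>\<^sup>+z. f z \<partial>lborel) = ennreal (\<bar>c\<bar> ^ DIM('a)) * (\<integral>\<^sup>+z. f (c *\<^sub>R z) \<partial>lborel)"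
proof -
  have "(\<integral>\<^sup>+z. f z \<partial>lborel)
    = (\<integral>\<^sup>+z. f z \<partial>density (distr lborel borel (\<lambda>x. 0 + c *\<^sub>R x)) (\<lambda>_. \<bar>c\<bar> ^ DIM('a)))"
    using lborel_affine[OF c, of "0::'a"] by simp
  also have "\<dots> = ennreal (\<bar>c\<bar> ^ DIM('a)) * (\<integral>\<^sup>+z. f (c *\<^sub>R z) \<partial>lborel)"
    by (subst nn_integral_density) (auto simp: nn_integral_distr nn_integral_cmult)
  finally show ?thesis .
qed

lemma nn_integral_lborel_uminus:
  fixes f :: "'a::euclidean_space \<Rightarrow> ennreal"
  assumes [measurable]: "f \<in> borel_measurable borel"
  shows "(\<integral>\<^sup>+z. f (- z) \<partial>lborel) = (\<integral>\<^sup>+z. f z \<partial>lborel)"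
  using nn_integral_lborel_scale[OF assms, of "-1"] by simp

text \<open>Inserting \<open>1 = \<integral> indicator {0..1} (y \<bullet> e - t) dt\<close> turns the translation of \<open>y\<close> along \<open>e\<close>
  into a translation of the real parameter \<open>t\<close>, and there the shift \<open>f y\<close> does not matter.\<close>

lemma nn_integral_lborel_shear:
  fixes h :: "'a::euclidean_space \<Rightarrow> ennreal" and f :: "'a \<Rightarrow> real"
  assumes [measurable]: "h \<in> borel_measurable borel" "f \<in> borel_measurable borel"
    and e: "norm e = 1" and f: "\<And>y t. f (y + t *\<^sub>R e) = f y"
  shows "(\<integral>\<^sup>+y. h (y + f y *\<^sub>R e) \<partial>lborel) = (\<integral>\<^sup>+y. h y \<partial>lborel)"
proof -
  define chi :: "real \<Rightarrow> ennreal" where "chi = indicator {0..1}"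
  have [measurable]: "chi \<in> borel_measurable borel" by (auto simp: chi_def)
  have ee: "e \<bullet> e = 1" using e by (simp add: norm_eq_1)
  have chi1: "(\<integral>\<^sup>+t. chi (a - t) \<partial>lborel) = 1" for a
  proof -
    have "(\<integral>\<^sup>+t. chi (a - t) \<partial>lborel) = (\<integral>\<^sup>+t. indicator {a - 1..a} t \<partial>lborel)"
      by (intro nn_integral_cong) (auto simp: chi_def indicator_def)
    then show ?thesis by simp
  qed
  have key: "(\<integral>\<^sup>+y. h (y + g y *\<^sub>R e) \<partial>lborel)
      = (\<integral>\<^sup>+y. chi (y \<bullet> e) * (\<integral>\<^sup>+t. h (y + t *\<^sub>R e) \<partial>lborel) \<partial>lborel)"
    if [measurable]: "g \<in> borel_measurable borel" and g: "\<And>y t. g (y + t *\<^sub>R e) = g y" for g :: "'a \<Rightarrow> real"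
  proof -
    have "(\<integral>\<^sup>+y. h (y + g y *\<^sub>R e) \<partial>lborel)
      = (\<integral>\<^sup>+y. (\<integral>\<^sup>+t. h (y + g y *\<^sub>R e) * chi (y \<bullet> e - t) \<partial>lborel) \<partial>lborel)"
      by (subst nn_integral_cmult) (auto simp: chi1)
    also have "\<dots> = (\<integral>\<^sup>+t. (\<integral>\<^sup>+y. h (y + g y *\<^sub>R e) * chi (y \<bullet> e - t) \<partial>lborel) \<partial>lborel)"
      by (rule lborel_pair.Fubini') measurable
    also have "\<dots> = (\<integral>\<^sup>+t. (\<integral>\<^sup>+y. h (y + (g y + t) *\<^sub>R e) * chi (y \<bullet> e) \<partial>lborel) \<partial>lborel)"
    proof (rule nn_integral_cong)
      fix t :: real
      have "(\<integral>\<^sup>+y. h (y + g y *\<^sub>R e) * chi (y \<bullet> e - t) \<partial>lborel)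
        = (\<integral>\<^sup>+y. h ((t *\<^sub>R e + y) + g (t *\<^sub>R e + y) *\<^sub>R e) * chi ((t *\<^sub>R e + y) \<bullet> e - t) \<partial>lborel)"
        by (rule nn_integral_lborel_translate[symmetric]) measurable
      also have "\<dots> = (\<integral>\<^sup>+y. h (y + (g y + t) *\<^sub>R e) * chi (y \<bullet> e) \<partial>lborel)"
        using g by (intro nn_integral_cong) (simp add: algebra_simps ee)
      finally show "(\<integral>\<^sup>+y. h (y + g y *\<^sub>R e) * chi (y \<bullet> e - t) \<partial>lborel)
          = (\<integral>\<^sup>+y. h (y + (g y + t) *\<^sub>R e) * chi (y \<bullet> e) \<partial>lborel)" .
    qed
    also have "\<dots> = (\<integral>\<^sup>+y. (\<integral>\<^sup>+t. h (y + (g y + t) *\<^sub>R e) * chi (y \<bullet> e) \<partial>lborel) \<partial>lborel)"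
      by (rule lborel_pair.Fubini'[symmetric]) measurable
    also have "\<dots> = (\<integral>\<^sup>+y. chi (y \<bullet> e) * (\<integral>\<^sup>+t. h (y + (g y + t) *\<^sub>R e) \<partial>lborel) \<partial>lborel)"
      by (subst nn_integral_multc) (auto simp: mult.commute)
    also have "\<dots> = (\<integral>\<^sup>+y. chi (y \<bullet> e) * (\<integral>\<^sup>+t. h (y + t *\<^sub>R e) \<partial>lborel) \<partial>lborel)"
    proof (rule nn_integral_cong, rule arg_cong2[where f="(*)"], rule refl)
      fix y
      show "(\<integral>\<^sup>+t. h (y + (g y + t) *\<^sub>R e) \<partial>lborel) = (\<integral>\<^sup>+t. h (y + t *\<^sub>R e) \<partial>lborel)"
        by (rule nn_integral_lborel_translate) measurable
    qed
    finally show ?thesis .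
  qed
  show ?thesis
    using key[of f] key[of "\<lambda>_. 0"] f by simp
qed

text \<open>By scaling, the integral over the shell of radii \<open>c^k * m\<close> to
  \<open>2 * (c^k * m)\<close> is the k-th power of the ratio times that of the first shell, so a
  geometric series bounds the whole. \<open>c = 2\<close> and \<open>c = 1/2\<close> serve the
  exterior and the interior of a ball; overlaps of shells only increase the sum.\<close>

lemma nn_integral_norm_powr_geometric:
  fixes m c a :: real
  assumes c: "0 < c" and m: "0 < m" and ratio: "c powr (real DIM('a::euclidean_space) + a) < 1"
  shows "(\<integral>\<^sup>+(z::'a). ennreal (norm z powr a) * indicator (\<Union>k::nat. {z. c^k * m \<le> norm z \<and> norm z \<le> 2 * (c^k * m)}) z \<partial>lborel) < \<infinity>"
proof -
  define S where "S r = {z::'a. r \<le> norm z \<and> norm z \<le> 2 * r}" for r :: real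
  have [measurable]: "S r \<in> sets borel" for r
    unfolding S_def by measurable
  define J where "J = (\<integral>\<^sup>+(z::'a). ennreal (norm z powr a) * indicator (S m) z \<partial>lborel)"
  have J: "J < \<infinity>"
  proof -
    have "J \<le> (\<integral>\<^sup>+(z::'a). ennreal (m powr a + (2*m) powr a) * indicator (cball 0 (2*m)) z \<partial>lborel)"
      unfolding J_def
    proof (intro nn_integral_mono)
      fix z :: 'a
      have "norm z powr a \<le> m powr a + (2*m) powr a" if "z \<in> S m"
      proof (cases "a \<ge> 0")
        case True
        then have "norm z powr a \<le> (2*m) powr a" using that by (intro powr_mono2) (auto simp: S_def)
        then show ?thesis by (simp add: add_increasing)
      next
        case False
        then have "norm z powr a \<le> m powr a" using that m by (intro powr_mono2') (auto simp: S_def)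
        then show ?thesis by (simp add: add_increasing2)
      qed
      then show "ennreal (norm z powr a) * indicator (S m) z
          \<le> ennreal (m powr a + (2*m) powr a) * indicator (cball 0 (2*m)) z"
        by (auto simp: indicator_def S_def simp del: ennreal_plus intro!: ennreal_leI)
    qed
    also have "\<dots> < \<infinity>"
      using emeasure_lborel_cball_finite[of "0::'a" "2*m"]
      by (simp add: nn_integral_cmult_indicator ennreal_mult_less_top del: ennreal_plus)
    finally show ?thesis .
  qed
  define R where "R = c powr (real DIM('a) + a)"
  have scale: "(\<integral>\<^sup>+(z::'a). ennreal (norm z powr a) * indicator (S (c^k * m)) z \<partial>lborel) = ennreal (R ^ k) * J" for k :: nat
  proof -
    have "(\<integral>\<^sup>+(z::'a). ennreal (norm z powr a) * indicator (S (c^k * m)) z \<partial>lborel)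
      = ennreal (\<bar>c^k\<bar> ^ DIM('a)) * (\<integral>\<^sup>+(z::'a). ennreal (norm (c^k *\<^sub>R z) powr a) * indicator (S (c^k * m)) (c^k *\<^sub>R z) \<partial>lborel)"
      using c by (intro nn_integral_lborel_scale) auto
    also have "(\<integral>\<^sup>+(z::'a). ennreal (norm (c^k *\<^sub>R z) powr a) * indicator (S (c^k * m)) (c^k *\<^sub>R z) \<partial>lborel)
      = (\<integral>\<^sup>+(z::'a). ennreal ((c^k) powr a) * (ennreal (norm z powr a) * indicator (S m) z) \<partial>lborel)"
    proof (intro nn_integral_cong)
      fix z :: 'a
      have "c^k > 0" using c by simp
      then have "c^k *\<^sub>R z \<in> S (c^k * m) \<longleftrightarrow> z \<in> S m"
        by (auto simp: S_def mult.left_commute[of 2])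
      moreover have "norm (c^k *\<^sub>R z) powr a = (c^k) powr a * norm z powr a"
        using c by (simp add: powr_mult)
      ultimately show "ennreal (norm (c^k *\<^sub>R z) powr a) * indicator (S (c^k * m)) (c^k *\<^sub>R z)
          = ennreal ((c^k) powr a) * (ennreal (norm z powr a) * indicator (S m) z)"
        by (auto simp: indicator_def ennreal_mult')
    qed
    also have "\<dots> = ennreal ((c^k) powr a) * J"
      unfolding J_def by (rule nn_integral_cmult) measurable
    also have "ennreal (\<bar>c^k\<bar> ^ DIM('a)) * (ennreal ((c^k) powr a) * J) = ennreal (R^k) * J"
    proof -
      have "(c^k) ^ DIM('a) * (c^k) powr a = R ^ k"
        using c unfolding R_def
        by (simp add: powr_realpow[symmetric] powr_powr powr_add[symmetric] algebra_simps)
      then show ?thesis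
        using c by (simp add: mult.assoc[symmetric] ennreal_mult'[symmetric])
    qed
    finally show ?thesis .
  qed
  have "(\<integral>\<^sup>+(z::'a). ennreal (norm z powr a) * indicator (\<Union>k::nat. S (c^k * m)) z \<partial>lborel)
    \<le> (\<integral>\<^sup>+(z::'a). (\<Sum>k. ennreal (norm z powr a) * indicator (S (c^k * m)) z) \<partial>lborel)"
  proof (intro nn_integral_mono)
    fix z :: 'a
    show "ennreal (norm z powr a) * indicator (\<Union>k::nat. S (c^k * m)) z
        \<le> (\<Sum>k. ennreal (norm z powr a) * indicator (S (c^k * m)) z)"
    proof (cases "z \<in> (\<Union>k::nat. S (c^k * m))")
      case True
      then obtain k where k: "z \<in> S (c^k * m)" by auto
      have "(\<Sum>i\<in>{k}. ennreal (norm z powr a) * indicator (S (c^i * m)) z)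
          \<le> (\<Sum>k. ennreal (norm z powr a) * indicator (S (c^k * m)) z)"
        by (rule sum_le_suminf) auto
      then show ?thesis using True k by (simp add: indicator_def)
    qed simp
  qed
  also have "\<dots> = (\<Sum>k. ennreal (R^k) * J)"
    by (subst nn_integral_suminf) (auto simp: scale)
  also have "\<dots> = (\<Sum>k. ennreal (R^k)) * J"
    by simp
  also have "(\<Sum>k. ennreal (R^k)) = ennreal (\<Sum>k. R^k)"
    using ratio c by (intro suminf_ennreal2) (auto simp: R_def intro!: summable_geometric)
  also have "ennreal (\<Sum>k. R^k) * J < \<infinity>"
    using J by (simp add: ennreal_mult_less_top)
  finally show ?thesis by (simp add: S_def)
qed

lemma nn_integral_norm_powr_outside_ball:
  fixes m b :: real
  assumes m: "0 < m" and b: "0 < b"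
  shows "(\<integral>\<^sup>+(z::'a::euclidean_space). ennreal (norm z powr (- (real DIM('a) + b))) * indicator {z. m \<le> norm z} z \<partial>lborel) < \<infinity>"
proof -
  let ?U = "\<Union>k::nat. {z::'a. 2^k * m \<le> norm z \<and> norm z \<le> 2 * (2^k * m)}"
  have "{z::'a. m \<le> norm z} \<subseteq> ?U"
  proof
    fix z :: 'a assume z: "z \<in> {z. m \<le> norm z}"
    define k where "k = nat \<lfloor>log 2 (norm z / m)\<rfloor>"
    have pos: "norm z / m \<ge> 1" using z m by simp
    then have nn: "log 2 (norm z / m) \<ge> 0" by simp
    have "real k \<le> log 2 (norm z / m)" "log 2 (norm z / m) \<le> real k + 1"
      using nn unfolding k_def by linarith+
    then have "2 powr real k \<le> norm z / m" "norm z / m \<le> 2 powr (real k + 1)"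
      using pos by (auto simp: le_log_iff log_le_iff)
    then have "2^k * m \<le> norm z" "norm z \<le> 2 * (2^k*m)"
      using m by (auto simp: powr_realpow powr_add field_simps)
    then show "z \<in> ?U" by blast
  qed
  then have "(\<integral>\<^sup>+(z::'a). ennreal (norm z powr (- (real DIM('a) + b))) * indicator {z. m \<le> norm z} z \<partial>lborel)
     \<le> (\<integral>\<^sup>+(z::'a). ennreal (norm z powr (- (real DIM('a) + b))) * indicator ?U z \<partial>lborel)"
    by (intro nn_integral_mono mult_left_mono) (auto simp: indicator_def)
  also have "\<dots> < \<infinity>"
    using m b by (intro nn_integral_norm_powr_geometric) (auto intro: powr_less_one)
  finally show ?thesis .
qed

lemma nn_integral_norm_powr_inside_ball:
  fixes m b :: real
  assumes m: "0 < m" and b: "0 < b"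
  shows "(\<integral>\<^sup>+(z::'a::euclidean_space). ennreal (norm z powr (b - real DIM('a))) * indicator {z. norm z \<le> m} z \<partial>lborel) < \<infinity>"
proof -
  let ?U = "\<Union>k::nat. {z::'a. (1/2)^k * m \<le> norm z \<and> norm z \<le> 2 * ((1/2)^k * m)}"
  have U: "z \<in> ?U" if z: "norm z \<le> m" "z \<noteq> 0" for z :: 'a
  proof -
    define k where "k = nat \<lceil>log 2 (m / norm z)\<rceil>"
    have pos: "m / norm z \<ge> 1" using z m by simp
    then have nn: "log 2 (m / norm z) \<ge> 0" by simp
    have "real k \<ge> log 2 (m / norm z)" "log 2 (m / norm z) \<ge> real k - 1"
      using nn unfolding k_def by linarith+
    then have "2 powr real k \<ge> m / norm z" "m / norm z \<ge> 2 powr (real k - 1)"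
      using pos by (auto simp: le_log_iff log_le_iff)
    then have "(1/2)^k * m \<le> norm z" "norm z \<le> 2 * ((1/2)^k*m)"
      using m z by (auto simp: powr_realpow powr_diff field_simps power_one_over)
    then show ?thesis by blast
  qed
  have "(\<integral>\<^sup>+(z::'a). ennreal (norm z powr (b - real DIM('a))) * indicator {z. norm z \<le> m} z \<partial>lborel)
     \<le> (\<integral>\<^sup>+(z::'a). ennreal (norm z powr (b - real DIM('a))) * indicator ?U z \<partial>lborel)"
  proof (intro nn_integral_mono)
    fix z :: 'a
    \<comment> \<open>The origin lies in no shell, but \<open>0 powr x = 0\<close> makes the
      integrand vanish there.\<close>
    show "ennreal (norm z powr (b - real DIM('a))) * indicator {z. norm z \<le> m} z
      \<le> ennreal (norm z powr (b - real DIM('a))) * indicator ?U z"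
      using U[of z] by (cases "z = 0") (auto simp: indicator_def)
  qed
  also have "\<dots> < \<infinity>"
    using m b by (intro nn_integral_norm_powr_geometric) (auto simp: powr_divide gr_one_powr)
  finally show ?thesis .
qed

lemma integrable_kernel_outside:
  assumes "0 < r" "0 < b"
  shows "integrable lborel (\<lambda>y::'a::euclidean_space. norm (x - y) powr (- (real DIM('a) + b)) * indicator {y. r \<le> norm (x - y)} y)"
proof (rule integrableI_nonneg)
  have "(\<integral>\<^sup>+y. ennreal (norm (x - y) powr (- (real DIM('a) + b)) * indicator {y. r \<le> norm (x - y)} y) \<partial>lborel)
    = (\<integral>\<^sup>+z. ennreal (norm (x - (x + z)) powr (- (real DIM('a) + b)) * indicator {y. r \<le> norm (x - y)} (x + z)) \<partial>lborel)"
    by (rule nn_integral_lborel_translate[symmetric]) measurable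
  also have "\<dots> = (\<integral>\<^sup>+(z::'a). ennreal (norm z powr (- (real DIM('a) + b))) * indicator {z. r \<le> norm z} z \<partial>lborel)"
    by (intro nn_integral_cong) (auto simp: indicator_def)
  also have "\<dots> < \<infinity>" using assms by (intro nn_integral_norm_powr_outside_ball) auto
  finally show "(\<integral>\<^sup>+y. ennreal (norm (x - y) powr (- (real DIM('a) + b)) * indicator {y. r \<le> norm (x - y)} y) \<partial>lborel) < \<infinity>" .
qed auto

section \<open>Projection of the kernel onto a line\<close>

lemma nn_integral_powr_tail:
  fixes c b :: real
  assumes c: "0 < c" and b: "0 < b"
  shows "(\<integral>\<^sup>+t. ennreal (t powr (- 1 - b)) * indicator {c<..} t \<partial>lborel) = ennreal (c powr (- b) / b)"
proof -
  have "(\<integral>\<^sup>+t. ennreal (t powr (- 1 - b)) * indicator {c<..} t \<partial>lborel)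
      = (\<integral>\<^sup>+t. ennreal (t powr (- 1 - b)) * indicator {c..} t \<partial>lborel)"
  proof (rule nn_integral_cong_AE)
    have "AE t in lborel. t \<noteq> c" by (rule AE_lborel_singleton)
    then show "AE t in lborel. ennreal (t powr (- 1 - b)) * indicator {c<..} t
        = ennreal (t powr (- 1 - b)) * indicator {c..} t"
      by eventually_elim (auto simp: indicator_def)
  qed
  also have "\<dots> = ennreal (0 - (- (c powr (- b) / b)))"
  proof (rule nn_integral_FTC_atLeast)
    fix t assume "c \<le> t"
    then show "((\<lambda>t. - (t powr (- b) / b)) has_real_derivative t powr (- 1 - b)) (at t)"
      using c b by (auto intro!: derivative_eq_intros simp: field_simps powr_diff powr_minus)
  next
    have "((\<lambda>t. - (t powr (- b) / b)) \<longlongrightarrow> - (0 / b)) at_top"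
      using b by (intro tendsto_intros tendsto_neg_powr filterlim_ident) auto
    then show "((\<lambda>t. - (t powr (- b) / b)) \<longlongrightarrow> 0) at_top" by simp
  qed auto
  finally show ?thesis by simp
qed

text \<open>By Cauchy-Schwarz the half-space stays outside the ball of radius
  \<open>c / (norm v + 1)\<close>; the \<open>+ 1\<close> keeps the denominator positive for
  \<open>v = 0\<close>.\<close>

lemma halfspace_kernel_finite:
  fixes v :: "'a::euclidean_space"
  assumes b: "0 < b" and c: "0 < c"
  shows "(\<integral>\<^sup>+z. ennreal (norm z powr (- (real DIM('a) + b))) * indicator {z. c < v \<bullet> z} z \<partial>lborel) < \<infinity>"
proof -
  have "(\<integral>\<^sup>+z. ennreal (norm z powr (- (real DIM('a) + b))) * indicator {z. c < v \<bullet> z} z \<partial>lborel)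
    \<le> (\<integral>\<^sup>+(z::'a). ennreal (norm z powr (- (real DIM('a) + b))) * indicator {z. c / (norm v + 1) \<le> norm z} z \<partial>lborel)"
  proof (rule nn_integral_mono, rule mult_left_mono)
    fix z :: 'a
    have "c / (norm v + 1) \<le> norm z" if "c < v \<bullet> z"
    proof -
      have "c \<le> norm v * norm z" using that norm_cauchy_schwarz[of v z] by linarith
      also have "\<dots> \<le> norm z * (norm v + 1)" by (simp add: algebra_simps)
      finally show ?thesis by (simp add: divide_le_eq add_nonneg_pos)
    qed
    then show "indicator {z. c < v \<bullet> z} z \<le> (indicator {z. c / (norm v + 1) \<le> norm z} z :: ennreal)"
      by (auto simp: indicator_def)
  qed auto
  also have "\<dots> < \<infinity>"
    using b c by (intro nn_integral_norm_powr_outside_ball) (auto simp: add_nonneg_pos)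
  finally show ?thesis .
qed

text \<open>Push the kernel measure forward along \<open>z \<mapsto> v \<bullet> z\<close>. Scaling
  shows that its tail beyond \<open>c\<close> is \<open>c powr (- b) * m\<close>, the tail of the
  density \<open>m * b * t powr (- 1 - b)\<close>, and measures on the line with equal finite tails
  coincide. No rotation or polar coordinates are involved, and \<open>v\<close> enters only through
  the mass \<open>m\<close>.\<close>

lemma nn_integral_halfspace_projection:
  fixes v :: "'a::euclidean_space" and f :: "real \<Rightarrow> ennreal"
  assumes [measurable]: "f \<in> borel_measurable borel" and b: "0 < b" and h: "0 < h"
  defines "m \<equiv> (\<integral>\<^sup>+z. ennreal (norm z powr (- (real DIM('a) + b))) * indicator {z. 1 < v \<bullet> z} z \<partial>lborel)"
  shows "(\<integral>\<^sup>+z. f (v \<bullet> z) * (ennreal (norm z powr (- (real DIM('a) + b))) * indicator {z. h < v \<bullet> z} z) \<partial>lborel)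
      = m * ennreal b * (\<integral>\<^sup>+t. f t * (ennreal (t powr (- 1 - b)) * indicator {h<..} t) \<partial>lborel)"
proof -
  let ?k = "\<lambda>z::'a. ennreal (norm z powr (- (real DIM('a) + b)))"
  define M where "M = distr (density lborel (\<lambda>z. ?k z * indicator {z. h < v \<bullet> z} z)) borel (\<lambda>z. v \<bullet> z)"
  define N where "N = density lborel (\<lambda>t. m * ennreal b * (ennreal (t powr (- 1 - b)) * indicator {h<..} t))"
  have scale: "(\<integral>\<^sup>+z. ?k z * indicator {z. c < v \<bullet> z} z \<partial>lborel) = ennreal (c powr (- b)) * m" if c: "0 < c" for c
  proof -
    have "(\<integral>\<^sup>+z. ?k z * indicator {z. c < v \<bullet> z} z \<partial>lborel)
      = ennreal (\<bar>c\<bar> ^ DIM('a)) * (\<integral>\<^sup>+z. ?k (c *\<^sub>R z) * indicator {z. c < v \<bullet> z} (c *\<^sub>R z) \<partial>lborel)"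
      using c by (intro nn_integral_lborel_scale) auto
    also have "(\<integral>\<^sup>+z. ?k (c *\<^sub>R z) * indicator {z. c < v \<bullet> z} (c *\<^sub>R z) \<partial>lborel)
      = (\<integral>\<^sup>+z. ennreal (c powr (- (real DIM('a) + b))) * (?k z * indicator {z. 1 < v \<bullet> z} z) \<partial>lborel)"
      using c by (intro nn_integral_cong) (auto simp: indicator_def powr_mult ennreal_mult')
    also have "\<dots> = ennreal (c powr (- (real DIM('a) + b))) * m"
      unfolding m_def by (rule nn_integral_cmult) measurable
    also have "ennreal (\<bar>c\<bar> ^ DIM('a)) * (ennreal (c powr (- (real DIM('a) + b))) * m) = ennreal (c powr (- b)) * m"
      using c by (simp add: mult.assoc[symmetric] ennreal_mult'[symmetric] powr_realpow[symmetric] powr_add[symmetric])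
    finally show ?thesis .
  qed
  have "M = N"
  proof (rule measure_eqI_lessThan)
    fix x :: real
    \<comment> \<open>Both measures are carried by \<open>{h<..}\<close>, so below \<open>h\<close>
      the tail is that of \<open>h\<close>.\<close>
    define c where "c = max x h"
    have c: "0 < c" using h by (simp add: c_def)
    have "(\<bullet>) v -` {x<..} = {z. x < v \<bullet> z}" by auto
    then have vim: "(\<bullet>) v -` {x<..} \<in> sets borel" by simp
    have "emeasure M {x<..} = (\<integral>\<^sup>+z. ?k z * indicator {z. c < v \<bullet> z} z \<partial>lborel)"
      unfolding M_def
      by (subst emeasure_distr, simp, simp, subst emeasure_density, simp, simp add: vim)
         (auto simp: indicator_def c_def intro!: nn_integral_cong)
    then have M: "emeasure M {x<..} = ennreal (c powr (- b)) * m"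
      using scale[OF c] by simp
    have "m < \<infinity>" unfolding m_def using b by (intro halfspace_kernel_finite) auto
    then show "emeasure M {x<..} < \<infinity>"
      unfolding M by (simp add: ennreal_mult_less_top)
    have "emeasure N {x<..} = (\<integral>\<^sup>+t. m * ennreal b * (ennreal (t powr (- 1 - b)) * indicator {c<..} t) \<partial>lborel)"
      unfolding N_def
      by (subst emeasure_density) (auto simp: indicator_def c_def intro!: nn_integral_cong)
    also have "\<dots> = m * ennreal b * ennreal (c powr (- b) / b)"
      by (subst nn_integral_cmult) (auto simp: nn_integral_powr_tail[OF c b])
    also have "\<dots> = m * ennreal (c powr (- b))"
      using b by (simp add: mult.assoc ennreal_mult'[symmetric])
    finally show "emeasure M {x<..} = emeasure N {x<..}"
      unfolding M by (simp add: mult.commute)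
  qed (auto simp: M_def N_def)
  have "(\<integral>\<^sup>+z. f (v \<bullet> z) * (?k z * indicator {z. h < v \<bullet> z} z) \<partial>lborel) = (\<integral>\<^sup>+t. f t \<partial>M)"
    unfolding M_def by (subst nn_integral_distr) (auto simp: nn_integral_density mult.commute)
  also have "\<dots> = (\<integral>\<^sup>+t. f t \<partial>N)" using \<open>M = N\<close> by simp
  also have "\<dots> = (\<integral>\<^sup>+t. m * ennreal b * (f t * (ennreal (t powr (- 1 - b)) * indicator {h<..} t)) \<partial>lborel)"
    unfolding N_def by (subst nn_integral_density) (auto simp: mult_ac)
  also have "\<dots> = m * ennreal b * (\<integral>\<^sup>+t. f t * (ennreal (t powr (- 1 - b)) * indicator {h<..} t) \<partial>lborel)"
    by (rule nn_integral_cmult) measurable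
  finally show ?thesis .
qed

subsection \<open>The half-line profile\<close>

text \<open>Divided by \<open>a powr s\<close>, this is the sum of the inequalities
  \<open>y \<le> y powr s\<close> for \<open>y = b / a\<close> and
  \<open>y = 1 - b / a\<close>.\<close>

lemma powr_diff_le_diff_powr:
  fixes a b s :: real
  assumes "0 \<le> b" "b \<le> a" "0 < s" "s < 1"
  shows "a powr s - b powr s \<le> (a - b) powr s"
proof (cases "a = 0")
  case True then show ?thesis using assms by simp
next
  case False
  then have a: "0 < a" using assms by simp
  define x where "x = b / a"
  have x: "0 \<le> x" "x \<le> 1" using assms a by (auto simp: x_def)
  have le: "y \<le> y powr s" if "0 \<le> y" "y \<le> 1" for y :: real
    using powr_mono'[of s 1 y] that assms by (cases "y = 0") auto
  have "1 \<le> (1 - x) powr s + x powr s" using le[of x] le[of "1-x"] x by linarith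
  then have "a powr s * 1 \<le> a powr s * ((1 - x) powr s + x powr s)"
    by (intro mult_left_mono) auto
  also have "\<dots> = (a * (1 - x)) powr s + (a * x) powr s"
    using x a by (simp add: powr_mult distrib_left)
  also have "\<dots> = (a - b) powr s + b powr s"
    using a by (simp add: x_def algebra_simps)
  finally show ?thesis by simp
qed

text \<open>The reflection \<open>z \<mapsto> d\<^sup>2 / z\<close> maps the region above \<open>d\<close> to the region below \<open>d\<close>; the difference
  of the two integrands is then the derivative of \<open>(d\<^sup>s - z\<^sup>s)\<^sup>p (d - z)\<^sup>-\<^sup>p\<^sup>s\<close> up to a factor.\<close>

lemma halfline_balance:
  fixes s p d \<epsilon> :: real
  assumes s: "0 < s" "s < 1" and p: "1 < p" and d: "0 < d" and e: "0 < \<epsilon>" "\<epsilon> < 1"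
  shows "(\<integral>\<^sup>+h. ennreal ((h powr s - d powr s) powr (p - 1) * (h - d) powr (- 1 - p * s)) * indicator {d / (1 - \<epsilon>)..} h \<partial>lborel)
    \<le> (\<integral>\<^sup>+h. ennreal ((d powr s - h powr s) powr (p - 1) * (d - h) powr (- 1 - p * s)) * indicator {0<..(1 - \<epsilon>) * d} h \<partial>lborel)
      + ennreal (d powr (- s) / (p * s))"
    (is "?R \<le> ?L + _")
proof -
  define b where "b = (1 - \<epsilon>) * d"
  have b: "0 < b" "b < d" using d e by (auto simp: b_def)
  define r where "r h = (h powr s - d powr s) powr (p - 1) * (h - d) powr (- 1 - p * s)" for h
  define l where "l z = (d powr s - z powr s) powr (p - 1) * (d - z) powr (- 1 - p * s)" for z
  have [measurable]: "r \<in> borel_measurable borel" "l \<in> borel_measurable borel"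
    unfolding r_def[abs_def] l_def[abs_def] by measurable
  have l0: "0 \<le> l z" for z by (simp add: l_def)
  have dsq: "d / (1 - \<epsilon>) = d\<^sup>2 / b" using d e by (simp add: b_def field_simps power2_eq_square)
  \<comment> \<open>The substitution is carried out on the compact interval \<open>{a..b}\<close>,
    with a bound independent of \<open>a\<close>; monotone convergence along
    \<open>a = b / Suc n\<close> then exhausts the unbounded region.\<close>
  have trunc: "(\<integral>\<^sup>+h. ennreal (r h) * indicator {d\<^sup>2 / b..d\<^sup>2 / a} h \<partial>lborel) \<le> ?L + ennreal (d powr (- s) / (p * s))"
    if a: "0 < a" "a \<le> b" for a
  proof -
    have "(\<integral>\<^sup>+h. ennreal (r h) * indicator {d\<^sup>2 / b..d\<^sup>2 / a} h \<partial>lborel)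
      = (\<integral>\<^sup>+h. ennreal (r (- h)) * indicator {- (d\<^sup>2 / a).. - (d\<^sup>2 / b)} h \<partial>lborel)"
      by (subst nn_integral_lborel_uminus[symmetric], simp, intro nn_integral_cong) (auto simp: indicator_def)
    also have "\<dots> = (\<integral>\<^sup>+h. ennreal (r (- h) * indicator {- (d\<^sup>2 / a).. - (d\<^sup>2 / b)} h) \<partial>lborel)"
      by (intro nn_integral_cong) (auto simp: indicator_def)
    \<comment> \<open>The substitution rule wants a nonnegative derivative. The decreasing map
      \<open>d\<^sup>2 / z\<close> is therefore negated, after the reflection
      \<open>h \<mapsto> - h\<close> in the previous step.\<close>
    also have "\<dots> = (\<integral>\<^sup>+z. ennreal (r (- (- (d\<^sup>2 / z))) * (d\<^sup>2 / z\<^sup>2) * indicator {a..b} z) \<partial>lborel)"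
      using a by (intro nn_integral_substitution[where g = "\<lambda>z. - (d\<^sup>2 / z)" and f = "\<lambda>h. r (- h)"])
        (auto intro!: derivative_eq_intros continuous_intros simp: set_borel_measurable_def power2_eq_square)
    also have "\<dots> = (\<integral>\<^sup>+z. ennreal (r (- (- (d\<^sup>2 / z))) * (d\<^sup>2 / z\<^sup>2)) * indicator {a..b} z \<partial>lborel)"
      by (intro nn_integral_cong) (auto simp: indicator_def)
    also have "\<dots> = (\<integral>\<^sup>+z. ennreal (l z * (z / d) powr (s - 1)) * indicator {a..b} z \<partial>lborel)"
    proof (intro nn_integral_cong)
      fix z
      have "r (d\<^sup>2 / z) * (d\<^sup>2 / z\<^sup>2) = l z * (z / d) powr (s - 1)" if "z \<in> {a..b}"
      proof -
        have z: "0 < z" "z < d" using that a b by auto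
        have 1: "(d\<^sup>2 / z) powr s - d powr s = (d / z) powr s * (d powr s - z powr s)"
          using z d by (simp add: powr_divide powr_mult power2_eq_square field_simps)
        have 2: "d\<^sup>2 / z - d = (d / z) * (d - z)"
          using z by (simp add: field_simps power2_eq_square)
        have nn: "0 \<le> d powr s - z powr s" using z s by (simp add: powr_mono2)
        have "r (d\<^sup>2 / z) = ((d / z) powr s) powr (p - 1) * (d powr s - z powr s) powr (p - 1)
            * ((d / z) powr (- 1 - p * s) * (d - z) powr (- 1 - p * s))"
        proof -
          have "((d / z) * (d - z)) powr (- 1 - p * s) = (d / z) powr (- 1 - p * s) * (d - z) powr (- 1 - p * s)"
            by (rule powr_mult)
          moreover have "((d / z) powr s * (d powr s - z powr s)) powr (p - 1) = ((d / z) powr s) powr (p - 1) * (d powr s - z powr s) powr (p - 1)"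
            by (rule powr_mult)
          ultimately show ?thesis unfolding r_def 1 2 by simp
        qed
        also have "\<dots> = l z * ((d / z) powr (s * (p - 1)) * (d / z) powr (- 1 - p * s))"
          by (simp add: l_def powr_powr)
        also have "(d / z) powr (s * (p - 1)) * (d / z) powr (- 1 - p * s) = (d / z) powr (- 1 - s)"
          by (simp add: powr_add[symmetric] algebra_simps)
        finally have "r (d\<^sup>2 / z) * (d\<^sup>2 / z\<^sup>2) = l z * ((d / z) powr (- 1 - s) * (d / z) powr 2)"
          using z d by (simp add: power_divide)
        also have "(d / z) powr (- 1 - s) * (d / z) powr 2 = (d / z) powr (- (s - 1))"
          by (simp add: powr_add[symmetric])
        also have "\<dots> = (z / d) powr (s - 1)"
          by (simp only: powr_minus powr_divide inverse_divide)
        finally show ?thesis .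
      qed
      then show "ennreal (r (- (- (d\<^sup>2 / z))) * (d\<^sup>2 / z\<^sup>2)) * indicator {a..b} z
          = ennreal (l z * (z / d) powr (s - 1)) * indicator {a..b} z"
        by (auto simp: indicator_def)
    qed
    \<comment> \<open>The weight \<open>(z / d) powr (s - 1)\<close> is at least 1 since
      \<open>z < d\<close> and \<open>s < 1\<close>. The reflected part thus exceeds
      \<open>l\<close>, and the excess is what the extra term has to cover.\<close>
    also have "\<dots> = (\<integral>\<^sup>+z. ennreal (l z) * indicator {a..b} z
         + ennreal (l z * ((z / d) powr (s - 1) - 1)) * indicator {a..b} z \<partial>lborel)"
    proof (intro nn_integral_cong)
      fix z
      have "(z / d) powr (s - 1) \<ge> 1" if "z \<in> {a..b}"
        using that a b s powr_mono2'[of "s - 1" "z / d" 1] by auto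
      then have "ennreal (l z * (z / d) powr (s - 1)) = ennreal (l z) + ennreal (l z * ((z / d) powr (s - 1) - 1))"
        if "z \<in> {a..b}"
        using l0[of z] that mult_left_mono[of 1 "(z / d) powr (s - 1)" "l z"]
        by (subst ennreal_plus[symmetric]) (auto simp: algebra_simps)
      then show "ennreal (l z * (z / d) powr (s - 1)) * indicator {a..b} z =
        ennreal (l z) * indicator {a..b} z + ennreal (l z * ((z / d) powr (s - 1) - 1)) * indicator {a..b} z"
        by (auto simp: indicator_def)
    qed
    also have "\<dots> = (\<integral>\<^sup>+z. ennreal (l z) * indicator {a..b} z \<partial>lborel)
        + (\<integral>\<^sup>+z. ennreal (l z * ((z / d) powr (s - 1) - 1)) * indicator {a..b} z \<partial>lborel)"
      by (rule nn_integral_add) auto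
    also have "\<dots> \<le> ?L + ennreal (d powr (- s) / (p * s))"
    proof (rule add_mono)
      show "(\<integral>\<^sup>+z. ennreal (l z) * indicator {a..b} z \<partial>lborel) \<le> ?L"
        using a by (intro nn_integral_mono) (auto simp: indicator_def l_def b_def)
      \<comment> \<open>An antiderivative of the excess. In \<open>F'\<close> the two product-rule
        terms share the factor \<open>l z\<close>, and what remains is
        \<open>z powr (s - 1) * (d - z) - (d powr s - z powr s)\<close>, in which
        \<open>z powr s\<close> cancels.\<close>
      define F where "F z = - ((d powr s - z powr s) powr p * (d - z) powr (- (p * s)) / (p * s * d powr s))" for z
      have "(\<integral>\<^sup>+z. ennreal (l z * ((z / d) powr (s - 1) - 1)) * indicator {a..b} z \<partial>lborel) = ennreal (F b - F a)"
      proof (rule nn_integral_FTC_Icc)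
        fix z assume z': "z \<in> {a..b}"
        then have z: "0 < z" "z < d" using a b by auto
        have ds: "0 < d powr s - z powr s" using z s by (simp add: powr_less_mono2)
        show "0 \<le> l z * ((z / d) powr (s - 1) - 1)"
          using z s powr_mono2'[of "s - 1" "z / d" 1] l0[of z] by auto
        have e1: "(d powr s - z powr s) powr p = (d powr s - z powr s) powr (p - 1) * (d powr s - z powr s)"
          using ds by (simp add: powr_diff)
        have e2: "(d - z) powr (- (p * s)) = (d - z) powr (- 1 - p * s) * (d - z)"
          using z by (simp add: powr_diff powr_minus field_simps)
        have e5: "- (p * s) - 1 = - 1 - p * s" by simp
        have e3: "(z / d) powr (s - 1) = z powr (s - 1) * d / d powr s"
          using z d by (simp add: powr_divide powr_diff field_simps)
        have e4: "z powr s = z powr (s - 1) * z"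
          using z by (simp add: powr_diff)
        have H: "((\<lambda>z. (d powr s - z powr s) powr p * (d - z) powr (- (p * s))) has_real_derivative
            ((p * (d powr s - z powr s) powr (p - 1) * (- (s * z powr (s - 1)))) * (d - z) powr (- (p * s))
             + (d powr s - z powr s) powr p * ((- (p * s)) * (d - z) powr (- (p * s) - 1) * (- 1)))) (at z)"
          using z ds by (auto intro!: derivative_eq_intros simp: algebra_simps)
        have D: "(F has_real_derivative
            (- (((p * (d powr s - z powr s) powr (p - 1) * (- (s * z powr (s - 1)))) * (d - z) powr (- (p * s))
             + (d powr s - z powr s) powr p * ((- (p * s)) * (d - z) powr (- (p * s) - 1) * (- 1))) / (p * s * d powr s)))) (at z)"
          unfolding F_def by (intro DERIV_minus DERIV_cdivide H)
        have "- (((p * (d powr s - z powr s) powr (p - 1) * (- (s * z powr (s - 1)))) * (d - z) powr (- (p * s))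
             + (d powr s - z powr s) powr p * ((- (p * s)) * (d - z) powr (- (p * s) - 1) * (- 1))) / (p * s * d powr s))
            = l z * (z powr (s - 1) * (d - z) - (d powr s - z powr s)) / d powr s"
          unfolding l_def e1 e2 e5 using s p d by (simp add: field_simps)
        also have "\<dots> = l z * ((z / d) powr (s - 1) - 1)"
          unfolding e3 e4 using d by (simp add: field_simps)
        finally show "(F has_real_derivative l z * ((z / d) powr (s - 1) - 1)) (at z)"
          using D by simp
      qed (use a in auto)
      also have "F b - F a \<le> d powr (- s) / (p * s)"
      proof -
        have "F b \<le> 0" using s p by (simp add: F_def)
        \<comment> \<open>Subadditivity gives
          \<open>(d powr s - a powr s) powr p \<le> (d - a) powr (p * s)\<close>, so the product in
          \<open>F a\<close> is at most 1, uniformly in \<open>a\<close>.\<close>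
        moreover have "- F a \<le> d powr (- s) / (p * s)"
        proof -
          have "(d powr s - a powr s) powr p \<le> ((d - a) powr s) powr p"
            using a b s p by (intro powr_mono2 powr_diff_le_diff_powr) (auto intro!: powr_mono2)
          also have "\<dots> = (d - a) powr (p * s)" by (simp add: powr_powr mult.commute)
          finally have "(d powr s - a powr s) powr p * (d - a) powr (- (p * s)) \<le> (d - a) powr (p * s) * (d - a) powr (- (p * s))"
            by (intro mult_right_mono) auto
          also have "\<dots> = 1" using a b by (simp add: powr_add[symmetric])
          finally show ?thesis unfolding F_def using s p d
            by (simp add: powr_minus field_simps divide_right_mono)
        qed
        ultimately show ?thesis by simp
      qed
      then show "(\<integral>\<^sup>+z. ennreal (l z * ((z / d) powr (s - 1) - 1)) * indicator {a..b} z \<partial>lborel) \<le> ennreal (d powr (- s) / (p * s))"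
        by (simp add: calculation ennreal_leI)
    qed
    finally show ?thesis .
  qed
  have "?R = (\<integral>\<^sup>+h. (SUP n. ennreal (r h) * indicator {d\<^sup>2 / b..d\<^sup>2 / (b / Suc n)} h) \<partial>lborel)"
  proof (intro nn_integral_cong)
    fix h
    show "ennreal ((h powr s - d powr s) powr (p - 1) * (h - d) powr (- 1 - p * s)) * indicator {d / (1 - \<epsilon>)..} h
       = (SUP n. ennreal (r h) * indicator {d\<^sup>2 / b..d\<^sup>2 / (b / Suc n)} h)"
    proof (rule antisym)
      obtain N :: nat where N: "h * b / d\<^sup>2 \<le> N" using real_arch_simple by blast
      have "h \<le> d\<^sup>2 / (b / Suc N)"
        using N b d by (simp add: field_simps add_increasing)
      then have "ennreal (r h) * indicator {d / (1 - \<epsilon>)..} h \<le> ennreal (r h) * indicator {d\<^sup>2 / b..d\<^sup>2 / (b / Suc N)} h"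
        unfolding dsq by (auto simp: indicator_def)
      also have "\<dots> \<le> (SUP n. ennreal (r h) * indicator {d\<^sup>2 / b..d\<^sup>2 / (b / Suc n)} h)"
        by (rule SUP_upper) simp
      finally show "ennreal ((h powr s - d powr s) powr (p - 1) * (h - d) powr (- 1 - p * s)) * indicator {d / (1 - \<epsilon>)..} h \<le> \<dots>"
        by (simp add: r_def)
      show "(SUP n. ennreal (r h) * indicator {d\<^sup>2 / b..d\<^sup>2 / (b / Suc n)} h)
        \<le> ennreal ((h powr s - d powr s) powr (p - 1) * (h - d) powr (- 1 - p * s)) * indicator {d / (1 - \<epsilon>)..} h"
        unfolding dsq by (intro SUP_least) (auto simp: indicator_def r_def)
    qed
  qed
  also have "\<dots> = (SUP n. (\<integral>\<^sup>+h. ennreal (r h) * indicator {d\<^sup>2 / b..d\<^sup>2 / (b / Suc n)} h \<partial>lborel))"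
  proof (rule nn_integral_monotone_convergence_SUP)
    show "incseq (\<lambda>n h. ennreal (r h) * indicator {d\<^sup>2 / b..d\<^sup>2 / (b / Suc n)} h)"
    proof (intro incseq_SucI le_funI mult_left_mono)
      fix n h
      have "d\<^sup>2 / (b / Suc n) \<le> d\<^sup>2 / (b / Suc (Suc n))" using b by (simp add: field_simps)
      then show "indicator {d\<^sup>2 / b..d\<^sup>2 / (b / Suc n)} h \<le> (indicator {d\<^sup>2 / b..d\<^sup>2 / (b / Suc (Suc n))} h :: ennreal)"
        by (auto simp: indicator_def)
    qed auto
  qed auto
  also have "\<dots> \<le> ?L + ennreal (d powr (- s) / (p * s))"
    using b by (intro SUP_least trunc) (auto simp: field_simps)
  finally show ?thesis .
qed

text \<open>The half-space formula is applied on both sides of the hyperplane, with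
  \<open>- z\<close> in place of \<open>z\<close> on the negative one; both sides have the same mass
  \<open>m\<close>. The slab between them, to which that formula does not apply, is removed by
  \<open>f0\<close>.\<close>

lemma nn_integral_kernel_projection:
  fixes v :: "'a::euclidean_space" and f :: "real \<Rightarrow> ennreal"
  assumes [measurable]: "f \<in> borel_measurable borel" and b: "0 < b" and h: "0 < h"
    and f0: "\<And>t. \<bar>t\<bar> \<le> h \<Longrightarrow> f t = 0"
  defines "m \<equiv> (\<integral>\<^sup>+z. ennreal (norm z powr (- (real DIM('a) + b))) * indicator {z. 1 < v \<bullet> z} z \<partial>lborel)"
  shows "(\<integral>\<^sup>+z. f (v \<bullet> z) * ennreal (norm z powr (- (real DIM('a) + b))) \<partial>lborel)
      = m * ennreal b * (\<integral>\<^sup>+t. f t * ennreal (\<bar>t\<bar> powr (- 1 - b)) \<partial>lborel)"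
proof -
  let ?k = "\<lambda>z::'a. ennreal (norm z powr (- (real DIM('a) + b)))"
  have "(\<integral>\<^sup>+z. f (v \<bullet> z) * ?k z \<partial>lborel)
    = (\<integral>\<^sup>+z. f (v \<bullet> z) * (?k z * indicator {z. h < v \<bullet> z} z) + f (- (v \<bullet> (- z))) * (?k (- z) * indicator {z. h < v \<bullet> z} (- z)) \<partial>lborel)"
  proof (intro nn_integral_cong)
    fix z
    show "f (v \<bullet> z) * ?k z = f (v \<bullet> z) * (?k z * indicator {z. h < v \<bullet> z} z) + f (- (v \<bullet> (- z))) * (?k (- z) * indicator {z. h < v \<bullet> z} (- z))"
      using f0[of "v \<bullet> z"] h by (cases "\<bar>v \<bullet> z\<bar> \<le> h") (auto simp: indicator_def)
  qed
  also have "\<dots> = (\<integral>\<^sup>+z. f (v \<bullet> z) * (?k z * indicator {z. h < v \<bullet> z} z) \<partial>lborel)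
      + (\<integral>\<^sup>+z. f (- (v \<bullet> (- z))) * (?k (- z) * indicator {z. h < v \<bullet> z} (- z)) \<partial>lborel)"
    by (rule nn_integral_add) measurable
  also have "(\<integral>\<^sup>+z. f (- (v \<bullet> (- z))) * (?k (- z) * indicator {z. h < v \<bullet> z} (- z)) \<partial>lborel)
      = (\<integral>\<^sup>+z. f (- (v \<bullet> z)) * (?k z * indicator {z. h < v \<bullet> z} z) \<partial>lborel)"
    by (rule nn_integral_lborel_uminus) measurable
  also have "\<dots> = m * ennreal b * (\<integral>\<^sup>+t. f (- t) * (ennreal (t powr (- 1 - b)) * indicator {h<..} t) \<partial>lborel)"
    unfolding m_def using b h by (intro nn_integral_halfspace_projection) auto
  also have "(\<integral>\<^sup>+t. f (- t) * (ennreal (t powr (- 1 - b)) * indicator {h<..} t) \<partial>lborel)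
      = (\<integral>\<^sup>+t. f (- (- t)) * (ennreal ((- t) powr (- 1 - b)) * indicator {h<..} (- t)) \<partial>lborel)"
    by (rule nn_integral_lborel_uminus[symmetric]) measurable
  also have "(\<integral>\<^sup>+z. f (v \<bullet> z) * (?k z * indicator {z. h < v \<bullet> z} z) \<partial>lborel)
      = m * ennreal b * (\<integral>\<^sup>+t. f t * (ennreal (t powr (- 1 - b)) * indicator {h<..} t) \<partial>lborel)"
    unfolding m_def using b h by (intro nn_integral_halfspace_projection) auto
  also have "m * ennreal b * (\<integral>\<^sup>+t. f t * (ennreal (t powr (- 1 - b)) * indicator {h<..} t) \<partial>lborel)
    + m * ennreal b * (\<integral>\<^sup>+t. f (- (- t)) * (ennreal ((- t) powr (- 1 - b)) * indicator {h<..} (- t)) \<partial>lborel)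
    = m * ennreal b * (\<integral>\<^sup>+t. f t * (ennreal (t powr (- 1 - b)) * indicator {h<..} t)
        + f (- (- t)) * (ennreal ((- t) powr (- 1 - b)) * indicator {h<..} (- t)) \<partial>lborel)"
    by (subst nn_integral_add) (auto simp: distrib_left)
  also have "(\<integral>\<^sup>+t. f t * (ennreal (t powr (- 1 - b)) * indicator {h<..} t)
        + f (- (- t)) * (ennreal ((- t) powr (- 1 - b)) * indicator {h<..} (- t)) \<partial>lborel)
    = (\<integral>\<^sup>+t. f t * ennreal (\<bar>t\<bar> powr (- 1 - b)) \<partial>lborel)"
  proof (intro nn_integral_cong)
    fix t
    show "f t * (ennreal (t powr (- 1 - b)) * indicator {h<..} t)
        + f (- (- t)) * (ennreal ((- t) powr (- 1 - b)) * indicator {h<..} (- t)) = f t * ennreal (\<bar>t\<bar> powr (- 1 - b))"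
      using f0[of t] h by (cases "\<bar>t\<bar> \<le> h") (auto simp: indicator_def)
  qed
  finally show ?thesis .
qed

section \<open>Signed powers and the cut-off profile on the line\<close>

lemma spow_nonneg_eq: "0 \<le> a \<Longrightarrow> spow a q = a powr q"
  by (cases "a = 0") (auto simp: spow_def powr_diff)

lemma spow_minus: "spow (- a) q = - spow a q"
  by (simp add: spow_def)

lemma abs_spow: "\<bar>spow a q\<bar> = \<bar>a\<bar> powr q"
  by (cases "a = 0") (auto simp: spow_def powr_diff abs_mult)

lemma spow_nonpos_eq: "a \<le> 0 \<Longrightarrow> spow a q = - ((- a) powr q)"
  using spow_nonneg_eq[of "- a" q] spow_minus[of a q] by simp

lemma spow_mono:
  assumes "a \<le> b" "0 \<le> q" shows "spow a q \<le> spow b q"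
proof (cases "0 \<le> a")
  case True then show ?thesis using assms by (simp add: spow_nonneg_eq powr_mono2)
next
  case a: False
  show ?thesis
  proof (cases "0 \<le> b")
    case True
    then have "spow a q \<le> 0" "0 \<le> spow b q" using a by (auto simp: spow_nonneg_eq spow_nonpos_eq)
    then show ?thesis by simp
  next
    case False
    then show ?thesis using a assms by (simp add: spow_nonpos_eq powr_mono2)
  qed
qed

lemma spow_cmult: "0 \<le> c \<Longrightarrow> spow (c * a) q = c powr q * spow a q"
  by (cases "c = 0") (auto simp: spow_def abs_mult powr_mult powr_diff)

lemma spow_measurable [measurable]:
  "f \<in> borel_measurable M \<Longrightarrow> (\<lambda>x. spow (f x) q) \<in> borel_measurable M"
  unfolding spow_def by measurable

definition trunc_powr :: "real \<Rightarrow> real \<Rightarrow> real \<Rightarrow> real" where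
  "trunc_powr \<rho> s h = min (max h 0) \<rho> powr s"

lemma trunc_powr_measurable [measurable]: "trunc_powr \<rho> s \<in> borel_measurable borel"
  unfolding trunc_powr_def[abs_def] by measurable

lemma trunc_powr_bounds: "0 < \<rho> \<Longrightarrow> 0 < s \<Longrightarrow> 0 \<le> trunc_powr \<rho> s h \<and> trunc_powr \<rho> s h \<le> \<rho> powr s"
  by (auto simp: trunc_powr_def intro!: powr_mono2)

lemma trunc_powr_mono: "0 < \<rho> \<Longrightarrow> 0 < s \<Longrightarrow> h \<le> h' \<Longrightarrow> trunc_powr \<rho> s h \<le> trunc_powr \<rho> s h'"
  by (auto simp: trunc_powr_def intro!: powr_mono2)

lemma abs_trunc_powr_diff_le:
  assumes "0 < \<rho>" "0 < s" "s < 1"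
  shows "\<bar>trunc_powr \<rho> s h - trunc_powr \<rho> s h'\<bar> \<le> \<bar>h - h'\<bar> powr s"
proof -
  have "trunc_powr \<rho> s h - trunc_powr \<rho> s h' \<le> \<bar>h - h'\<bar> powr s" if "h' \<le> h" for h h'
  proof -
    define a where "a = min (max h 0) \<rho>"
    define b where "b = min (max h' 0) \<rho>"
    have ab: "0 \<le> b" "b \<le> a" "a - b \<le> \<bar>h - h'\<bar>" using that assms by (auto simp: a_def b_def)
    have "a powr s - b powr s \<le> (a - b) powr s"
      using ab assms by (intro powr_diff_le_diff_powr) auto
    also have "\<dots> \<le> \<bar>h - h'\<bar> powr s" using ab assms by (intro powr_mono2) auto
    finally show ?thesis by (simp add: trunc_powr_def a_def b_def)
  qed
  from this[of h' h] this[of h h'] trunc_powr_mono[OF assms(1,2), of h h'] trunc_powr_mono[OF assms(1,2), of h' h]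
  show ?thesis by (cases "h \<le> h'") (auto simp: abs_real_def abs_minus_commute)
qed

text \<open>Here \<open>d\<close> is the height of the centre and \<open>d + t\<close> that of the
  other point. The interval on which the value is 0 says \<open>(1 - \<epsilon>) * d < d + t\<close>
  and \<open>(1 - \<epsilon>) * (d + t) < d\<close>, a condition symmetric in the two
  heights.\<close>

definition barrier_jump :: "real \<Rightarrow> real \<Rightarrow> real \<Rightarrow> real \<Rightarrow> real \<Rightarrow> real \<Rightarrow> real" where
  "barrier_jump \<rho> s p d \<epsilon> t = (if - (\<epsilon> * d) < t \<and> t < \<epsilon> * d / (1 - \<epsilon>) then 0
     else spow (d powr s - trunc_powr \<rho> s (d + t)) (p - 1))"

lemma barrier_jump_measurable [measurable]: "barrier_jump \<rho> s p d \<epsilon> \<in> borel_measurable borel"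
  unfolding barrier_jump_def[abs_def] by measurable

text \<open>A continuous positive function on a compact interval has a positive minimum. This treats
  \<open>q < 1\<close> and \<open>q \<ge> 1\<close> alike, as needed for
  \<open>q = p - 1\<close>.\<close>

lemma ex_powr_increment_bound:
  fixes q \<delta> :: real
  assumes q: "0 < q" and d: "0 < \<delta>"
  shows "\<exists>m>0. \<forall>\<beta>\<in>{0..1}. \<beta> powr q + m \<le> (\<beta> + \<delta>) powr q"
proof -
  have "continuous_on {0..1} (\<lambda>\<beta>::real. (\<beta> + \<delta>) powr q - \<beta> powr q)"
    using q d by (intro continuous_intros continuous_on_powr') auto
  then obtain b :: real where b: "b \<in> {0..1}" "\<forall>\<beta>\<in>{0..1}. (b + \<delta>) powr q - b powr q \<le> (\<beta> + \<delta>) powr q - \<beta> powr q"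
    using continuous_attains_inf[of "{0..1::real}" "\<lambda>\<beta>::real. (\<beta> + \<delta>) powr q - \<beta> powr q"] by auto
  have "b powr q < (b + \<delta>) powr q" using b q d by (intro powr_less_mono2) auto
  with b show ?thesis by (intro exI[of _ "(b + \<delta>) powr q - b powr q"]) force
qed

text \<open>At heights up to \<open>d < \<rho>\<close> the cut-off profile is the full one, so the
  positive part is unchanged. Above \<open>d\<close> the cutoff only shrinks the negative part, and
  on \<open>{2 * \<rho>..3 * \<rho>}\<close> by a definite amount. Positive and negative parts are
  kept as separate nonnegative integrals, the form in which the projection formula applies to
  them.\<close>

lemma barrier_jump_balance:
  fixes s p :: real
  assumes s: "0 < s" "s < 1" and p: "1 < p"
  shows "\<exists>c>0. \<forall>\<rho> d \<epsilon>. 0 < d \<longrightarrow> d < \<rho> \<longrightarrow> 0 < \<epsilon> \<longrightarrow> \<epsilon> \<le> 1/2 \<longrightarrow>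
     (\<integral>\<^sup>+t. ennreal (- barrier_jump \<rho> s p d \<epsilon> t) * ennreal (\<bar>t\<bar> powr (- 1 - p * s)) \<partial>lborel) + ennreal (c * \<rho> powr (- s))
     \<le> (\<integral>\<^sup>+t. ennreal (barrier_jump \<rho> s p d \<epsilon> t) * ennreal (\<bar>t\<bar> powr (- 1 - p * s)) \<partial>lborel)"
proof -
  have "(1::real) < 2 powr s" using s by (simp add: gr_one_powr)
  then obtain m where m: "m > 0" "\<forall>\<beta>\<in>{0..1}. \<beta> powr (p - 1) + m \<le> (\<beta> + (2 powr s - 1)) powr (p - 1)"
    using ex_powr_increment_bound[of "p - 1" "2 powr s - 1"] p by auto
  define c where "c = m * 3 powr (- 1 - p * s)"
  have ps: "0 < p * s" using s p by simp
  show ?thesis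
  proof (intro exI[of _ c] conjI allI impI)
    show "c > 0" using m by (simp add: c_def)
    fix \<rho> d \<epsilon> :: real
    assume d: "0 < d" "d < \<rho>" and e: "0 < \<epsilon>" "\<epsilon> \<le> 1/2"
    let ?T = "trunc_powr \<rho> s"
    let ?J = "barrier_jump \<rho> s p d \<epsilon>"
    let ?b = "- 1 - p * s"
    have rho: "0 < \<rho>" using d by simp
    have Td: "?T d = d powr s" using d by (simp add: trunc_powr_def)
    have eq1: "d + \<epsilon> * d / (1 - \<epsilon>) = d / (1 - \<epsilon>)" using e by (simp add: field_simps)
    have neg: "(\<integral>\<^sup>+t. ennreal (- ?J t) * ennreal (\<bar>t\<bar> powr ?b) \<partial>lborel)
      \<le> (\<integral>\<^sup>+h. ennreal ((?T h - d powr s) powr (p - 1) * (h - d) powr ?b) * indicator {d / (1 - \<epsilon>)..} h \<partial>lborel)"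
    proof -
      have "(\<integral>\<^sup>+t. ennreal (- ?J t) * ennreal (\<bar>t\<bar> powr ?b) \<partial>lborel)
        \<le> (\<integral>\<^sup>+t. ennreal ((?T (d + t) - d powr s) powr (p - 1) * ((d + t) - d) powr ?b) * indicator {d / (1 - \<epsilon>)..} (d + t) \<partial>lborel)"
      proof (intro nn_integral_mono)
        fix t
        consider "t \<le> - (\<epsilon> * d)" | "- (\<epsilon> * d) < t" "t < \<epsilon> * d / (1 - \<epsilon>)" | "\<epsilon> * d / (1 - \<epsilon>) \<le> t" "- (\<epsilon> * d) < t"
          by linarith
        then show "ennreal (- ?J t) * ennreal (\<bar>t\<bar> powr ?b)
          \<le> ennreal ((?T (d + t) - d powr s) powr (p - 1) * ((d + t) - d) powr ?b) * indicator {d / (1 - \<epsilon>)..} (d + t)"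
        proof cases
          case 1
          have "t \<le> 0" using 1 e d by (meson le_minus_iff mult_nonneg_nonneg less_imp_le neg_0_le_iff_le order_trans)
          then have "?T (d + t) \<le> d powr s" using trunc_powr_mono[OF rho s(1), of "d + t" d] Td by simp
          then have "0 \<le> ?J t" using 1 by (simp add: barrier_jump_def spow_nonneg_eq)
          then show ?thesis by (simp add: ennreal_neg)
        next
          case 2
          then show ?thesis by (simp add: barrier_jump_def)
        next
          case 3
          have "0 < \<epsilon> * d / (1 - \<epsilon>)" using e d by simp
          then have t: "0 < t" using 3 by linarith
          have "d powr s \<le> ?T (d + t)" using trunc_powr_mono[OF rho s(1), of d "d + t"] Td t by simp
          then have "- ?J t = (?T (d + t) - d powr s) powr (p - 1)"
            using 3 by (simp add: barrier_jump_def spow_nonpos_eq)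
          moreover have "d / (1 - \<epsilon>) \<le> d + t" using 3 eq1 by linarith
          ultimately show ?thesis using t by (simp add: ennreal_mult')
        qed
      qed
      also have "\<dots> = (\<integral>\<^sup>+h. ennreal ((?T h - d powr s) powr (p - 1) * (h - d) powr ?b) * indicator {d / (1 - \<epsilon>)..} h \<partial>lborel)"
        by (rule nn_integral_lborel_translate) measurable
      finally show ?thesis .
    qed
    have gain: "(\<integral>\<^sup>+h. ennreal ((?T h - d powr s) powr (p - 1) * (h - d) powr ?b) * indicator {d / (1 - \<epsilon>)..} h \<partial>lborel)
        + ennreal (c * \<rho> powr (- s))
      \<le> (\<integral>\<^sup>+h. ennreal ((h powr s - d powr s) powr (p - 1) * (h - d) powr ?b) * indicator {d / (1 - \<epsilon>)..} h \<partial>lborel)"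
    proof -
      \<comment> \<open>A lower bound for the saving on \<open>{2 * \<rho>..3 * \<rho>}\<close>: the
        powers of the differences are at least \<open>m * \<rho> powr (s * (p - 1))\<close> apart,
        and \<open>h - d \<le> 3 * \<rho>\<close> bounds the kernel from below. Times the length
        \<open>\<rho>\<close> this is \<open>c * \<rho> powr (- s)\<close>.\<close>
      define G where "G = m * \<rho> powr (s * (p - 1)) * (3 * \<rho>) powr ?b"
      have G0: "0 \<le> G" using m by (simp add: G_def)
      have "ennreal (c * \<rho> powr (- s)) = (\<integral>\<^sup>+h. ennreal G * indicator {2 * \<rho>..3 * \<rho>} h \<partial>lborel)"
      proof -
        have "(\<integral>\<^sup>+h. ennreal G * indicator {2 * \<rho>..3 * \<rho>} h \<partial>lborel) = ennreal (G * \<rho>)"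
          using rho G0 by (subst nn_integral_cmult_indicator) (auto simp: ennreal_mult')
        moreover have "G * \<rho> = c * (\<rho> powr (s * (p - 1)) * \<rho> powr ?b * \<rho> powr 1)"
          using rho by (simp add: G_def c_def powr_mult)
        moreover have "\<rho> powr (s * (p - 1)) * \<rho> powr ?b * \<rho> powr 1 = \<rho> powr (- s)"
          by (simp only: powr_add[symmetric]) (simp add: algebra_simps)
        ultimately show ?thesis by simp
      qed
      then have "(\<integral>\<^sup>+h. ennreal ((?T h - d powr s) powr (p - 1) * (h - d) powr ?b) * indicator {d / (1 - \<epsilon>)..} h \<partial>lborel)
          + ennreal (c * \<rho> powr (- s))
        = (\<integral>\<^sup>+h. ennreal ((?T h - d powr s) powr (p - 1) * (h - d) powr ?b) * indicator {d / (1 - \<epsilon>)..} h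
           + ennreal G * indicator {2 * \<rho>..3 * \<rho>} h \<partial>lborel)"
        by (subst nn_integral_add) auto
      also have "\<dots> \<le> (\<integral>\<^sup>+h. ennreal ((h powr s - d powr s) powr (p - 1) * (h - d) powr ?b) * indicator {d / (1 - \<epsilon>)..} h \<partial>lborel)"
      proof (rule nn_integral_mono)
        fix h
        have low: "(?T h - d powr s) powr (p - 1) \<le> (h powr s - d powr s) powr (p - 1)" if "d / (1 - \<epsilon>) \<le> h"
        proof -
          have "d \<le> d / (1 - \<epsilon>)" using d e by (simp add: field_simps)
          then have h: "d \<le> h" using that by linarith
          have "d powr s \<le> ?T h" using trunc_powr_mono[OF rho s(1) h] Td by simp
          moreover have "?T h \<le> h powr s" using h d s by (auto simp: trunc_powr_def intro!: powr_mono2)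
          ultimately show ?thesis using p by (intro powr_mono2) auto
        qed
        have high: "(?T h - d powr s) powr (p - 1) * (h - d) powr ?b + G \<le> (h powr s - d powr s) powr (p - 1) * (h - d) powr ?b
            \<and> d / (1 - \<epsilon>) \<le> h" if h: "2 * \<rho> \<le> h" "h \<le> 3 * \<rho>"
        proof
          have "d / (1 - \<epsilon>) \<le> 2 * d" using d e by (simp add: field_simps)
          then show "d / (1 - \<epsilon>) \<le> h" using h d by linarith
          have T: "?T h = \<rho> powr s" using h rho by (simp add: trunc_powr_def)
          \<comment> \<open>Normalising by \<open>\<rho> powr s\<close> turns the cut-off difference
            into \<open>\<beta>\<close> and the full one, for \<open>h \<ge> 2 * \<rho>\<close>,
            into at least \<open>\<beta> + (2 powr s - 1)\<close>. Since \<open>\<beta>\<close>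
            ranges over \<open>{0..1}\<close>, the minimum \<open>m\<close> applies uniformly in
            \<open>d\<close>.\<close>
          define \<beta> where "\<beta> = 1 - (d / \<rho>) powr s"
          have beta: "\<beta> \<in> {0..1}" using d s powr_mono2[of s "d / \<rho>" 1] by (auto simp: \<beta>_def)
          have B: "\<rho> powr s - d powr s = \<rho> powr s * \<beta>"
            using d by (simp add: \<beta>_def powr_divide field_simps)
          have "(2 * \<rho>) powr s \<le> h powr s" using h rho s by (intro powr_mono2) auto
          moreover have "(2 * \<rho>) powr s - d powr s = \<rho> powr s * (\<beta> + (2 powr s - 1))"
            using d by (simp add: \<beta>_def powr_divide powr_mult field_simps)
          ultimately have A: "\<rho> powr s * (\<beta> + (2 powr s - 1)) \<le> h powr s - d powr s" by linarith
          have "(?T h - d powr s) powr (p - 1) + \<rho> powr (s * (p - 1)) * m = \<rho> powr (s * (p - 1)) * (\<beta> powr (p - 1) + m)"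
            unfolding T B by (simp add: powr_mult powr_powr distrib_left)
          also have "\<dots> \<le> \<rho> powr (s * (p - 1)) * (\<beta> + (2 powr s - 1)) powr (p - 1)"
            using m beta by (intro mult_left_mono) auto
          also have "\<dots> = (\<rho> powr s * (\<beta> + (2 powr s - 1))) powr (p - 1)"
            by (simp add: powr_mult powr_powr)
          also have "\<dots> \<le> (h powr s - d powr s) powr (p - 1)"
            using A p beta \<open>(1::real) < 2 powr s\<close> by (intro powr_mono2) auto
          finally have "((?T h - d powr s) powr (p - 1) + \<rho> powr (s * (p - 1)) * m) * (h - d) powr ?b
              \<le> (h powr s - d powr s) powr (p - 1) * (h - d) powr ?b"
            by (intro mult_right_mono) auto
          moreover have "G \<le> \<rho> powr (s * (p - 1)) * m * (h - d) powr ?b"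
          proof -
            have "(3 * \<rho>) powr ?b \<le> (h - d) powr ?b" using h d ps by (intro powr_mono2') auto
            then show ?thesis unfolding G_def using m by (simp add: mult.commute mult_left_mono)
          qed
          ultimately show "(?T h - d powr s) powr (p - 1) * (h - d) powr ?b + G \<le> (h powr s - d powr s) powr (p - 1) * (h - d) powr ?b"
            by (simp add: distrib_right)
        qed
        show "ennreal ((?T h - d powr s) powr (p - 1) * (h - d) powr ?b) * indicator {d / (1 - \<epsilon>)..} h
           + ennreal G * indicator {2 * \<rho>..3 * \<rho>} h
           \<le> ennreal ((h powr s - d powr s) powr (p - 1) * (h - d) powr ?b) * indicator {d / (1 - \<epsilon>)..} h"
        proof (cases "h \<in> {2 * \<rho>..3 * \<rho>}")
          case True
          then show ?thesis using high G0
            by (auto simp: indicator_def ennreal_plus[symmetric] simp del: ennreal_plus intro!: ennreal_leI)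
        next
          case False
          then show ?thesis using low by (auto simp: indicator_def intro!: ennreal_leI mult_right_mono)
        qed
      qed
      finally show ?thesis .
    qed
    have pos: "(\<integral>\<^sup>+h. ennreal ((d powr s - h powr s) powr (p - 1) * (d - h) powr ?b) * indicator {0<..(1 - \<epsilon>) * d} h \<partial>lborel)
      + ennreal (d powr (- s) / (p * s)) \<le> (\<integral>\<^sup>+t. ennreal (?J t) * ennreal (\<bar>t\<bar> powr ?b) \<partial>lborel)"
    proof -
      \<comment> \<open>The error term of \<open>halfline_balance\<close> is exactly the
        contribution of the negative heights: there the profile is 0, the jump is
        \<open>d powr (s * (p - 1))\<close>, and \<open>t < - d\<close>.\<close>
      have "ennreal (d powr (- s) / (p * s)) = ennreal (d powr (s * (p - 1))) * ennreal (d powr (- (p * s)) / (p * s))"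
        using ps by (simp add: ennreal_mult'[symmetric] powr_add[symmetric] algebra_simps)
      also have "\<dots> = (\<integral>\<^sup>+t. ennreal (d powr (s * (p - 1))) * (ennreal (t powr (- 1 - p * s)) * indicator {d<..} t) \<partial>lborel)"
        using nn_integral_powr_tail[OF d(1) ps] by (simp add: nn_integral_cmult)
      also have "\<dots> = (\<integral>\<^sup>+t. ennreal (d powr (s * (p - 1))) * (ennreal ((- t) powr (- 1 - p * s)) * indicator {d<..} (- t)) \<partial>lborel)"
        by (rule nn_integral_lborel_uminus[symmetric]) measurable
      finally have 1: "ennreal (d powr (- s) / (p * s)) = \<dots>" .
      have 2: "(\<integral>\<^sup>+h. ennreal ((d powr s - h powr s) powr (p - 1) * (d - h) powr ?b) * indicator {0<..(1 - \<epsilon>) * d} h \<partial>lborel)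
        = (\<integral>\<^sup>+t. ennreal ((d powr s - (d + t) powr s) powr (p - 1) * (d - (d + t)) powr ?b) * indicator {0<..(1 - \<epsilon>) * d} (d + t) \<partial>lborel)"
        by (rule nn_integral_lborel_translate[symmetric]) measurable
      have "(\<integral>\<^sup>+h. ennreal ((d powr s - h powr s) powr (p - 1) * (d - h) powr ?b) * indicator {0<..(1 - \<epsilon>) * d} h \<partial>lborel)
        + ennreal (d powr (- s) / (p * s))
        = (\<integral>\<^sup>+t. ennreal ((d powr s - (d + t) powr s) powr (p - 1) * (d - (d + t)) powr ?b) * indicator {0<..(1 - \<epsilon>) * d} (d + t)
           + ennreal (d powr (s * (p - 1))) * (ennreal ((- t) powr (- 1 - p * s)) * indicator {d<..} (- t)) \<partial>lborel)"
        unfolding 1 2 by (rule nn_integral_add[symmetric]) measurable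
      also have "\<dots> \<le> (\<integral>\<^sup>+t. ennreal (?J t) * ennreal (\<bar>t\<bar> powr ?b) \<partial>lborel)"
      proof (rule nn_integral_mono)
        fix t
        have ed: "\<epsilon> * d \<le> d" using e d by simp
        have t1: "?J t = spow (d powr s - ?T (d + t)) (p - 1)" if "t \<le> - (\<epsilon> * d)"
          using that by (simp add: barrier_jump_def)
        consider "d < - t" | "0 < d + t" "d + t \<le> (1 - \<epsilon>) * d" | "d + t = 0" | "(1 - \<epsilon>) * d < d + t"
          by linarith
        then show "ennreal ((d powr s - (d + t) powr s) powr (p - 1) * (d - (d + t)) powr ?b) * indicator {0<..(1 - \<epsilon>) * d} (d + t)
           + ennreal (d powr (s * (p - 1))) * (ennreal ((- t) powr (- 1 - p * s)) * indicator {d<..} (- t))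
           \<le> ennreal (?J t) * ennreal (\<bar>t\<bar> powr ?b)"
        proof cases
          case 1
          then have "t \<le> - (\<epsilon> * d)" using ed by linarith
          then have "?J t = d powr (s * (p - 1))"
            using t1 1 rho s d by (simp add: trunc_powr_def spow_nonneg_eq powr_powr)
          then show ?thesis using 1 d by (simp add: indicator_def)
        next
          case 2
          then have t: "t \<le> - (\<epsilon> * d)" "t < 0" using e d by (auto simp: algebra_simps) (smt (verit) mult_pos_pos)
          have "?T (d + t) = (d + t) powr s" using 2 t d by (simp add: trunc_powr_def)
          moreover have "(d + t) powr s \<le> d powr s" using 2 t s by (intro powr_mono2) auto
          ultimately have "?J t = (d powr s - (d + t) powr s) powr (p - 1)"
            using t1 t by (simp add: spow_nonneg_eq)
          then show ?thesis using 2 t d by (simp add: indicator_def ennreal_mult')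
        next
          case 3
          then show ?thesis by (auto simp: indicator_def)
        next
          case 4
          have "0 < (1 - \<epsilon>) * d" using e d by simp
          then have "\<not> d < - t" using 4 by linarith
          then show ?thesis using 4 by (auto simp: indicator_def)
        qed
      qed
      finally show ?thesis .
    qed
    have "(\<integral>\<^sup>+t. ennreal (- ?J t) * ennreal (\<bar>t\<bar> powr ?b) \<partial>lborel) + ennreal (c * \<rho> powr (- s))
      \<le> (\<integral>\<^sup>+h. ennreal ((?T h - d powr s) powr (p - 1) * (h - d) powr ?b) * indicator {d / (1 - \<epsilon>)..} h \<partial>lborel)
        + ennreal (c * \<rho> powr (- s))"
      using neg by (rule add_right_mono)
    also note gain
    also note halfline_balance[OF s p d(1) e(1)]
    also note pos
    finally show "(\<integral>\<^sup>+t. ennreal (- ?J t) * ennreal (\<bar>t\<bar> powr ?b) \<partial>lborel) + ennreal (c * \<rho> powr (- s))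
      \<le> (\<integral>\<^sup>+t. ennreal (?J t) * ennreal (\<bar>t\<bar> powr ?b) \<partial>lborel)"
      using e by simp
  qed
qed

section \<open>From the half-line to half-spaces and paraboloids\<close>

lemma distr_lborel_shear:
  fixes e :: "'a::euclidean_space" and f :: "'a \<Rightarrow> real"
  assumes [measurable]: "f \<in> borel_measurable borel"
    and e: "norm e = 1" and f: "\<And>y t. f (y + t *\<^sub>R e) = f y"
  shows "distr lborel borel (\<lambda>y. y + f y *\<^sub>R e) = lborel"
proof (rule measure_eqI)
  fix A :: "'a set" assume "A \<in> sets (distr lborel borel (\<lambda>y. y + f y *\<^sub>R e))"
  then have [measurable]: "A \<in> sets borel" by simp
  have "emeasure (distr lborel borel (\<lambda>y. y + f y *\<^sub>R e)) A
    = (\<integral>\<^sup>+y. indicator A y \<partial>distr lborel borel (\<lambda>y. y + f y *\<^sub>R e))" by simp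
  also have "\<dots> = (\<integral>\<^sup>+y. indicator A (y + f y *\<^sub>R e) \<partial>lborel)"
    by (rule nn_integral_distr) auto
  also have "\<dots> = (\<integral>\<^sup>+y. indicator A y \<partial>lborel)"
    by (rule nn_integral_lborel_shear[OF _ assms(1) e f]) auto
  finally show "emeasure (distr lborel borel (\<lambda>y. y + f y *\<^sub>R e)) A = emeasure lborel A" by simp
qed simp

text \<open>For a unit vector \<open>e\<close> this is the squared norm of the part of
  \<open>y\<close> orthogonal to \<open>e\<close>, by Pythagoras.\<close>

definition tang_sq :: "'a::euclidean_space \<Rightarrow> 'a \<Rightarrow> real" where
  "tang_sq e y = y \<bullet> y - (y \<bullet> e)\<^sup>2"

lemma tang_sq_measurable [measurable]: "tang_sq e \<in> borel_measurable borel"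
  unfolding tang_sq_def[abs_def] by measurable

lemma tang_sq_shift: "norm e = 1 \<Longrightarrow> tang_sq e (y + t *\<^sub>R e) = tang_sq e y"
  by (simp add: tang_sq_def inner_add_left inner_add_right inner_commute norm_eq_1 power2_eq_square algebra_simps)

lemma tang_sq_bounds:
  assumes "norm e = 1" shows "0 \<le> tang_sq e y" "tang_sq e y \<le> (norm y)\<^sup>2"
proof -
  have "\<bar>y \<bullet> e\<bar> \<le> norm y" using Cauchy_Schwarz_ineq2[of y e] assms by simp
  then have "(y \<bullet> e)\<^sup>2 \<le> (norm y)\<^sup>2" by (metis abs_le_square_iff abs_norm_cancel)
  then show "0 \<le> tang_sq e y" "tang_sq e y \<le> (norm y)\<^sup>2"
    by (auto simp: tang_sq_def power2_norm_eq_inner)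
qed

text \<open>The first bound beats the kernel singularity once a factor \<open>norm z\<close> is
  gained, the second controls large distances, and the third makes every integral with fixed
  \<open>\<epsilon>\<close> absolutely convergent.\<close>

lemma barrier_jump_bounds:
  assumes s: "0 < s" "s < 1" and p: "1 < p" and d: "0 < d" "d < \<rho>" and e: "0 < \<epsilon>" "\<epsilon> \<le> 1/2"
  shows "\<bar>barrier_jump \<rho> s p d \<epsilon> t\<bar> \<le> \<bar>t\<bar> powr (s * (p - 1))"
    and "\<bar>barrier_jump \<rho> s p d \<epsilon> t\<bar> \<le> \<rho> powr (s * (p - 1))"
    and "\<bar>t\<bar> \<le> \<epsilon> * d / 2 \<Longrightarrow> barrier_jump \<rho> s p d \<epsilon> t = 0"
proof -
  have rho: "0 < \<rho>" using d by simp
  have Td: "trunc_powr \<rho> s d = d powr s" using d by (simp add: trunc_powr_def)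
  have J: "\<bar>barrier_jump \<rho> s p d \<epsilon> t\<bar> \<le> \<bar>trunc_powr \<rho> s d - trunc_powr \<rho> s (d + t)\<bar> powr (p - 1)"
    by (simp add: barrier_jump_def abs_spow Td)
  also have "\<dots> \<le> (\<bar>t\<bar> powr s) powr (p - 1)"
    using abs_trunc_powr_diff_le[OF rho s, of d "d + t"] p by (intro powr_mono2) auto
  finally show "\<bar>barrier_jump \<rho> s p d \<epsilon> t\<bar> \<le> \<bar>t\<bar> powr (s * (p - 1))" by (simp add: powr_powr)
  note J
  also have "\<bar>trunc_powr \<rho> s d - trunc_powr \<rho> s (d + t)\<bar> powr (p - 1) \<le> (\<rho> powr s) powr (p - 1)"
    using trunc_powr_bounds[OF rho s(1), of d] trunc_powr_bounds[OF rho s(1), of "d + t"] p by (intro powr_mono2) auto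
  finally show "\<bar>barrier_jump \<rho> s p d \<epsilon> t\<bar> \<le> \<rho> powr (s * (p - 1))" by (simp add: powr_powr)
  assume t: "\<bar>t\<bar> \<le> \<epsilon> * d / 2"
  have pos: "0 < \<epsilon> * d" using e d by simp
  then have "\<epsilon> * d \<le> \<epsilon> * d / (1 - \<epsilon>)" using e d by (simp add: le_divide_eq mult_left_le)
  then show "barrier_jump \<rho> s p d \<epsilon> t = 0" using t pos by (auto simp: barrier_jump_def)
qed

lemma powr_neg_diff_le:
  fixes x y a :: real
  assumes "0 < y" "y / 2 \<le> x" "0 < a"
  shows "\<bar>x powr (- a) - y powr (- a)\<bar> \<le> a * (y / 2) powr (- a - 1) * \<bar>x - y\<bar>"
proof -
  have x: "0 < x" using assms by linarith
  have main: "\<bar>u powr (- a) - w powr (- a)\<bar> \<le> a * (y / 2) powr (- a - 1) * \<bar>u - w\<bar>"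
    if uw: "u < w" "y / 2 \<le> u" for u w
  proof -
    have u: "0 < u" using uw assms by linarith
    obtain z where z: "u < z" "z < w" "w powr (- a) - u powr (- a) = (w - u) * ((- a) * z powr (- a - 1))"
    proof -
      have "((\<lambda>x. x powr (- a)) has_real_derivative (- a) * x powr (- a - 1)) (at x)" if "u \<le> x" for x
        using that u by (auto intro!: derivative_eq_intros)
      then show ?thesis
        using MVT2[of u w "\<lambda>x. x powr (- a)" "\<lambda>x. (- a) * x powr (- a - 1)"] uw that by blast
    qed
    have "z powr (- a - 1) \<le> (y / 2) powr (- a - 1)"
      using z uw assms by (intro powr_mono2') auto
    then have "a * z powr (- a - 1) * \<bar>u - w\<bar> \<le> a * (y / 2) powr (- a - 1) * \<bar>u - w\<bar>"
      using assms by (intro mult_right_mono mult_left_mono) auto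
    moreover have "\<bar>u powr (- a) - w powr (- a)\<bar> = a * z powr (- a - 1) * \<bar>u - w\<bar>"
      using z(3) uw assms
      by (simp add: abs_minus_commute[of "u powr (- a)"] abs_minus_commute[of u] abs_mult mult.commute mult.left_commute)
    ultimately show ?thesis by simp
  qed
  consider "x < y" | "x = y" | "y < x" by linarith
  then show ?thesis
  proof cases
    case 1 then show ?thesis using main[of x y] assms by simp
  next
    case 3 then show ?thesis using main[of y x] assms by (simp add: abs_minus_commute)
  qed simp
qed

text \<open>The gain is multiplied by the mass of the half-space, which must therefore be bounded
  below uniformly in \<open>v\<close>. The ball of radius \<open>1/2\<close> about
  \<open>2 *\<^sub>R v\<close> lies in the half-space and has norms at most 5.\<close>

lemma halfspace_kernel_ge:
  fixes v :: "'a::euclidean_space"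
  assumes b: "0 < b" and v: "1 \<le> norm v" "norm v \<le> 2"
  shows "ennreal (5 powr (- (real DIM('a) + b))) * emeasure lborel (ball (0::'a) (1/2))
    \<le> (\<integral>\<^sup>+z. ennreal (norm z powr (- (real DIM('a) + b))) * indicator {z. 1 < v \<bullet> z} z \<partial>lborel)"
proof -
  have "ennreal (5 powr (- (real DIM('a) + b))) * emeasure lborel (ball (0::'a) (1/2))
    = ennreal (5 powr (- (real DIM('a) + b))) * emeasure lborel (ball (2 *\<^sub>R v) (1/2))"
    by (simp add: emeasure_ball)
  also have "\<dots> = (\<integral>\<^sup>+z. ennreal (5 powr (- (real DIM('a) + b))) * indicator (ball (2 *\<^sub>R v) (1/2)) z \<partial>lborel)"
    by (simp add: nn_integral_cmult_indicator)
  also have "\<dots> \<le> (\<integral>\<^sup>+z. ennreal (norm z powr (- (real DIM('a) + b))) * indicator {z. 1 < v \<bullet> z} z \<partial>lborel)"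
  proof (rule nn_integral_mono)
    fix z :: 'a
    have "1 < v \<bullet> z \<and> 5 powr (- (real DIM('a) + b)) \<le> norm z powr (- (real DIM('a) + b))" if z: "z \<in> ball (2 *\<^sub>R v) (1/2)"
    proof -
      define w where "w = z - 2 *\<^sub>R v"
      have w: "norm w < 1/2" using z by (simp add: w_def dist_norm norm_minus_commute)
      have zw: "z = 2 *\<^sub>R v + w" by (simp add: w_def)
      have "\<bar>v \<bullet> w\<bar> \<le> norm v * norm w" by (rule Cauchy_Schwarz_ineq2)
      also have "\<dots> \<le> norm v * (1/2)" using w by (intro mult_left_mono) auto
      finally have vw: "\<bar>v \<bullet> w\<bar> \<le> norm v / 2" by simp
      have vv: "v \<bullet> v = norm v * norm v" by (simp add: norm_eq_sqrt_inner)
      have "norm v * 1 \<le> norm v * norm v" using v by (intro mult_left_mono) auto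
      then have 1: "1 < v \<bullet> z" using vw v by (simp add: zw inner_add_right vv) 
      have "norm z \<le> 2 * norm v + norm w" unfolding zw using norm_triangle_ineq[of "2 *\<^sub>R v" w] by simp
      then have "norm z \<le> 5" using w v by simp
      moreover have "0 < norm z" using 1 by (cases "z = 0") auto
      ultimately show ?thesis using 1 b by (auto intro!: powr_mono2')
    qed
    then show "ennreal (5 powr (- (real DIM('a) + b))) * indicator (ball (2 *\<^sub>R v) (1/2)) z
      \<le> ennreal (norm z powr (- (real DIM('a) + b))) * indicator {z. 1 < v \<bullet> z} z"
      by (auto simp: indicator_def simp del: mem_ball intro!: ennreal_leI)
  qed
  finally show ?thesis .
qed

text \<open>The projection multiplies the one-dimensional balance by \<open>mv * b\<close>, and
  \<open>mv\<close> is at least the fixed mass \<open>m0\<close>. The range of \<open>norm v\<close>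
  is the one that gradients of \<open>para_height\<close> near \<open>b\<close> take.\<close>

lemma barrier_halfspace_lower:
  fixes s p :: real
  assumes s: "0 < s" "s < 1" and p: "1 < p"
  shows "\<exists>c>0. \<forall>(v::'a::euclidean_space) \<rho> d \<epsilon>. 1 \<le> norm v \<longrightarrow> norm v \<le> 2 \<longrightarrow> 0 < d \<longrightarrow> d < \<rho> \<longrightarrow> \<rho> \<le> 1 \<longrightarrow> 0 < \<epsilon> \<longrightarrow> \<epsilon> \<le> 1/2 \<longrightarrow>
     integrable lborel (\<lambda>z. barrier_jump \<rho> s p d \<epsilon> (v \<bullet> z) * norm z powr (- (real DIM('a) + p * s))) \<and>
     c * \<rho> powr (- s) \<le> (\<integral>z. barrier_jump \<rho> s p d \<epsilon> (v \<bullet> z) * norm z powr (- (real DIM('a) + p * s)) \<partial>lborel)"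
proof -
  define b where "b = p * s"
  have b: "0 < b" using s p by (simp add: b_def)
  obtain c0 where c0: "c0 > 0" "\<forall>\<rho> d \<epsilon>. 0 < d \<longrightarrow> d < \<rho> \<longrightarrow> 0 < \<epsilon> \<longrightarrow> \<epsilon> \<le> 1/2 \<longrightarrow>
     (\<integral>\<^sup>+t. ennreal (- barrier_jump \<rho> s p d \<epsilon> t) * ennreal (\<bar>t\<bar> powr (- 1 - p * s)) \<partial>lborel) + ennreal (c0 * \<rho> powr (- s))
     \<le> (\<integral>\<^sup>+t. ennreal (barrier_jump \<rho> s p d \<epsilon> t) * ennreal (\<bar>t\<bar> powr (- 1 - p * s)) \<partial>lborel)"
    using barrier_jump_balance[OF s p] by blast
  define m0 where "m0 = 5 powr (- (real DIM('a) + b)) * measure lborel (ball (0::'a) (1/2))"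
  have m0: "0 < m0" by (simp add: m0_def content_ball_pos)
  have em0: "ennreal m0 = ennreal (5 powr (- (real DIM('a) + b))) * emeasure lborel (ball (0::'a) (1/2))"
  proof -
    have "emeasure lborel (ball (0::'a) (1/2)) = ennreal (measure lborel (ball (0::'a) (1/2)))"
      using emeasure_lborel_ball_finite[of "0::'a" "1/2"] by (intro emeasure_eq_ennreal_measure) auto
    then show ?thesis by (simp only: m0_def ennreal_mult powr_ge_zero measure_nonneg)
  qed
  show ?thesis
  proof (intro exI[of _ "m0 * b * c0"] conjI allI impI)
    show "m0 * b * c0 > 0" using m0 b c0 by simp
    fix v :: 'a and \<rho> d \<epsilon> :: real
    assume v: "1 \<le> norm v" "norm v \<le> 2" and d: "0 < d" "d < \<rho>" and rho1: "\<rho> \<le> 1" and e: "0 < \<epsilon>" "\<epsilon> \<le> 1/2"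
    let ?J = "barrier_jump \<rho> s p d \<epsilon>"
    let ?k = "\<lambda>z::'a. norm z powr (- (real DIM('a) + b))"
    define h where "h = \<epsilon> * d / 2"
    have h: "0 < h" using e d by (simp add: h_def)
    note J = barrier_jump_bounds[OF s p d e]
    have J1: "\<bar>?J t\<bar> \<le> 1" for t
    proof -
      have "\<rho> powr (s * (p - 1)) \<le> 1 powr (s * (p - 1))" using rho1 d s p by (intro powr_mono2) auto
      then show ?thesis using J(2)[of t] by simp
    qed
    \<comment> \<open>Since \<open>norm v \<le> 2\<close>, a vector of norm below
      \<open>h / 2\<close> has \<open>v \<bullet> z\<close> within \<open>h\<close>, where the jump
      vanishes.\<close>
    have bnd: "norm (?J (v \<bullet> z) * ?k z) \<le> ?k z * indicator {z. h / 2 \<le> norm z} z" for z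
    proof (cases "h / 2 \<le> norm z")
      case True
      have "norm (?J (v \<bullet> z) * ?k z) = \<bar>?J (v \<bullet> z)\<bar> * ?k z" by (simp add: abs_mult)
      also have "\<dots> \<le> 1 * ?k z" using J1 by (intro mult_right_mono) auto
      finally show ?thesis using True by simp
    next
      case False
      have "\<bar>v \<bullet> z\<bar> \<le> norm v * norm z" by (rule Cauchy_Schwarz_ineq2)
      also have "\<dots> \<le> 2 * norm z" using v by (intro mult_right_mono) auto
      finally have "?J (v \<bullet> z) = 0" using False by (intro J(3)) (simp add: h_def)
      then show ?thesis by simp
    qed
    have ik: "integrable lborel (\<lambda>z. ?k z * indicator {z. h / 2 \<le> norm z} z)"
      using integrable_kernel_outside[of "h / 2" b "0::'a"] h b by simp
    have int: "integrable lborel (\<lambda>z. ?J (v \<bullet> z) * ?k z)"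
      using bnd by (intro Bochner_Integration.integrable_bound[OF ik]) (auto intro!: AE_I2 simp: abs_mult)
    then show "integrable lborel (\<lambda>z. barrier_jump \<rho> s p d \<epsilon> (v \<bullet> z) * norm z powr (- (real DIM('a) + p * s)))"
      by (simp add: b_def)
    define mv where "mv = (\<integral>\<^sup>+z. ennreal (?k z) * indicator {z. 1 < v \<bullet> z} z \<partial>lborel)"
    have mv: "ennreal m0 \<le> mv"
      unfolding em0 mv_def using halfspace_kernel_ge[OF b v] by simp
    define P where "P = (\<integral>\<^sup>+z. ennreal (?J (v \<bullet> z) * ?k z) \<partial>lborel)"
    define N where "N = (\<integral>\<^sup>+z. ennreal (- (?J (v \<bullet> z) * ?k z)) \<partial>lborel)"
    have fin: "P < \<infinity>" "N < \<infinity>"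
      using int unfolding P_def N_def by (auto simp: real_integrable_def less_top)
    have P: "P = mv * ennreal b * (\<integral>\<^sup>+t. ennreal (?J t) * ennreal (\<bar>t\<bar> powr (- 1 - b)) \<partial>lborel)"
    proof -
      have "P = (\<integral>\<^sup>+z. ennreal (?J (v \<bullet> z)) * ennreal (?k z) \<partial>lborel)"
        unfolding P_def by (intro nn_integral_cong) (simp add: ennreal_mult'')
      also have "\<dots> = mv * ennreal b * (\<integral>\<^sup>+t. ennreal (?J t) * ennreal (\<bar>t\<bar> powr (- 1 - b)) \<partial>lborel)"
        unfolding mv_def using J(3) h by (intro nn_integral_kernel_projection[OF _ b h]) (auto simp: h_def)
      finally show ?thesis .
    qed
    have N: "N = mv * ennreal b * (\<integral>\<^sup>+t. ennreal (- ?J t) * ennreal (\<bar>t\<bar> powr (- 1 - b)) \<partial>lborel)"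
    proof -
      have "N = (\<integral>\<^sup>+z. ennreal (- ?J (v \<bullet> z)) * ennreal (?k z) \<partial>lborel)"
        unfolding N_def
      proof (intro nn_integral_cong)
        fix z
        have "- (?J (v \<bullet> z) * ?k z) = (- ?J (v \<bullet> z)) * ?k z" by simp
        then show "ennreal (- (?J (v \<bullet> z) * ?k z)) = ennreal (- ?J (v \<bullet> z)) * ennreal (?k z)"
          by (simp only: ennreal_mult'' powr_ge_zero)
      qed
      also have "\<dots> = mv * ennreal b * (\<integral>\<^sup>+t. ennreal (- ?J t) * ennreal (\<bar>t\<bar> powr (- 1 - b)) \<partial>lborel)"
        unfolding mv_def using J(3) h by (intro nn_integral_kernel_projection[OF _ b h]) (auto simp: h_def)
      finally show ?thesis .
    qed
    \<comment> \<open>The comparison is made in \<open>ennreal\<close>; passing to the difference of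
      the real parts is sound because \<open>P\<close> and \<open>N\<close> are finite.\<close>
    have "N + ennreal (m0 * b * c0 * \<rho> powr (- s)) = N + ennreal m0 * (ennreal b * ennreal (c0 * \<rho> powr (- s)))"
      using m0 b c0 by (simp add: ennreal_mult'[symmetric] mult_ac)
    also have "\<dots> \<le> N + mv * (ennreal b * ennreal (c0 * \<rho> powr (- s)))"
      using mv by (intro add_left_mono mult_right_mono) auto
    also have "\<dots> = mv * ennreal b * ((\<integral>\<^sup>+t. ennreal (- ?J t) * ennreal (\<bar>t\<bar> powr (- 1 - b)) \<partial>lborel) + ennreal (c0 * \<rho> powr (- s)))"
      unfolding N by (simp add: distrib_left mult.assoc)
    also have "\<dots> \<le> P"
      unfolding P using c0(2) d e by (intro mult_left_mono) (auto simp: b_def)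
    finally have le: "N + ennreal (m0 * b * c0 * \<rho> powr (- s)) \<le> P" .
    have "enn2real N + m0 * b * c0 * \<rho> powr (- s) = enn2real (N + ennreal (m0 * b * c0 * \<rho> powr (- s)))"
      using fin m0 b c0 by (subst enn2real_plus) auto
    also have "\<dots> \<le> enn2real P" using le fin by (intro enn2real_mono) auto
    finally have "m0 * b * c0 * \<rho> powr (- s) \<le> enn2real P - enn2real N" by simp
    also have "\<dots> = (\<integral>z. ?J (v \<bullet> z) * ?k z \<partial>lborel)"
      unfolding P_def N_def by (rule real_lebesgue_integral_def[OF int, symmetric])
    finally show "m0 * b * c0 * \<rho> powr (- s) \<le> (\<integral>z. barrier_jump \<rho> s p d \<epsilon> (v \<bullet> z) * norm z powr (- (real DIM('a) + p * s)) \<partial>lborel)"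
      by (simp add: b_def)
  qed
qed

text \<open>A shear along \<open>e\<close> straightens the paraboloid. It changes the kernel by a factor \<open>1 + O(\<bar>z\<bar>)\<close>, and since
  \<open>barrier_jump\<close> is \<open>O(\<bar>z\<bar>\<^bsup>s(p-1)\<^esup>)\<close> the error is dominated by the integrable function \<open>\<bar>z\<bar>\<^bsup>1-s-n\<^esup>\<close>.\<close>

lemma barrier_curved_lower:
  fixes s p \<kappa> :: real
  assumes s: "0 < s" "s < 1" and p: "1 < p" and kap: "0 < \<kappa>"
  shows "\<exists>c>0. \<exists>C. \<forall>(e::'a::euclidean_space) v \<rho> d \<epsilon>. norm e = 1 \<longrightarrow> v \<bullet> e = 1 \<longrightarrow> norm v \<le> 2 \<longrightarrow>
       0 < d \<longrightarrow> d < \<rho> \<longrightarrow> \<rho> \<le> 1 \<longrightarrow> 0 < \<epsilon> \<longrightarrow> \<epsilon> \<le> 1/2 \<longrightarrow>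
     integrable lborel (\<lambda>z. barrier_jump \<rho> s p d \<epsilon> (v \<bullet> z + \<kappa> * tang_sq e z) * norm z powr (- (real DIM('a) + p * s))) \<and>
     c * \<rho> powr (- s) - C \<le> (\<integral>z. barrier_jump \<rho> s p d \<epsilon> (v \<bullet> z + \<kappa> * tang_sq e z) * norm z powr (- (real DIM('a) + p * s)) \<partial>lborel)"
proof -
  define b where "b = p * s"
  have b: "0 < b" using s p by (simp add: b_def)
  define a where "a = real DIM('a) + b"
  have a: "0 < a" using b by (simp add: a_def add_nonneg_pos)
  obtain c where c: "c > 0" and half: "\<And>(v::'a) \<rho> d \<epsilon>. 1 \<le> norm v \<Longrightarrow> norm v \<le> 2 \<Longrightarrow> 0 < d \<Longrightarrow> d < \<rho> \<Longrightarrow> \<rho> \<le> 1 \<Longrightarrow> 0 < \<epsilon> \<Longrightarrow> \<epsilon> \<le> 1/2 \<Longrightarrow>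
     integrable lborel (\<lambda>z. barrier_jump \<rho> s p d \<epsilon> (v \<bullet> z) * norm z powr (- a)) \<and>
     c * \<rho> powr (- s) \<le> (\<integral>z. barrier_jump \<rho> s p d \<epsilon> (v \<bullet> z) * norm z powr (- a) \<partial>lborel)"
    using barrier_halfspace_lower[OF s p, where 'a='a] unfolding a_def b_def by blast
  let ?k = "\<lambda>z::'a. norm z powr (- a)"
  \<comment> \<open>With \<open>\<kappa> * m \<le> 1/2\<close> the shear moves a point of norm at
    most \<open>m\<close> by at most half its norm, so the kernel changes by a controlled factor
    there.\<close>
  define m where "m = min 1 (1 / (2 * \<kappa>))"
  have m: "0 < m" "\<kappa> * m \<le> 1/2" using kap by (auto simp: m_def min_def field_simps)
  \<comment> \<open>The factor \<open>2 powr (s * (p - 1))\<close> comes from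
    \<open>\<bar>v \<bullet> z\<bar> \<le> 2 * norm z\<close> in the jump; the rest is the mean
    value bound for the kernel with displacement at most
    \<open>\<kappa> * (norm z)\<^sup>2\<close>.\<close>
  define D where "D = 2 powr (s * (p - 1)) * (a * (1/2) powr (- a - 1) * \<kappa>)"
  have D: "0 \<le> D" using a kap by (simp add: D_def)
  define near where "near z = D * (norm z powr ((1 - s) - real DIM('a)) * indicator {z. norm z \<le> m} z)" for z :: 'a
  define far where "far z = ?k z * indicator {z. m / 2 \<le> norm z} z" for z :: 'a
  have [measurable]: "near \<in> borel_measurable borel" "far \<in> borel_measurable borel"
    unfolding near_def[abs_def] far_def[abs_def] by measurable
  have near0: "0 \<le> near z" and far0: "0 \<le> far z" for z using D by (auto simp: near_def far_def)
  have inear: "integrable lborel near"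
    unfolding near_def[abs_def]
  proof (rule integrable_mult_right, rule integrableI_nonneg)
    have "(\<integral>\<^sup>+(z::'a). ennreal (norm z powr ((1 - s) - real DIM('a)) * indicator {z. norm z \<le> m} z) \<partial>lborel)
      = (\<integral>\<^sup>+(z::'a). ennreal (norm z powr ((1 - s) - real DIM('a))) * indicator {z. norm z \<le> m} z \<partial>lborel)"
      by (intro nn_integral_cong) (auto simp: indicator_def)
    also have "\<dots> < \<infinity>" using m s by (intro nn_integral_norm_powr_inside_ball) auto
    finally show "(\<integral>\<^sup>+(z::'a). ennreal (norm z powr ((1 - s) - real DIM('a)) * indicator {z. norm z \<le> m} z) \<partial>lborel) < \<infinity>" .
  qed auto
  have ioutside: "integrable lborel (\<lambda>z::'a. ?k z * indicator {z. r \<le> norm z} z)" if "0 < r" for r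
    using integrable_kernel_outside[OF that b, of "0::'a"] by (simp add: a_def)
  have ifar: "integrable lborel far"
    unfolding far_def[abs_def] using m by (intro ioutside) auto
  \<comment> \<open>The far part counts twice, for the kernel and for its sheared copy, which has
    the same integral. Nothing here involves \<open>v\<close>, \<open>\<rho>\<close>,
    \<open>d\<close> or \<open>\<epsilon>\<close>.\<close>
  define C where "C = (\<integral>z. near z \<partial>lborel) + 2 * (\<integral>z. far z \<partial>lborel)"
  have main: "integrable lborel (\<lambda>z. barrier_jump \<rho> s p d \<epsilon> (v \<bullet> z + \<kappa> * tang_sq e z) * ?k z) \<and>
     c * \<rho> powr (- s) - C \<le> (\<integral>z. barrier_jump \<rho> s p d \<epsilon> (v \<bullet> z + \<kappa> * tang_sq e z) * ?k z \<partial>lborel)"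
    if e: "norm e = 1" and ve: "v \<bullet> e = 1" and v2: "norm v \<le> 2" and d: "0 < d" "d < \<rho>" and rho1: "\<rho> \<le> 1"
      and eps: "0 < \<epsilon>" "\<epsilon> \<le> 1/2" for e v :: 'a and \<rho> d \<epsilon> :: real
  proof -
    let ?J = "barrier_jump \<rho> s p d \<epsilon>"
    define f where "f z = \<kappa> * tang_sq e z" for z
    have [measurable]: "f \<in> borel_measurable borel" unfolding f_def[abs_def] by measurable
    have fshift: "f (y + t *\<^sub>R e) = f y" for y t by (simp add: f_def tang_sq_shift[OF e])
    have f0: "0 \<le> f z" and fle: "f z \<le> \<kappa> * (norm z)\<^sup>2" for z
      using tang_sq_bounds[OF e, of z] kap by (auto simp: f_def)
    define S where "S z = z + f z *\<^sub>R e" for z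
    have [measurable]: "S \<in> borel_measurable borel" unfolding S_def[abs_def] by measurable
    have distr: "distr lborel borel S = lborel"
      unfolding S_def[abs_def] using e fshift by (intro distr_lborel_shear) auto
    \<comment> \<open>Since \<open>f\<close> is constant along \<open>e\<close>, the map
      \<open>z \<mapsto> z - f z *\<^sub>R e\<close> inverts \<open>S\<close>. The change of
      variables makes the argument of the jump linear and moves the curvature into the
      kernel.\<close>
    define k1 where "k1 z = ?k (z - f z *\<^sub>R e)" for z
    have [measurable]: "k1 \<in> borel_measurable borel" unfolding k1_def[abs_def] by measurable
    have k1S: "k1 (S z) = ?k z" for z by (simp add: k1_def S_def fshift)
    have vS: "v \<bullet> S z = v \<bullet> z + f z" for z by (simp add: S_def inner_add_right ve)
    have nS: "norm (S z) \<le> norm z + \<kappa> * (norm z)\<^sup>2" for z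
    proof -
      have "norm (S z) \<le> norm z + norm (f z *\<^sub>R e)" unfolding S_def by (rule norm_triangle_ineq)
      also have "norm (f z *\<^sub>R e) = f z" using e f0[of z] by simp
      finally show ?thesis using fle[of z] by linarith
    qed
    have v1: "1 \<le> norm v" using Cauchy_Schwarz_ineq2[of v e] e ve by simp
    note J = barrier_jump_bounds[OF s p d eps]
    have J1: "\<bar>?J t\<bar> \<le> 1" for t
    proof -
      have "\<rho> powr (s * (p - 1)) \<le> 1 powr (s * (p - 1))" using rho1 d s p by (intro powr_mono2) auto
      then show ?thesis using J(2)[of t] by simp
    qed
    have I0: "integrable lborel (\<lambda>z. ?J (v \<bullet> z) * ?k z)" "c * \<rho> powr (- s) \<le> (\<integral>z. ?J (v \<bullet> z) * ?k z \<partial>lborel)"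
      using half[OF v1 v2 d rho1 eps] by auto
    have I1: "integrable lborel (\<lambda>z. ?J (v \<bullet> z + f z) * ?k z)"
    proof -
      \<comment> \<open>Below this radius the height difference is at most
        \<open>(2 + \<kappa>) * norm z \<le> \<epsilon> * d / 2\<close>, so the jump vanishes; the
        bound by 1 lets \<open>norm z\<close> dominate its square.\<close>
      define r where "r = min 1 (\<epsilon> * d / 2 / (2 + \<kappa>))"
      have r: "0 < r" using d eps kap by (auto simp: r_def)
      have "norm (?J (v \<bullet> z + f z) * ?k z) \<le> norm (?k z * indicator {z. r \<le> norm z} z)" for z
      proof (cases "r \<le> norm z")
        case True
        have "norm (?J (v \<bullet> z + f z) * ?k z) = \<bar>?J (v \<bullet> z + f z)\<bar> * ?k z" by (simp add: abs_mult)
        also have "\<dots> \<le> 1 * ?k z" using J1 by (intro mult_right_mono) auto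
        finally show ?thesis using True by simp
      next
        case False
        then have z: "norm z \<le> 1" "norm z \<le> \<epsilon> * d / 2 / (2 + \<kappa>)" by (auto simp: r_def)
        have "(norm z)\<^sup>2 \<le> norm z" using z by (simp add: power2_eq_square mult_left_le)
        then have "\<kappa> * (norm z)\<^sup>2 \<le> \<kappa> * norm z" using kap by simp
        moreover have "\<bar>v \<bullet> z\<bar> \<le> 2 * norm z"
          using Cauchy_Schwarz_ineq2[of v z] mult_right_mono[OF v2, of "norm z"] by simp
        ultimately have "\<bar>v \<bullet> z + f z\<bar> \<le> (2 + \<kappa>) * norm z" using f0[of z] fle[of z] by (simp add: algebra_simps)
        also have "\<dots> \<le> \<epsilon> * d / 2" using z(2) kap by (simp add: field_simps)
        finally have "?J (v \<bullet> z + f z) = 0" by (rule J(3))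
        then show ?thesis by simp
      qed
      then show ?thesis by (intro Bochner_Integration.integrable_bound[OF ioutside[OF r]]) auto
    qed
    have I1': "integrable lborel (\<lambda>z. ?J (v \<bullet> z) * k1 z)"
      and eq: "(\<integral>z. ?J (v \<bullet> z + f z) * ?k z \<partial>lborel) = (\<integral>z. ?J (v \<bullet> z) * k1 z \<partial>lborel)"
    proof -
      have "integrable (distr lborel borel S) (\<lambda>z. ?J (v \<bullet> z) * k1 z)"
        by (subst integrable_distr_eq) (auto simp: I1 k1S vS)
      then show "integrable lborel (\<lambda>z. ?J (v \<bullet> z) * k1 z)" by (simp add: distr)
      have "(\<integral>z. ?J (v \<bullet> z) * k1 z \<partial>lborel) = (\<integral>z. ?J (v \<bullet> z) * k1 z \<partial>distr lborel borel S)" by (simp add: distr)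
      also have "\<dots> = (\<integral>z. ?J (v \<bullet> z + f z) * ?k z \<partial>lborel)"
        by (subst integral_distr) (auto simp: k1S vS)
      finally show "(\<integral>z. ?J (v \<bullet> z + f z) * ?k z \<partial>lborel) = (\<integral>z. ?J (v \<bullet> z) * k1 z \<partial>lborel)" by simp
    qed
    define far1 where "far1 z = far (z - f z *\<^sub>R e)" for z
    have ifar1: "integrable lborel far1" and far1eq: "(\<integral>z. far1 z \<partial>lborel) = (\<integral>z. far z \<partial>lborel)"
    proof -
      have S1: "far1 (S z) = far z" for z by (simp add: far1_def S_def fshift)
      have [measurable]: "far1 \<in> borel_measurable borel" unfolding far1_def[abs_def] by measurable
      have "integrable (distr lborel borel S) far1"
        by (subst integrable_distr_eq) (auto simp: S1 ifar)
      then show "integrable lborel far1" by (simp add: distr)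
      have "(\<integral>z. far1 z \<partial>lborel) = (\<integral>z. far1 z \<partial>distr lborel borel S)" by (simp add: distr)
      also have "\<dots> = (\<integral>z. far z \<partial>lborel)" by (subst integral_distr) (auto simp: S1)
      finally show "(\<integral>z. far1 z \<partial>lborel) = (\<integral>z. far z \<partial>lborel)" .
    qed
    have err: "\<bar>?J (v \<bullet> z) * k1 z - ?J (v \<bullet> z) * ?k z\<bar> \<le> near z + far z + far1 z" for z
    proof (cases "norm z \<le> m")
      case True
      show ?thesis
      proof (cases "z = 0")
        case True
        then have "k1 z = ?k z" using fle[of 0] f0[of 0] by (simp add: k1_def)
        then show ?thesis using near0[of z] far0 by (simp add: far1_def)
      next
        case False
        define w where "w = z - f z *\<^sub>R e"
        have fz: "f z \<le> \<kappa> * (norm z)\<^sup>2" by (rule fle)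
        have "\<kappa> * (norm z)\<^sup>2 \<le> (\<kappa> * m) * norm z"
          using True kap by (simp add: power2_eq_square mult_left_mono mult_right_mono)
        also have "\<dots> \<le> norm z / 2" using m(2) mult_right_mono[OF m(2), of "norm z"] by simp
        finally have fz2: "f z \<le> norm z / 2" using fz by linarith
        have nfe: "norm (f z *\<^sub>R e) = f z" using e f0[of z] by simp
        have wz: "\<bar>norm w - norm z\<bar> \<le> f z"
          using norm_triangle_ineq3[of w z] nfe by (simp add: w_def)
        have "\<bar>norm w powr (- a) - norm z powr (- a)\<bar> \<le> a * (norm z / 2) powr (- a - 1) * \<bar>norm w - norm z\<bar>"
          using False wz fz2 a by (intro powr_neg_diff_le) auto
        also have "\<dots> \<le> a * (norm z / 2) powr (- a - 1) * (\<kappa> * (norm z)\<^sup>2)"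
          using a wz fz by (intro mult_left_mono) auto
        finally have kd: "\<bar>k1 z - ?k z\<bar> \<le> a * (norm z / 2) powr (- a - 1) * (\<kappa> * (norm z)\<^sup>2)"
          by (simp add: k1_def w_def)
        have Jz: "\<bar>?J (v \<bullet> z)\<bar> \<le> (2 * norm z) powr (s * (p - 1))"
        proof -
          have "\<bar>v \<bullet> z\<bar> \<le> 2 * norm z"
            using Cauchy_Schwarz_ineq2[of v z] mult_right_mono[OF v2, of "norm z"] by simp
          then have "\<bar>v \<bullet> z\<bar> powr (s * (p - 1)) \<le> (2 * norm z) powr (s * (p - 1))"
            using s p by (intro powr_mono2) auto
          then show ?thesis using J(1)[of "v \<bullet> z"] by linarith
        qed
        have "\<bar>?J (v \<bullet> z) * k1 z - ?J (v \<bullet> z) * ?k z\<bar> = \<bar>?J (v \<bullet> z)\<bar> * \<bar>k1 z - ?k z\<bar>"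
          by (simp add: abs_mult[symmetric] right_diff_distrib)
        also have "\<dots> \<le> (2 * norm z) powr (s * (p - 1)) * (a * (norm z / 2) powr (- a - 1) * (\<kappa> * (norm z)\<^sup>2))"
          using Jz kd by (intro mult_mono) auto
        also have "\<dots> = D * (norm z powr (s * (p - 1)) * norm z powr (- a - 1) * norm z powr 2)"
        proof -
          have 1: "(norm z / 2) powr (- a - 1) = norm z powr (- a - 1) * (1/2) powr (- a - 1)"
            using powr_mult[of "norm z" "1/2" "- a - 1"] by simp
          have 2: "(norm z)\<^sup>2 = norm z powr 2" using False by simp
          show ?thesis unfolding D_def 1 2 powr_mult by (simp add: mult_ac)
        qed
        \<comment> \<open>The exponents add up to \<open>1 - s\<close> minus the dimension: the
          jump, the derivative of the kernel and the quadratic displacement leave an integrable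
          singularity because \<open>s < 1\<close>.\<close>
        also have "norm z powr (s * (p - 1)) * norm z powr (- a - 1) * norm z powr 2 = norm z powr ((1 - s) - real DIM('a))"
          by (simp only: powr_add[symmetric]) (simp add: a_def b_def algebra_simps)
        also have "D * norm z powr ((1 - s) - real DIM('a)) = near z" using True by (simp add: near_def)
        finally show ?thesis using far0[of z] far0[of "z - f z *\<^sub>R e"] by (simp add: far1_def)
      qed
    next
      case False
      have 1: "?k z = far z" using False m by (simp add: far_def)
      have 2: "k1 z = far1 z"
      proof -
        \<comment> \<open>Otherwise applying \<open>S\<close> to the preimage would give a point of
          norm at most \<open>m / 2 + m / 8\<close>, although its image \<open>z\<close> has norm
          above \<open>m\<close>.\<close>
        have "m / 2 \<le> norm (z - f z *\<^sub>R e)"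
        proof (rule ccontr)
          assume "\<not> ?thesis"
          then have w: "norm (z - f z *\<^sub>R e) < m / 2" by simp
          have Sw: "S (z - f z *\<^sub>R e) = z" using fshift[of z "- f z"] by (simp add: S_def)
          have "(norm (z - f z *\<^sub>R e))\<^sup>2 \<le> (m / 2)\<^sup>2" using w by (intro power_mono) auto
          then have "\<kappa> * (norm (z - f z *\<^sub>R e))\<^sup>2 \<le> \<kappa> * (m / 2)\<^sup>2" using kap by simp
          also have "\<dots> = (\<kappa> * m) * (m / 4)" by (simp add: power2_eq_square)
          also have "\<dots> \<le> 1/2 * (m / 4)" using m by (intro mult_right_mono) auto
          finally have "norm (S (z - f z *\<^sub>R e)) \<le> m / 2 + m / 8" using nS[of "z - f z *\<^sub>R e"] w by linarith
          then show False using False m unfolding Sw by linarith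
        qed
        then show ?thesis by (simp add: k1_def far1_def far_def)
      qed
      have "\<bar>?J (v \<bullet> z) * k1 z - ?J (v \<bullet> z) * ?k z\<bar> = \<bar>?J (v \<bullet> z)\<bar> * \<bar>far1 z - far z\<bar>"
        by (simp add: abs_mult[symmetric] right_diff_distrib 1 2)
      also have "\<dots> \<le> 1 * \<bar>far1 z - far z\<bar>" using J1 by (intro mult_right_mono) auto
      also have "\<dots> \<le> near z + far z + far1 z" using near0[of z] far0[of z] far0[of "z - f z *\<^sub>R e"] by (simp add: far1_def)
      finally show ?thesis .
    qed
    have "\<bar>(\<integral>z. ?J (v \<bullet> z) * k1 z \<partial>lborel) - (\<integral>z. ?J (v \<bullet> z) * ?k z \<partial>lborel)\<bar>
        = \<bar>(\<integral>z. ?J (v \<bullet> z) * k1 z - ?J (v \<bullet> z) * ?k z \<partial>lborel)\<bar>"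
      using I0(1) I1' by simp
    also have "\<dots> \<le> (\<integral>z. \<bar>?J (v \<bullet> z) * k1 z - ?J (v \<bullet> z) * ?k z\<bar> \<partial>lborel)"
      by (rule integral_abs_bound)
    also have "\<dots> \<le> (\<integral>z. near z + far z + far1 z \<partial>lborel)"
      using err I0(1) I1' inear ifar ifar1 by (intro integral_mono) auto
    also have "\<dots> = C" using inear ifar ifar1 by (simp add: C_def far1eq)
    finally show ?thesis using I0 I1 eq by (auto simp: f_def)
  qed
  show ?thesis
    using c main unfolding a_def b_def by blast
qed

subsection \<open>The barrier\<close>

text \<open>The function \<open>g\<close> of the overview raised by \<open>\<tau>\<close>, which
  keeps heights over \<open>\<Omega>\<close> away from 0.\<close>

definition para_height :: "real \<Rightarrow> 'a::euclidean_space \<Rightarrow> 'a \<Rightarrow> real \<Rightarrow> 'a \<Rightarrow> real" where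
  "para_height \<kappa> e b \<tau> y = (y - b) \<bullet> e + \<kappa> * tang_sq e (y - b) + \<tau>"

text \<open>The jump across the sphere of radius \<open>M\<close> is harmless over
  \<open>\<Omega>\<close>: for \<open>\<rho> \<le> c1 * M\<^sup>2 / 4\<close> the quadratic growth
  of the height there makes the inner formula equal \<open>\<rho> powr s\<close> before the sphere
  is reached.\<close>

definition barrier :: "real \<Rightarrow> real \<Rightarrow> real \<Rightarrow> real \<Rightarrow> 'a::euclidean_space \<Rightarrow> 'a \<Rightarrow> real \<Rightarrow> 'a \<Rightarrow> real" where
  "barrier \<kappa> M \<rho> s e b \<tau> y = (if norm (y - b) < M then trunc_powr \<rho> s (para_height \<kappa> e b \<tau> y) else \<rho> powr s)"

text \<open>Removed are the pairs of positive heights with ratio strictly between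
  \<open>1 - \<epsilon>\<close> and its inverse. The distance cutoff \<open>\<eta>\<close>
  guarantees absolute convergence also at points far from \<open>b\<close>, where the height says
  little.\<close>

definition sep_pairs :: "real \<Rightarrow> 'a::euclidean_space \<Rightarrow> 'a \<Rightarrow> real \<Rightarrow> real \<Rightarrow> real \<Rightarrow> ('a \<times> 'a) set" where
  "sep_pairs \<kappa> e b \<tau> \<epsilon> \<eta> = {z. \<not> (0 < para_height \<kappa> e b \<tau> (fst z) \<and> 0 < para_height \<kappa> e b \<tau> (snd z)
      \<and> (1 - \<epsilon>) * para_height \<kappa> e b \<tau> (fst z) < para_height \<kappa> e b \<tau> (snd z)
      \<and> (1 - \<epsilon>) * para_height \<kappa> e b \<tau> (snd z) < para_height \<kappa> e b \<tau> (fst z)) \<and> \<eta> \<le> norm (fst z - snd z)}"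

lemma para_height_measurable [measurable]: "para_height \<kappa> e b \<tau> \<in> borel_measurable borel"
  unfolding para_height_def[abs_def] by measurable

lemma barrier_measurable [measurable]: "barrier \<kappa> M \<rho> s e b \<tau> \<in> borel_measurable borel"
  unfolding barrier_def[abs_def] by measurable

lemma sep_pairs_measurable [measurable]: "sep_pairs \<kappa> e b \<tau> \<epsilon> \<eta> \<in> sets (borel \<Otimes>\<^sub>M borel)"
proof -
  have "sep_pairs \<kappa> e b \<tau> \<epsilon> \<eta> = {z \<in> space (borel \<Otimes>\<^sub>M borel).
      \<not> (0 < para_height \<kappa> e b \<tau> (fst z) \<and> 0 < para_height \<kappa> e b \<tau> (snd z)
      \<and> (1 - \<epsilon>) * para_height \<kappa> e b \<tau> (fst z) < para_height \<kappa> e b \<tau> (snd z)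
      \<and> (1 - \<epsilon>) * para_height \<kappa> e b \<tau> (snd z) < para_height \<kappa> e b \<tau> (fst z)) \<and> \<eta> \<le> norm (fst z - snd z)}"
    by (simp add: sep_pairs_def space_pair_measure)
  also have "\<dots> \<in> sets (borel \<Otimes>\<^sub>M borel)" by measurable
  finally show ?thesis .
qed

lemma sep_pairs_sym: "(x, y) \<in> sep_pairs \<kappa> e b \<tau> \<epsilon> \<eta> \<longleftrightarrow> (y, x) \<in> sep_pairs \<kappa> e b \<tau> \<epsilon> \<eta>"
  by (auto simp: sep_pairs_def norm_minus_commute)

lemma barrier_bounds:
  "0 < \<rho> \<Longrightarrow> 0 < s \<Longrightarrow> 0 \<le> barrier \<kappa> M \<rho> s e b \<tau> y"
  "0 < \<rho> \<Longrightarrow> 0 < s \<Longrightarrow> barrier \<kappa> M \<rho> s e b \<tau> y \<le> \<rho> powr s"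
  using trunc_powr_bounds[of \<rho> s] by (auto simp: barrier_def)

text \<open>The height is a quadratic polynomial, so its expansion is exact. The quadratic part is
  the same at every \<open>x\<close>, so every point sees the model integrand of
  \<open>barrier_curved_lower\<close>, with only the linear coefficient changing.\<close>

lemma para_height_add:
  "para_height \<kappa> e b \<tau> (x + z) = para_height \<kappa> e b \<tau> x
     + ((e + (2 * \<kappa>) *\<^sub>R ((x - b) - ((x - b) \<bullet> e) *\<^sub>R e)) \<bullet> z + \<kappa> * tang_sq e z)"
proof -
  define w where "w = x - b"
  have eq: "x + z - b = w + z" by (simp add: w_def)
  show ?thesis
    unfolding para_height_def tang_sq_def eq w_def[symmetric]
    by (simp add: inner_add_left inner_add_right inner_diff_left inner_commute power2_eq_square algebra_simps)
qed

lemma para_height_gradient: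
  fixes e :: "'a::euclidean_space"
  assumes e: "norm e = 1" and k: "0 \<le> \<kappa>" "4 * \<kappa> * M \<le> 1" and x: "norm (x - b) \<le> M"
  defines "v \<equiv> e + (2 * \<kappa>) *\<^sub>R ((x - b) - ((x - b) \<bullet> e) *\<^sub>R e)"
  shows "v \<bullet> e = 1" "norm v \<le> 2"
proof -
  have ee: "e \<bullet> e = 1" using e by (simp add: norm_eq_1)
  show "v \<bullet> e = 1" by (simp add: v_def inner_add_left inner_diff_left ee)
  define w where "w = (x - b) - ((x - b) \<bullet> e) *\<^sub>R e"
  have "w \<bullet> w = tang_sq e (x - b)"
    by (simp add: w_def tang_sq_def inner_diff_left inner_diff_right ee inner_commute power2_eq_square)
  then have "(norm w)\<^sup>2 \<le> (norm (x - b))\<^sup>2" using tang_sq_bounds[OF e, of "x - b"] by (simp add: power2_norm_eq_inner)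
  then have "norm w \<le> norm (x - b)" by (simp add: power2_le_iff_abs_le)
  then have w: "norm w \<le> M" using x by linarith
  have "norm v \<le> norm e + norm ((2 * \<kappa>) *\<^sub>R w)" unfolding v_def w_def by (rule norm_triangle_ineq)
  also have "\<dots> = 1 + 2 * \<kappa> * norm w" using e k by simp
  also have "2 * \<kappa> * norm w \<le> 2 * \<kappa> * M" using w k by (intro mult_left_mono) auto
  finally show "norm v \<le> 2" using k by linarith
qed

text \<open>The 3 is 2 from the gradient plus 1 from the quadratic part, whose factor
  \<open>\<kappa> * norm (y - x)\<close> is at most \<open>2 * \<kappa> * M\<close>.\<close>

lemma para_height_diff_le:
  assumes e: "norm e = 1" and k: "0 \<le> \<kappa>" "4 * \<kappa> * M \<le> 1" and x: "norm (x - b) \<le> M" and y: "norm (y - x) \<le> 2 * M"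
  shows "\<bar>para_height \<kappa> e b \<tau> y - para_height \<kappa> e b \<tau> x\<bar> \<le> 3 * norm (y - x)"
proof -
  define v where "v = e + (2 * \<kappa>) *\<^sub>R ((x - b) - ((x - b) \<bullet> e) *\<^sub>R e)"
  have v: "norm v \<le> 2" unfolding v_def using para_height_gradient[OF e k x] by simp
  define z where "z = y - x"
  have "para_height \<kappa> e b \<tau> y - para_height \<kappa> e b \<tau> x = v \<bullet> z + \<kappa> * tang_sq e z"
    using para_height_add[of \<kappa> e b \<tau> x z] by (simp add: z_def v_def)
  moreover have "\<bar>v \<bullet> z\<bar> \<le> 2 * norm z"
    using Cauchy_Schwarz_ineq2[of v z] mult_right_mono[OF v, of "norm z"] by simp
  moreover have "\<kappa> * tang_sq e z \<le> norm z"
  proof -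
    have "\<kappa> * tang_sq e z \<le> \<kappa> * (norm z)\<^sup>2" using tang_sq_bounds[OF e, of z] k by (intro mult_left_mono) auto
    also have "\<dots> = (\<kappa> * norm z) * norm z" by (simp add: power2_eq_square)
    also have "\<dots> \<le> 1 * norm z"
    proof (intro mult_right_mono)
      have "\<kappa> * norm z \<le> \<kappa> * (2 * M)" using y k by (intro mult_left_mono) (auto simp: z_def)
      then show "\<kappa> * norm z \<le> 1" using k by linarith
    qed auto
    finally show ?thesis by simp
  qed
  moreover have "0 \<le> \<kappa> * tang_sq e z" using tang_sq_bounds[OF e, of z] k by simp
  ultimately show ?thesis unfolding z_def by linarith
qed

text \<open>If the barrier attains its maximum at \<open>x\<close>, the integrand is nonnegative,
  and a ball outside the paraboloid where the barrier is 0 gives the bound. Otherwise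
  \<open>x\<close> has height below \<open>\<rho>\<close> and lies within \<open>M / 2\<close> of
  \<open>b\<close>; the curved model applies up to an error from points outside the ball of radius
  \<open>M\<close>, which a small \<open>\<rho>\<close> absorbs. Neither \<open>\<rho>\<close> nor
  \<open>c\<close> depends on \<open>b\<close>, \<open>e\<close>, \<open>\<tau>\<close> or the
  truncation.\<close>

lemma barrier_supersolution:
  fixes s p \<kappa> M c1 L :: real
  assumes s: "0 < s" "s < 1" and p: "1 < p" and kap: "0 < \<kappa>" and M: "0 < M" "4 * \<kappa> * M \<le> 1" and c1: "0 < c1" and L: "0 < L"
  shows "\<exists>\<rho> c. 0 < \<rho> \<and> \<rho> \<le> c1 * M\<^sup>2 / 4 \<and> 0 < c \<and> (\<forall>(\<Omega>::'a::euclidean_space set) e b \<tau> \<epsilon> \<eta>. norm e = 1 \<longrightarrow> 0 < \<tau> \<longrightarrow> \<tau> \<le> M / 8 \<longrightarrow>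
      0 < \<epsilon> \<longrightarrow> \<epsilon> \<le> 1/2 \<longrightarrow> 0 < \<eta> \<longrightarrow> \<eta> \<le> M / 24 \<longrightarrow> \<eta> \<le> \<epsilon> * \<tau> / 3 \<longrightarrow>
      (\<forall>x\<in>\<Omega>. norm (x - b) < M \<longrightarrow> c1 * (norm (x - b))\<^sup>2 + \<tau> \<le> para_height \<kappa> e b \<tau> x) \<longrightarrow>
      (\<forall>x\<in>\<Omega>. norm (x - b) \<le> L) \<longrightarrow>
      (\<forall>x\<in>\<Omega>. c \<le> (\<integral>y. indicator (sep_pairs \<kappa> e b \<tau> \<epsilon> \<eta>) (x, y) * spow (barrier \<kappa> M \<rho> s e b \<tau> x - barrier \<kappa> M \<rho> s e b \<tau> y) (p - 1)
           * norm (x - y) powr (- (real DIM('a) + p * s)) \<partial>lborel)))"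
proof -
  define a where "a = real DIM('a) + p * s"
  have ps: "0 < p * s" using s p by simp
  have a0: "0 < a" using ps by (simp add: a_def add_nonneg_pos)
  have sq: "0 < s * (p - 1)" using s p by simp
  obtain c C where c: "c > 0" and curved: "\<And>(e::'a) v \<rho> d \<epsilon>. norm e = 1 \<Longrightarrow> v \<bullet> e = 1 \<Longrightarrow> norm v \<le> 2 \<Longrightarrow>
       0 < d \<Longrightarrow> d < \<rho> \<Longrightarrow> \<rho> \<le> 1 \<Longrightarrow> 0 < \<epsilon> \<Longrightarrow> \<epsilon> \<le> 1/2 \<Longrightarrow>
     integrable lborel (\<lambda>z. barrier_jump \<rho> s p d \<epsilon> (v \<bullet> z + \<kappa> * tang_sq e z) * norm z powr (- a)) \<and>
     c * \<rho> powr (- s) - C \<le> (\<integral>z. barrier_jump \<rho> s p d \<epsilon> (v \<bullet> z + \<kappa> * tang_sq e z) * norm z powr (- a) \<partial>lborel)"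
    using barrier_curved_lower[OF s p kap, where 'a='a] unfolding a_def by blast
  define far where "far z = norm z powr (- a) * indicator {z. M / 2 \<le> norm z} z" for z :: 'a
  have ifar: "integrable lborel far"
    using integrable_kernel_outside[of "M / 2" "p * s" "0::'a"] M ps unfolding far_def[abs_def] a_def by simp
  define F where "F = (\<integral>z. far z \<partial>lborel)"
  have F0: "0 \<le> F" unfolding F_def far_def by (intro integral_nonneg_AE) auto
  define X where "X = (max C 0 + 2 * F + 1) / c"
  have X: "0 < X" using c F0 by (simp add: X_def add_nonneg_pos)
  \<comment> \<open>The first entry makes \<open>c * \<rho> powr (- s)\<close> exceed
    \<open>C + 2 * F + 1\<close>, the second is required by the curved model, and the third forces
    points of height below \<open>\<rho>\<close> into the ball of radius
    \<open>M / 2\<close>.\<close>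
  define \<rho> where "\<rho> = min (X powr (- 1 / s)) (min 1 (c1 * M\<^sup>2 / 4))"
  have rho: "0 < \<rho>" "\<rho> \<le> 1" "\<rho> \<le> c1 * M\<^sup>2 / 4" "\<rho> \<le> X powr (- 1 / s)"
    using X c1 M by (auto simp: \<rho>_def)
  have rhoX: "1 \<le> c * \<rho> powr (- s) - C - 2 * F"
  proof -
    have "X = (X powr (- 1 / s)) powr (- s)" using s X by (simp add: powr_powr)
    also have "\<dots> \<le> \<rho> powr (- s)" using rho s by (intro powr_mono2') auto
    finally have "c * X \<le> c * \<rho> powr (- s)" using c by (intro mult_left_mono) auto
    then show ?thesis using c by (simp add: X_def)
  qed
  define Q where "Q = measure lborel (ball (0::'a) (M / 8))"
  have Q: "0 < Q" using M by (simp add: Q_def content_ball_pos)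
  \<comment> \<open>The minimum of the bounds from the two cases: 1 where the curved model applies,
    the other value where the barrier is maximal.\<close>
  define c' where "c' = min 1 (\<rho> powr (s * (p - 1)) * (L + M) powr (- a) * Q)"
  have c': "0 < c'" using rho Q L M by (simp add: c'_def)
  show ?thesis
  proof (rule exI[of _ \<rho>], rule exI[of _ c'], intro conjI allI impI ballI)
    show "0 < \<rho>" "\<rho> \<le> c1 * M\<^sup>2 / 4" "0 < c'" using rho c' by auto
    fix \<Omega> :: "'a set" and e b :: 'a and \<tau> \<epsilon> \<eta> :: real and x
    assume e: "norm e = 1" and tau: "0 < \<tau>" "\<tau> \<le> M / 8" and eps: "0 < \<epsilon>" "\<epsilon> \<le> 1/2"
      and eta: "0 < \<eta>" "\<eta> \<le> M / 24" "\<eta> \<le> \<epsilon> * \<tau> / 3"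
      and geo: "\<forall>x\<in>\<Omega>. norm (x - b) < M \<longrightarrow> c1 * (norm (x - b))\<^sup>2 + \<tau> \<le> para_height \<kappa> e b \<tau> x"
      and diam: "\<forall>x\<in>\<Omega>. norm (x - b) \<le> L" and x: "x \<in> \<Omega>"
    let ?W = "barrier \<kappa> M \<rho> s e b \<tau>"
    let ?h = "para_height \<kappa> e b \<tau>"
    let ?A = "sep_pairs \<kappa> e b \<tau> \<epsilon> \<eta>"
    define G where "G y = indicator ?A (x, y) * spow (?W x - ?W y) (p - 1) * norm (x - y) powr (- a)" for y
    have [measurable]: "(\<lambda>y. indicator ?A (x, y) :: real) \<in> borel_measurable borel"
      by measurable
    have [measurable]: "G \<in> borel_measurable borel" unfolding G_def[abs_def] by measurable
    note Wb = barrier_bounds[OF rho(1) s(1), of \<kappa> M e b \<tau>]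
    have sp_bound: "\<bar>spow (?W x - ?W y) (p - 1)\<bar> \<le> \<rho> powr (s * (p - 1))" for y
    proof -
      have "\<bar>?W x - ?W y\<bar> powr (p - 1) \<le> (\<rho> powr s) powr (p - 1)"
        using Wb[of x] Wb[of y] p by (intro powr_mono2) auto
      then show ?thesis by (simp add: abs_spow powr_powr)
    qed
    have rsq1: "\<rho> powr (s * (p - 1)) \<le> 1"
      using rho sq powr_mono2[of "s * (p - 1)" \<rho> 1] by simp
    have iG: "integrable lborel G"
    proof (rule Bochner_Integration.integrable_bound)
      show "integrable lborel (\<lambda>y. norm (x - y) powr (- a) * indicator {y. \<eta> \<le> norm (x - y)} y)"
        unfolding a_def using eta ps by (intro integrable_kernel_outside) auto
      have "\<bar>spow (?W x - ?W y) (p - 1)\<bar> \<le> 1" for y using sp_bound[of y] rsq1 by linarith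
      then have "norm (G y) \<le> norm (norm (x - y) powr (- a) * indicator {y. \<eta> \<le> norm (x - y)} y)" for y
        using mult_right_mono[of "\<bar>spow (?W x - ?W y) (p - 1)\<bar>" 1 "norm (x - y) powr (- a)"]
        by (auto simp: G_def indicator_def abs_mult sep_pairs_def)
      then show "AE y in lborel. norm (G y) \<le> norm (norm (x - y) powr (- a) * indicator {y. \<eta> \<le> norm (x - y)} y)" by simp
    qed auto
    have "c' \<le> (\<integral>y. G y \<partial>lborel)"
    proof (cases "?W x = \<rho> powr s")
      case True
      \<comment> \<open>A ball on the side of \<open>- e\<close>: its heights are at most
        \<open>- M/2 + M/8 + M/256 + \<tau>\<close>, hence at most \<open>- M/8\<close>, so the
        barrier is 0 on it.\<close>
      define B where "B = ball (b - (M / 2) *\<^sub>R e) (M / 8)"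
      have "c' \<le> \<rho> powr (s * (p - 1)) * (L + M) powr (- a) * measure lborel B"
        using M by (simp add: c'_def Q_def B_def content_ball)
      also have "\<dots> = (\<integral>y. \<rho> powr (s * (p - 1)) * (L + M) powr (- a) * indicator B y \<partial>lborel)"
        by (simp add: B_def emeasure_lborel_ball_finite)
      also have "\<dots> \<le> (\<integral>y. G y \<partial>lborel)"
      proof (rule integral_mono)
        show "integrable lborel (\<lambda>y. \<rho> powr (s * (p - 1)) * (L + M) powr (- a) * indicator B y)"
          using emeasure_lborel_ball_finite[of "b - (M / 2) *\<^sub>R e" "M / 8"]
          by (intro integrable_mult_right integrable_real_indicator) (auto simp: B_def)
        show "integrable lborel G" by (rule iG)
        fix y
        have sp0: "0 \<le> spow (?W x - ?W y) (p - 1)" using True Wb(2)[of y] by (simp add: spow_nonneg_eq)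
        show "\<rho> powr (s * (p - 1)) * (L + M) powr (- a) * indicator B y \<le> G y"
        proof (cases "y \<in> B")
          case False then show ?thesis using sp0 by (simp add: G_def)
        next
          case yB: True
          define w where "w = y - (b - (M / 2) *\<^sub>R e)"
          have w: "norm w < M / 8" using yB by (simp add: w_def B_def dist_norm norm_minus_commute)
          have yb: "y - b = w + (- M / 2) *\<^sub>R e" by (simp add: w_def)
          have ee: "e \<bullet> e = 1" using e by (simp add: norm_eq_1)
          have we: "\<bar>w \<bullet> e\<bar> \<le> norm w" using Cauchy_Schwarz_ineq2[of w e] e by simp
          have nyb: "norm (y - b) \<le> 5 * M / 8"
            using norm_triangle_ineq[of w "(- M / 2) *\<^sub>R e"] w e M unfolding yb by simp
          have "tang_sq e (y - b) = tang_sq e w" unfolding yb by (rule tang_sq_shift[OF e])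
          also have "\<dots> \<le> (norm w)\<^sup>2" by (rule tang_sq_bounds[OF e])
          also have "\<dots> \<le> (M / 8)\<^sup>2" using w by (intro power_mono) auto
          finally have "\<kappa> * tang_sq e (y - b) \<le> \<kappa> * (M / 8)\<^sup>2" using kap by (intro mult_left_mono) auto
          also have "\<dots> = (4 * \<kappa> * M) * (M / 256)" by (simp add: power2_eq_square)
          also have "\<dots> \<le> 1 * (M / 256)" using M by (intro mult_right_mono) auto
          finally have tg: "\<kappa> * tang_sq e (y - b) \<le> M / 256" by simp
          have "(y - b) \<bullet> e = w \<bullet> e - M / 2" unfolding yb by (simp add: inner_diff_left ee)
          then have hy: "?h y \<le> - (M / 8)"
            using tg we w tau M unfolding para_height_def by linarith
          have Wy: "?W y = 0" using nyb hy M s rho by (simp add: barrier_def trunc_powr_def)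
          \<comment> \<open>Near \<open>b\<close> the heights of \<open>x\<close> and
            \<open>y\<close> differ by at least \<open>M / 8\<close>; with Lipschitz constant 3 this
            yields the distance \<open>M / 24\<close>, the origin of that bound on
            \<open>\<eta>\<close>.\<close>
          have dist: "\<eta> \<le> norm (x - y)"
          proof (cases "norm (x - b) < M")
            case xM: True
            have "?h x \<ge> \<tau>" using geo x xM c1 by (smt (verit) mult_nonneg_nonneg zero_le_power2)
            then have gap: "M / 8 \<le> \<bar>?h y - ?h x\<bar>" using hy tau by linarith
            have "norm (y - x) \<le> norm (y - b) + norm (x - b)" using norm_triangle_ineq4[of "y - b" "x - b"] by simp
            then have "norm (y - x) \<le> 2 * M" using nyb xM M by linarith
            then have "\<bar>?h y - ?h x\<bar> \<le> 3 * norm (y - x)"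
              using xM kap M by (intro para_height_diff_le[OF e]) auto
            then show ?thesis using gap eta(2) by (simp add: norm_minus_commute)
          next
            case False
            have "norm (x - b) \<le> norm (x - y) + norm (y - b)" using norm_triangle_ineq[of "x - y" "y - b"] by simp
            then show ?thesis using False nyb eta(2) M by linarith
          qed
          have inA: "(x, y) \<in> ?A" using hy M dist by (simp add: sep_pairs_def)
          have "norm (x - y) \<le> norm (x - b) + norm (y - b)" using norm_triangle_ineq4[of "x - b" "y - b"] by simp
          then have "norm (x - y) \<le> L + M" using diam x nyb M by fastforce
          then have "(L + M) powr (- a) \<le> norm (x - y) powr (- a)"
            using dist eta a0 by (intro powr_mono2') auto
          then have "\<rho> powr (s * (p - 1)) * (L + M) powr (- a) \<le> \<rho> powr (s * (p - 1)) * norm (x - y) powr (- a)"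
            by (intro mult_left_mono) auto
          also have "\<dots> = G y" using inA True Wy by (simp add: G_def spow_nonneg_eq powr_powr)
          finally show ?thesis using yB by simp
        qed
      qed
      finally show ?thesis .
    next
      case False
      then have xM: "norm (x - b) < M" by (auto simp: barrier_def split: if_splits)
      define d where "d = ?h x"
      have dge: "c1 * (norm (x - b))\<^sup>2 + \<tau> \<le> d" using geo x xM by (simp add: d_def)
      then have d0: "\<tau> \<le> d" "0 < d" using c1 tau by (smt (verit) mult_nonneg_nonneg zero_le_power2)+
      have drho: "d < \<rho>"
      proof (rule ccontr)
        assume "\<not> d < \<rho>"
        then have "?W x = \<rho> powr s" using xM d0 by (simp add: barrier_def trunc_powr_def d_def)
        then show False using False by simp
      qed
      have Wx: "?W x = d powr s" using xM d0 drho by (simp add: barrier_def trunc_powr_def d_def)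
      have xM2: "norm (x - b) \<le> M / 2"
      proof -
        have "c1 * (norm (x - b))\<^sup>2 \<le> c1 * (M / 2)\<^sup>2" using dge tau drho rho(3) by (simp add: power2_eq_square)
        then have "(norm (x - b))\<^sup>2 \<le> (M / 2)\<^sup>2" using c1 by simp
        then show ?thesis using M by (simp add: power2_le_iff_abs_le)
      qed
      define v where "v = e + (2 * \<kappa>) *\<^sub>R ((x - b) - ((x - b) \<bullet> e) *\<^sub>R e)"
      have v: "v \<bullet> e = 1" "norm v \<le> 2"
        unfolding v_def using para_height_gradient[OF e _ M(2), of x b] kap xM by auto
      let ?J = "barrier_jump \<rho> s p d \<epsilon>"
      define G0 where "G0 z = ?J (v \<bullet> z + \<kappa> * tang_sq e z) * norm z powr (- a)" for z
      have iG0: "integrable lborel G0" and G0ge: "c * \<rho> powr (- s) - C \<le> (\<integral>z. G0 z \<partial>lborel)"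
        unfolding G0_def[abs_def] using curved[OF e v d0(2) drho rho(2) eps] by auto
      have same: "G (x + z) = G0 z" if z: "norm (x + z - b) < M" for z
      proof -
        define t where "t = v \<bullet> z + \<kappa> * tang_sq e z"
        have hz: "?h (x + z) = d + t" using para_height_add[of \<kappa> e b \<tau> x z] by (simp add: d_def t_def v_def)
        have Wz: "?W (x + z) = trunc_powr \<rho> s (d + t)" using z by (simp add: barrier_def hz)
        have near: "(0 < d + t \<and> (1 - \<epsilon>) * d < d + t \<and> (1 - \<epsilon>) * (d + t) < d) \<longleftrightarrow> (- (\<epsilon> * d) < t \<and> t < \<epsilon> * d / (1 - \<epsilon>))"
        proof -
          have "(1 - \<epsilon>) * d < d + t \<longleftrightarrow> - (\<epsilon> * d) < t"
            using left_diff_distrib[of 1 \<epsilon> d] by linarith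
          moreover have "(1 - \<epsilon>) * (d + t) < d \<longleftrightarrow> t < \<epsilon> * d / (1 - \<epsilon>)"
            using eps by (simp add: less_divide_eq algebra_simps)
          moreover have "0 < d + t" if "(1 - \<epsilon>) * d < d + t"
          proof -
            have "0 < (1 - \<epsilon>) * d" using eps d0 by simp
            then show ?thesis using that by linarith
          qed
          ultimately show ?thesis by blast
        qed
        have A_iff: "(x, x + z) \<in> ?A \<longleftrightarrow> \<not> (- (\<epsilon> * d) < t \<and> t < \<epsilon> * d / (1 - \<epsilon>)) \<and> \<eta> \<le> norm z"
        proof -
          have "(x, x + z) \<in> ?A \<longleftrightarrow> \<not> (0 < d \<and> 0 < d + t \<and> (1 - \<epsilon>) * d < d + t \<and> (1 - \<epsilon>) * (d + t) < d) \<and> \<eta> \<le> norm z"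
            by (simp add: sep_pairs_def hz d_def[symmetric])
          then show ?thesis using near d0 by blast
        qed
        \<comment> \<open>Here \<open>\<eta> \<le> \<epsilon> * \<tau> / 3\<close> enters: closer
          than \<open>\<eta>\<close> the heights differ by less than \<open>\<epsilon> * d\<close>,
          so the distance cutoff removes nothing that the height condition keeps.\<close>
        have big: "\<eta> \<le> norm z" if nt: "\<not> (- (\<epsilon> * d) < t \<and> t < \<epsilon> * d / (1 - \<epsilon>))"
        proof (rule ccontr)
          assume nz: "\<not> \<eta> \<le> norm z"
          have "norm z \<le> 2 * M" using nz eta M by linarith
          then have "\<bar>?h (x + z) - ?h x\<bar> \<le> 3 * norm z"
            using para_height_diff_le[OF e _ M(2), of x b "x + z" \<tau>] kap xM by simp
          then have "\<bar>t\<bar> < 3 * \<eta>" using nz hz d_def by simp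
          also have "\<dots> \<le> \<epsilon> * d" using eta(3) mult_left_mono[OF d0(1), of \<epsilon>] eps by linarith
          finally have "\<bar>t\<bar> < \<epsilon> * d" .
          moreover have "\<epsilon> * d \<le> \<epsilon> * d / (1 - \<epsilon>)" using eps d0 by (simp add: le_divide_eq mult_left_le)
          ultimately show False using nt by linarith
        qed
        show ?thesis
        proof (cases "- (\<epsilon> * d) < t \<and> t < \<epsilon> * d / (1 - \<epsilon>)")
          case True
          then show ?thesis using A_iff by (simp add: G_def G0_def barrier_jump_def t_def[symmetric])
        next
          case nt: False
          then have "(x, x + z) \<in> ?A" using A_iff big by simp
          moreover have "?J t = spow (d powr s - trunc_powr \<rho> s (d + t)) (p - 1)" using nt by (auto simp: barrier_jump_def)
          ultimately show ?thesis by (simp add: G_def G0_def Wx Wz t_def[symmetric])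
        qed
      qed
      \<comment> \<open>The integrands differ only at points outside the ball of radius
        \<open>M\<close>, at distance at least \<open>M / 2\<close> from \<open>x\<close>. Each is
        at most the kernel in absolute value there, hence the factor 2.\<close>
      have lower: "G0 z - 2 * far z \<le> G (x + z)" for z
      proof (cases "norm (x + z - b) < M")
        case True
        then show ?thesis using same[OF True] by (simp add: far_def)
      next
        case out: False
        have "norm (x + z - b) \<le> norm (x - b) + norm z" using norm_triangle_ineq[of "x - b" z] by (simp add: algebra_simps)
        then have "far z = norm z powr (- a)" using out xM2 by (simp add: far_def)
        moreover have "\<bar>?J (v \<bullet> z + \<kappa> * tang_sq e z)\<bar> \<le> 1"
          using barrier_jump_bounds(2)[OF s p d0(2) drho eps, of "v \<bullet> z + \<kappa> * tang_sq e z"] rsq1 by linarith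
        then have "G0 z \<le> 1 * norm z powr (- a)" unfolding G0_def by (intro mult_right_mono) auto
        moreover have "- G (x + z) \<le> 1 * norm z powr (- a)"
        proof -
          have "- (indicator ?A (x, x + z) * spow (?W x - ?W (x + z)) (p - 1)) \<le> 1"
            using sp_bound[of "x + z"] rsq1 by (auto simp: indicator_def)
          then have "- (indicator ?A (x, x + z) * spow (?W x - ?W (x + z)) (p - 1)) * norm z powr (- a) \<le> 1 * norm z powr (- a)"
            by (intro mult_right_mono) auto
          then show ?thesis by (simp add: G_def)
        qed
        ultimately show ?thesis by linarith
      qed
      have "c' \<le> c * \<rho> powr (- s) - C - 2 * F" using rhoX by (simp add: c'_def)
      also have "\<dots> \<le> (\<integral>z. G0 z \<partial>lborel) - 2 * F" using G0ge by simp
      also have "\<dots> = (\<integral>z. G0 z - 2 * far z \<partial>lborel)" using iG0 ifar by (simp add: F_def)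
      also have "\<dots> \<le> (\<integral>z. G (x + z) \<partial>lborel)"
      proof (rule integral_mono)
        show "integrable lborel (\<lambda>z. G (x + z))"
        proof -
          have "integrable (distr lborel borel ((+) x)) G" using iG by (simp add: lborel_distr_plus)
          then show ?thesis by (subst (asm) integrable_distr_eq) auto
        qed
        show "integrable lborel (\<lambda>z. G0 z - 2 * far z)" using iG0 ifar by auto
      qed (rule lower)
      also have "\<dots> = (\<integral>y. G y \<partial>distr lborel borel ((+) x))" by (subst integral_distr) auto
      also have "\<dots> = (\<integral>y. G y \<partial>lborel)" by (simp add: lborel_distr_plus)
      finally show ?thesis .
    qed
    then show "c' \<le> (\<integral>y. indicator ?A (x, y) * spow (?W x - ?W y) (p - 1) * norm (x - y) powr (- (real DIM('a) + p * s)) \<partial>lborel)"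
      by (simp add: G_def a_def)
  qed
qed

subsection \<open>Comparison\<close>

lemma sigma_finite_lebesgue: "sigma_finite_measure (lebesgue :: 'a::euclidean_space measure)"
proof
  show "\<exists>A. countable A \<and> A \<subseteq> sets (lebesgue :: 'a measure) \<and> \<Union> A = space lebesgue \<and> (\<forall>a\<in>A. emeasure lebesgue a \<noteq> \<infinity>)"
  proof (intro exI[of _ "range (\<lambda>n::nat. cball (0::'a) n)"] conjI)
    show "\<Union> (range (\<lambda>n::nat. cball (0::'a) n)) = space lebesgue"
      using real_arch_simple by (auto simp: dist_norm)
    show "\<forall>a\<in>range (\<lambda>n::nat. cball (0::'a) n). emeasure lebesgue a \<noteq> \<infinity>"
      using emeasure_lborel_cball_finite[where 'a='a] by (auto simp: less_top)
  qed auto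
qed

lemma pair_sigma_finite_lebesgue:
  "pair_sigma_finite (lebesgue :: 'a::euclidean_space measure) (lebesgue :: 'a measure)"
  using sigma_finite_lebesgue by (simp add: pair_sigma_finite_def)

lemma AE_pair_both:
  fixes M :: "'a measure"
  assumes "sigma_finite_measure M" "AE x in M. P x"
  shows "AE z in M \<Otimes>\<^sub>M M. P (fst z) \<and> P (snd z)"
proof -
  interpret sigma_finite_measure M by fact
  obtain N where N: "{x\<in>space M. \<not> P x} \<subseteq> N" "emeasure M N = 0" "N \<in> sets M"
    using assms(2) by (rule AE_E)
  have "AE z in M \<Otimes>\<^sub>M M. P (fst z)"
    using N by (intro AE_I[where N="N \<times> space M"]) (auto simp: space_pair_measure emeasure_pair_measure_Times)
  moreover have "AE z in M \<Otimes>\<^sub>M M. P (snd z)"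
    using N by (intro AE_I[where N="space M \<times> N"]) (auto simp: space_pair_measure emeasure_pair_measure_Times)
  ultimately show ?thesis by eventually_elim simp
qed

lemma borel_lebesgue_measurable [measurable (raw)]:
  "f \<in> borel_measurable borel \<Longrightarrow> f \<in> borel_measurable lebesgue"
  by (intro measurable_completion) simp

lemma borel_pair_lebesgue_measurable:
  fixes f :: "'a::euclidean_space \<times> 'a \<Rightarrow> 'b::topological_space"
  assumes f: "f \<in> borel_measurable (borel \<Otimes>\<^sub>M borel)"
  shows "f \<in> borel_measurable (lebesgue \<Otimes>\<^sub>M lebesgue)"
proof -
  have "(\<lambda>z. z) \<in> measurable (lebesgue \<Otimes>\<^sub>M (lebesgue :: 'a measure)) (borel \<Otimes>\<^sub>M borel)"
  proof -
    have "(\<lambda>z. (fst z, snd z)) \<in> measurable (lebesgue \<Otimes>\<^sub>M (lebesgue :: 'a measure)) (borel \<Otimes>\<^sub>M borel)"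
      by (intro measurable_Pair) (auto intro!: measurable_compose[OF measurable_fst] measurable_compose[OF measurable_snd] measurable_completion)
    then show ?thesis by simp
  qed
  from measurable_compose[OF this f] show ?thesis by simp
qed

lemma add_powr_le:
  fixes a b p :: real
  assumes "0 \<le> a" "0 \<le> b" "0 < p"
  shows "(a + b) powr p \<le> 2 powr p * (a powr p + b powr p)"
proof -
  have "(a + b) powr p \<le> (2 * max a b) powr p" using assms by (intro powr_mono2) auto
  also have "\<dots> = 2 powr p * max a b powr p" by (simp add: powr_mult)
  also have "\<dots> \<le> 2 powr p * (a powr p + b powr p)" by (intro mult_left_mono) (auto simp: max_def)
  finally show ?thesis .
qed

lemma powr_mult_le_add:
  fixes a b p :: real
  assumes "0 \<le> a" "0 \<le> b" "1 < p"
  shows "a powr (p - 1) * b \<le> a powr p + b powr p"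
proof -
  define m where "m = max a b"
  have pw: "x powr p = x powr (p - 1) * x" if "0 \<le> x" for x :: real
    using that by (cases "x = 0") (auto simp: powr_diff)
  have "a powr (p - 1) * b \<le> m powr (p - 1) * m"
    using assms by (intro mult_mono powr_mono2) (auto simp: m_def)
  also have "\<dots> = m powr p" using assms by (simp add: pw m_def)
  also have "\<dots> \<le> a powr p + b powr p" by (auto simp: m_def max_def)
  finally show ?thesis .
qed

text \<open>Monotonicity of \<open>spow\<close> bounds the energy of \<open>u\<close> against the
  test function from below by that of \<open>lam * W\<close>. On the symmetric set
  \<open>A n\<close> the latter folds into twice an integral of the pointwise bound
  \<open>super\<close>. Thus \<open>2 * lam powr (p - 1) * c\<close> times the integral of the test
  function is at most \<open>K\<close> times it, which forces that integral to be 0. The limit in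
  \<open>n\<close> is taken only in the integral containing \<open>u\<close>, so no principal value
  of \<open>W\<close> occurs.\<close>

lemma comparison_with_barrier:
  fixes s p K c lam B :: real and \<Omega> :: "'a::euclidean_space set" and u W :: "'a \<Rightarrow> real" and A :: "nat \<Rightarrow> ('a \<times> 'a) set"
  assumes s: "0 < s" "s < 1" and p: "1 < p" and Om: "open \<Omega>" "bounded \<Omega>"
    and u: "u \<in> Wsp0 s p \<Omega>" and weak: "weak_bounded_fplap s p \<Omega> u K"
    and Wm: "W \<in> borel_measurable borel" and W: "\<And>x. 0 \<le> W x" "\<And>x. W x \<le> B"
    and Wfin: "(\<integral>\<^sup>+ z. ennreal (indicator (\<Omega> \<times> \<Omega>) z * \<bar>W (fst z) - W (snd z)\<bar> powr p
              / norm (fst z - snd z) powr (real DIM('a) + p * s)) \<partial>(lebesgue \<Otimes>\<^sub>M lebesgue)) < \<infinity>"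
    and Am: "\<And>n. A n \<in> sets (borel \<Otimes>\<^sub>M borel)" and Asym: "\<And>n x y. (x, y) \<in> A n \<longleftrightarrow> (y, x) \<in> A n"
    and Asep: "\<And>n. \<exists>\<eta>>0. \<forall>x y. (x, y) \<in> A n \<longrightarrow> \<eta> \<le> norm (x - y)"
    and Alim: "AE z in lebesgue \<Otimes>\<^sub>M lebesgue. eventually (\<lambda>n. z \<in> A n) sequentially"
    and super: "\<And>n x. x \<in> \<Omega> \<Longrightarrow> c \<le> (\<integral>y. indicator (A n) (x, y) * spow (W x - W y) (p - 1)
           * norm (x - y) powr (- (real DIM('a) + p * s)) \<partial>lborel)"
    and lam: "0 < lam" "K < 2 * lam powr (p - 1) * c"
  shows "AE x in lebesgue. x \<in> \<Omega> \<longrightarrow> u x \<le> lam * W x"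
proof -
  interpret pair_sigma_finite "lebesgue :: 'a measure" "lebesgue :: 'a measure" by (rule pair_sigma_finite_lebesgue)
  let ?L = "lebesgue \<Otimes>\<^sub>M lebesgue :: ('a \<times> 'a) measure"
  define a where "a = real DIM('a) + p * s"
  have ps: "0 < p * s" using s p by simp
  define kk where "kk z = norm (fst z - snd z) powr (- a)" for z :: "'a \<times> 'a"
  have kk0: "0 \<le> kk z" for z by (simp add: kk_def)
  have kkdiv: "t / norm (fst z - snd z) powr (real DIM('a) + p * s) = t * kk z" for t and z :: "'a \<times> 'a"
    by (simp only: kk_def a_def powr_minus divide_inverse)
  have [measurable]: "\<Omega> \<in> sets lebesgue" using Om by auto
  have um [measurable]: "u \<in> borel_measurable lebesgue" and uint: "integrable lebesgue (\<lambda>x. \<bar>u x\<bar> powr p)"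
    and ufin: "(\<integral>\<^sup>+ z. ennreal (\<bar>u (fst z) - u (snd z)\<bar> powr p * kk z) \<partial>?L) < \<infinity>"
    and u0: "AE x in lebesgue. x \<notin> \<Omega> \<longrightarrow> u x = 0"
    using u by (auto simp: Wsp0_def kkdiv)
  have [measurable]: "W \<in> borel_measurable lebesgue" using Wm by (rule borel_lebesgue_measurable)
  have kkm [measurable]: "kk \<in> borel_measurable ?L"
    unfolding kk_def[abs_def] by (rule borel_pair_lebesgue_measurable) measurable
  have AL [measurable]: "A n \<in> sets ?L" for n
  proof -
    have "(indicator (A n) :: 'a \<times> 'a \<Rightarrow> real) \<in> borel_measurable ?L"
      using Am[of n] by (intro borel_pair_lebesgue_measurable) auto
    then show ?thesis by (simp add: borel_measurable_indicator_iff space_pair_measure)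
  qed
  \<comment> \<open>Set to 0 outside \<open>\<Omega>\<close> at every point, since \<open>u\<close>
    vanishes there only almost everywhere.\<close>
  define \<phi> where "\<phi> x = (if x \<in> \<Omega> then max (u x - lam * W x) 0 else 0)" for x
  have phim [measurable]: "\<phi> \<in> borel_measurable lebesgue"
    unfolding \<phi>_def[abs_def] by measurable
  have phi0: "0 \<le> \<phi> x" for x by (simp add: \<phi>_def)
  have phiu: "\<phi> x \<le> \<bar>u x\<bar>" for x
  proof -
    have "0 \<le> lam * W x" using W(1)[of x] lam by simp
    then have "u x - lam * W x \<le> \<bar>u x\<bar>" by linarith
    then show ?thesis by (simp add: \<phi>_def)
  qed
  have phip: "integrable lebesgue (\<lambda>x. \<bar>\<phi> x\<bar> powr p)"
    using phi0 phiu p by (intro Bochner_Integration.integrable_bound[OF uint]) (auto intro!: powr_mono2)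
  have AEu: "AE z in ?L. (fst z \<notin> \<Omega> \<longrightarrow> u (fst z) = 0) \<and> (snd z \<notin> \<Omega> \<longrightarrow> u (snd z) = 0)"
    using AE_pair_both[OF sigma_finite_lebesgue u0] by simp
  have mem: "(z \<in> \<Omega> \<times> \<Omega>) \<longleftrightarrow> fst z \<in> \<Omega> \<and> snd z \<in> \<Omega>" for z by (cases z) auto
  have phifin: "(\<integral>\<^sup>+ z. ennreal (\<bar>\<phi> (fst z) - \<phi> (snd z)\<bar> powr p * kk z) \<partial>?L) < \<infinity>"
  proof -
    have "(\<integral>\<^sup>+ z. ennreal (\<bar>\<phi> (fst z) - \<phi> (snd z)\<bar> powr p * kk z) \<partial>?L)
      \<le> (\<integral>\<^sup>+ z. ennreal (2 powr p) * ennreal (\<bar>u (fst z) - u (snd z)\<bar> powr p * kk z)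
         + ennreal (2 powr p * lam powr p) * ennreal (indicator (\<Omega> \<times> \<Omega>) z * \<bar>W (fst z) - W (snd z)\<bar> powr p * kk z) \<partial>?L)"
    proof (rule nn_integral_mono_AE, use AEu in eventually_elim)
      fix z assume z: "(fst z \<notin> \<Omega> \<longrightarrow> u (fst z) = 0) \<and> (snd z \<notin> \<Omega> \<longrightarrow> u (snd z) = 0)"
      define x y where "x = fst z" and "y = snd z"
      have ux: "x \<notin> \<Omega> \<Longrightarrow> u x = 0" and uy: "y \<notin> \<Omega> \<Longrightarrow> u y = 0" using z by (auto simp: x_def y_def)
      \<comment> \<open>If one of the points is outside \<open>\<Omega>\<close>, then
        \<open>u\<close> and \<open>\<phi>\<close> vanish there and
        \<open>\<phi> \<le> \<bar>u\<bar>\<close> suffices; so \<open>W\<close> is compared only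
        over \<open>\<Omega> \<times> \<Omega>\<close>.\<close>
      have "\<bar>\<phi> x - \<phi> y\<bar> \<le> \<bar>u x - u y\<bar> + lam * (indicator (\<Omega> \<times> \<Omega>) z * \<bar>W x - W y\<bar>)"
      proof (cases "x \<in> \<Omega> \<and> y \<in> \<Omega>")
        case True
        have "\<bar>\<phi> x - \<phi> y\<bar> \<le> \<bar>(u x - lam * W x) - (u y - lam * W y)\<bar>" using True by (auto simp: \<phi>_def)
        also have "\<dots> \<le> \<bar>u x - u y\<bar> + \<bar>lam * (W x - W y)\<bar>" by (simp add: right_diff_distrib)
        also have "\<bar>lam * (W x - W y)\<bar> = lam * \<bar>W x - W y\<bar>" using lam by (simp add: abs_mult)
        finally show ?thesis using True mem[of z] by (simp add: x_def y_def)
      next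
        case False
        have "\<bar>\<phi> x - \<phi> y\<bar> \<le> \<bar>u x - u y\<bar>"
        proof (cases "x \<in> \<Omega>")
          case True
          then have "y \<notin> \<Omega>" using False by simp
          then show ?thesis using phiu[of x] phi0[of x] uy by (simp add: \<phi>_def[of y])
        next
          case xn: False
          then show ?thesis using phiu[of y] phi0[of y] ux by (simp add: \<phi>_def[of x])
        qed
        then show ?thesis using False mem[of z] by (simp add: x_def y_def)
      qed
      then have "\<bar>\<phi> x - \<phi> y\<bar> powr p \<le> (\<bar>u x - u y\<bar> + lam * (indicator (\<Omega> \<times> \<Omega>) z * \<bar>W x - W y\<bar>)) powr p"
        using p by (intro powr_mono2) auto
      also have "\<dots> \<le> 2 powr p * (\<bar>u x - u y\<bar> powr p + (lam * (indicator (\<Omega> \<times> \<Omega>) z * \<bar>W x - W y\<bar>)) powr p)"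
        using p lam by (intro add_powr_le) auto
      also have "(lam * (indicator (\<Omega> \<times> \<Omega>) z * \<bar>W x - W y\<bar>)) powr p = lam powr p * (indicator (\<Omega> \<times> \<Omega>) z * \<bar>W x - W y\<bar> powr p)"
        by (simp add: powr_mult indicator_def)
      finally have "\<bar>\<phi> x - \<phi> y\<bar> powr p * kk z \<le> 2 powr p * (\<bar>u x - u y\<bar> powr p + lam powr p * (indicator (\<Omega> \<times> \<Omega>) z * \<bar>W x - W y\<bar> powr p)) * kk z"
        using kk0 by (intro mult_right_mono) auto
      also have "\<dots> = 2 powr p * (\<bar>u x - u y\<bar> powr p * kk z) + 2 powr p * lam powr p * (indicator (\<Omega> \<times> \<Omega>) z * \<bar>W x - W y\<bar> powr p * kk z)"
        by (simp add: algebra_simps)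
      finally have "ennreal (\<bar>\<phi> x - \<phi> y\<bar> powr p * kk z) \<le> ennreal \<dots>" by (rule ennreal_leI)
      also have "\<dots> = ennreal (2 powr p) * ennreal (\<bar>u x - u y\<bar> powr p * kk z)
         + ennreal (2 powr p * lam powr p) * ennreal (indicator (\<Omega> \<times> \<Omega>) z * \<bar>W x - W y\<bar> powr p * kk z)"
        using kk0[of z] by (simp add: ennreal_plus ennreal_mult')
      finally show "ennreal (\<bar>\<phi> (fst z) - \<phi> (snd z)\<bar> powr p * kk z)
         \<le> ennreal (2 powr p) * ennreal (\<bar>u (fst z) - u (snd z)\<bar> powr p * kk z)
         + ennreal (2 powr p * lam powr p) * ennreal (indicator (\<Omega> \<times> \<Omega>) z * \<bar>W (fst z) - W (snd z)\<bar> powr p * kk z)"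
        by (simp add: x_def y_def)
    qed
    also have "\<dots> = ennreal (2 powr p) * (\<integral>\<^sup>+ z. ennreal (\<bar>u (fst z) - u (snd z)\<bar> powr p * kk z) \<partial>?L)
       + ennreal (2 powr p * lam powr p) * (\<integral>\<^sup>+ z. ennreal (indicator (\<Omega> \<times> \<Omega>) z * \<bar>W (fst z) - W (snd z)\<bar> powr p * kk z) \<partial>?L)"
      by (subst nn_integral_add) (auto simp: nn_integral_cmult)
    also have "\<dots> < \<infinity>"
      using ufin Wfin by (simp add: kkdiv ennreal_mult_less_top)
    finally show ?thesis .
  qed
  have phiW: "\<phi> \<in> Wsp0 s p \<Omega>"
    using phip phifin by (auto simp: Wsp0_def kkdiv) (auto simp: \<phi>_def)
  \<comment> \<open>From \<open>t \<le> 1 + t powr p\<close> and the finite measure of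
    \<open>\<Omega>\<close>.\<close>
  have phi1: "integrable lebesgue \<phi>"
  proof (rule Bochner_Integration.integrable_bound)
    show "integrable lebesgue (\<lambda>x. indicator \<Omega> x + \<bar>\<phi> x\<bar> powr p)"
      using Om phip emeasure_bounded_finite[OF Om(2)]
      by (intro Bochner_Integration.integrable_add integrable_real_indicator) auto
    show "AE x in lebesgue. norm (\<phi> x) \<le> norm (indicator \<Omega> x + \<bar>\<phi> x\<bar> powr p)"
    proof (rule AE_I2)
      fix x
      show "norm (\<phi> x) \<le> norm (indicator \<Omega> x + \<bar>\<phi> x\<bar> powr p)"
      proof (cases "x \<in> \<Omega>")
        case True
        have "\<phi> x \<le> 1 + \<phi> x powr p"
        proof (cases "\<phi> x \<le> 1")
          case False
          then have "\<phi> x powr 1 \<le> \<phi> x powr p" using p by (intro powr_mono) auto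
          then show ?thesis using False by simp
        qed (auto intro: order_trans)
        then show ?thesis using True phi0[of x] by simp
      qed (simp add: \<phi>_def)
    qed
  qed auto
  have phiset: "(\<integral>x\<in>\<Omega>. \<phi> x \<partial>lebesgue) = (\<integral>x. \<phi> x \<partial>lebesgue)"
    unfolding set_lebesgue_integral_def by (intro Bochner_Integration.integral_cong) (auto simp: \<phi>_def indicator_def)
  define G where "G z = spow (u (fst z) - u (snd z)) (p - 1) * (\<phi> (fst z) - \<phi> (snd z)) * kk z" for z
  have Gm [measurable]: "G \<in> borel_measurable ?L" unfolding G_def[abs_def] by measurable
  have Gint: "integrable ?L G"
  proof (rule Bochner_Integration.integrable_bound)
    show "integrable ?L (\<lambda>z. \<bar>u (fst z) - u (snd z)\<bar> powr p * kk z + \<bar>\<phi> (fst z) - \<phi> (snd z)\<bar> powr p * kk z)"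
      using ufin phifin kk0 by (intro Bochner_Integration.integrable_add integrableI_nonneg) auto
    show "AE z in ?L. norm (G z) \<le> norm (\<bar>u (fst z) - u (snd z)\<bar> powr p * kk z + \<bar>\<phi> (fst z) - \<phi> (snd z)\<bar> powr p * kk z)"
    proof (rule AE_I2)
      fix z
      have "norm (G z) = (\<bar>u (fst z) - u (snd z)\<bar> powr (p - 1) * \<bar>\<phi> (fst z) - \<phi> (snd z)\<bar>) * kk z"
        using kk0[of z] by (simp add: G_def abs_mult abs_spow)
      also have "\<dots> \<le> (\<bar>u (fst z) - u (snd z)\<bar> powr p + \<bar>\<phi> (fst z) - \<phi> (snd z)\<bar> powr p) * kk z"
        using kk0 p by (intro mult_right_mono powr_mult_le_add) auto
      finally show "norm (G z) \<le> norm (\<bar>u (fst z) - u (snd z)\<bar> powr p * kk z + \<bar>\<phi> (fst z) - \<phi> (snd z)\<bar> powr p * kk z)"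
        using kk0[of z] by (simp add: distrib_right)
    qed
  qed auto
  have "frac_energy s p u \<phi> = (\<integral>z. G z \<partial>?L)"
    unfolding frac_energy_def G_def kkdiv ..
  then have EK: "(\<integral>z. G z \<partial>?L) \<le> K * (\<integral>x. \<phi> x \<partial>lebesgue)"
    using weak phiW phi0 unfolding weak_bounded_fplap_def phiset[symmetric] by metis
  have step: "2 * lam powr (p - 1) * c * (\<integral>x. \<phi> x \<partial>lebesgue) \<le> (\<integral>z. indicator (A n) z * G z \<partial>?L)" for n
  proof -
    define f where "f z = indicator (A n) z * spow (W (fst z) - W (snd z)) (p - 1) * kk z" for z
    have fm [measurable]: "f \<in> borel_measurable ?L" unfolding f_def[abs_def] by measurable
    have fswap: "f (y, x) = - f (x, y)" for x y
      using Asym[of x y n] spow_minus[of "W x - W y" "p - 1"]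
      by (simp add: f_def kk_def indicator_def norm_minus_commute)
    obtain \<eta> where eta: "\<eta> > 0" "\<And>x y. (x, y) \<in> A n \<Longrightarrow> \<eta> \<le> norm (x - y)" using Asep[of n] by auto
    define R where "R z = \<phi> (fst z) * f z" for z
    have Rm [measurable]: "R \<in> borel_measurable ?L" unfolding R_def[abs_def] by measurable
    define Kc where "Kc = (\<integral>\<^sup>+(z::'a). ennreal (norm z powr (- a)) * indicator {z. \<eta> \<le> norm z} z \<partial>lborel)"
    have Kc: "Kc < \<infinity>" unfolding Kc_def a_def using eta ps by (intro nn_integral_norm_powr_outside_ball) auto
    have B0: "0 \<le> B" using W(1)[of 0] W(2)[of 0] by linarith
    \<comment> \<open>The separation by \<open>\<eta>\<close> makes this one-sided term absolutely
      integrable, so that the symmetric integral may be split and Fubini applied.\<close>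
    have Rint: "integrable ?L R"
    proof (rule integrableI_bounded)
      have "(\<integral>\<^sup>+z. ennreal (norm (R z)) \<partial>?L) = (\<integral>\<^sup>+x. (\<integral>\<^sup>+y. ennreal (norm (R (x, y))) \<partial>lebesgue) \<partial>lebesgue)"
        by (rule sigma_finite_measure.nn_integral_fst[OF sigma_finite_lebesgue, symmetric]) measurable
      also have "\<dots> \<le> (\<integral>\<^sup>+x. ennreal (\<phi> x) * (ennreal (B powr (p - 1)) * Kc) \<partial>lebesgue)"
      proof (rule nn_integral_mono)
        fix x :: 'a
        have "(\<integral>\<^sup>+y. ennreal (norm (R (x, y))) \<partial>lebesgue) = (\<integral>\<^sup>+y. ennreal (norm (R (x, y))) \<partial>lborel)"
          by (rule nn_integral_completion)
        also have "\<dots> \<le> (\<integral>\<^sup>+y. ennreal (\<phi> x) * (ennreal (B powr (p - 1)) * (ennreal (norm (x - y) powr (- a)) * indicator {z. \<eta> \<le> norm z} (x - y))) \<partial>lborel)"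
        proof (rule nn_integral_mono)
          fix y
          show "ennreal (norm (R (x, y))) \<le> ennreal (\<phi> x) * (ennreal (B powr (p - 1)) * (ennreal (norm (x - y) powr (- a)) * indicator {z. \<eta> \<le> norm z} (x - y)))"
          proof (cases "(x, y) \<in> A n")
            case True
            have "\<bar>W x - W y\<bar> \<le> B" using W(1)[of x] W(1)[of y] W(2)[of x] W(2)[of y] by linarith
            then have "\<bar>W x - W y\<bar> powr (p - 1) \<le> B powr (p - 1)" using p by (intro powr_mono2) auto
            then have "norm (R (x, y)) \<le> \<phi> x * (B powr (p - 1) * norm (x - y) powr (- a))"
              using phi0[of x] True
              by (auto simp: R_def f_def kk_def abs_mult abs_spow intro!: mult_left_mono mult_right_mono)
            then have "ennreal (norm (R (x, y))) \<le> ennreal (\<phi> x * (B powr (p - 1) * norm (x - y) powr (- a)))"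
              by (rule ennreal_leI)
            then show ?thesis using eta(2)[OF True] phi0[of x] by (simp add: ennreal_mult')
          next
            case False
            then show ?thesis by (simp add: R_def f_def)
          qed
        qed
        also have "\<dots> = ennreal (\<phi> x) * (ennreal (B powr (p - 1)) * (\<integral>\<^sup>+y. ennreal (norm (x - y) powr (- a)) * indicator {z. \<eta> \<le> norm z} (x - y) \<partial>lborel))"
          by (subst nn_integral_cmult, measurable, subst nn_integral_cmult, measurable)
        also have "(\<integral>\<^sup>+y. ennreal (norm (x - y) powr (- a)) * indicator {z. \<eta> \<le> norm z} (x - y) \<partial>lborel)
          = (\<integral>\<^sup>+y. ennreal (norm (x - (x + y)) powr (- a)) * indicator {z. \<eta> \<le> norm z} (x - (x + y)) \<partial>lborel)"
          by (rule nn_integral_lborel_translate[symmetric]) measurable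
        also have "\<dots> = Kc" unfolding Kc_def by (intro nn_integral_cong) (auto simp: indicator_def)
        finally show "(\<integral>\<^sup>+y. ennreal (norm (R (x, y))) \<partial>lebesgue) \<le> ennreal (\<phi> x) * (ennreal (B powr (p - 1)) * Kc)" .
      qed
      also have "\<dots> = (\<integral>\<^sup>+x. ennreal (\<phi> x) \<partial>lebesgue) * (ennreal (B powr (p - 1)) * Kc)"
        by (rule nn_integral_multc) measurable
      also have "\<dots> < \<infinity>"
      proof -
        have "(\<integral>\<^sup>+x. ennreal (\<phi> x) \<partial>lebesgue) < \<infinity>"
          using phi1 phi0 by (simp add: integrable_iff_bounded)
        then show ?thesis using Kc by (simp add: ennreal_mult_less_top)
      qed
      finally show "(\<integral>\<^sup>+z. ennreal (norm (R z)) \<partial>?L) < \<infinity>" .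
    qed auto
    have Rswap: "integrable ?L (\<lambda>z. R (snd z, fst z))" "(\<integral>z. R (snd z, fst z) \<partial>?L) = (\<integral>z. R z \<partial>?L)"
      using integrable_product_swap[OF Rint] integral_product_swap[of R] by (auto simp: case_prod_beta')
    \<comment> \<open>Antisymmetry of \<open>f\<close> makes the second summand the swapped first
      one; this is the origin of the factor 2.\<close>
    have H: "f z * (\<phi> (fst z) - \<phi> (snd z)) = R z + R (snd z, fst z)" for z
      using fswap[of "snd z" "fst z"] by (simp add: R_def algebra_simps)
    have Hint: "integrable ?L (\<lambda>z. f z * (\<phi> (fst z) - \<phi> (snd z)))"
      unfolding H using Rint Rswap by auto
    have "(\<integral>z. f z * (\<phi> (fst z) - \<phi> (snd z)) \<partial>?L) = 2 * (\<integral>z. R z \<partial>?L)"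
      unfolding H using Rint Rswap by simp
    also have "(\<integral>z. R z \<partial>?L) = (\<integral>x. (\<integral>y. R (x, y) \<partial>lebesgue) \<partial>lebesgue)"
      by (rule integral_fst'[OF Rint, symmetric])
    also have "\<dots> = (\<integral>x. \<phi> x * (\<integral>y. f (x, y) \<partial>lebesgue) \<partial>lebesgue)"
      by (simp add: R_def)
    finally have Heq: "(\<integral>z. f z * (\<phi> (fst z) - \<phi> (snd z)) \<partial>?L) = 2 * (\<integral>x. \<phi> x * (\<integral>y. f (x, y) \<partial>lebesgue) \<partial>lebesgue)" .
    have inner: "(\<integral>y. f (x, y) \<partial>lebesgue) = (\<integral>y. indicator (A n) (x, y) * spow (W x - W y) (p - 1)
           * norm (x - y) powr (- (real DIM('a) + p * s)) \<partial>lborel)" for x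
    proof -
      have [measurable]: "A n \<in> sets (borel \<Otimes>\<^sub>M borel)" by (rule Am)
      note [measurable] = Wm
      have "(\<lambda>y. f (x, y)) \<in> borel_measurable lborel"
        unfolding f_def kk_def by simp
      then have "(\<integral>y. f (x, y) \<partial>lebesgue) = (\<integral>y. f (x, y) \<partial>lborel)" by (rule integral_completion)
      then show ?thesis by (simp add: f_def kk_def a_def)
    qed
    have "c * (\<integral>x. \<phi> x \<partial>lebesgue) = (\<integral>x. c * \<phi> x \<partial>lebesgue)" by simp
    also have "\<dots> \<le> (\<integral>x. \<phi> x * (\<integral>y. f (x, y) \<partial>lebesgue) \<partial>lebesgue)"
    proof (rule integral_mono)
      show "integrable lebesgue (\<lambda>x. c * \<phi> x)" using phi1 by simp
      show "integrable lebesgue (\<lambda>x. \<phi> x * (\<integral>y. f (x, y) \<partial>lebesgue))"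
        using integrable_fst'[OF Rint] by (simp add: R_def)
      fix x
      show "c * \<phi> x \<le> \<phi> x * (\<integral>y. f (x, y) \<partial>lebesgue)"
      proof (cases "x \<in> \<Omega>")
        case True
        then have "c \<le> (\<integral>y. f (x, y) \<partial>lebesgue)" unfolding inner by (rule super)
        from mult_left_mono[OF this phi0[of x]] show ?thesis by (simp add: mult.commute)
      qed (simp add: \<phi>_def)
    qed
    finally have 1: "2 * (c * (\<integral>x. \<phi> x \<partial>lebesgue)) \<le> (\<integral>z. f z * (\<phi> (fst z) - \<phi> (snd z)) \<partial>?L)"
      unfolding Heq by simp
    have "2 * lam powr (p - 1) * c * (\<integral>x. \<phi> x \<partial>lebesgue) = lam powr (p - 1) * (2 * (c * (\<integral>x. \<phi> x \<partial>lebesgue)))" by simp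
    also have "\<dots> \<le> lam powr (p - 1) * (\<integral>z. f z * (\<phi> (fst z) - \<phi> (snd z)) \<partial>?L)"
      using 1 by (intro mult_left_mono) auto
    also have "\<dots> = (\<integral>z. lam powr (p - 1) * (f z * (\<phi> (fst z) - \<phi> (snd z))) \<partial>?L)" by simp
    also have "\<dots> \<le> (\<integral>z. indicator (A n) z * G z \<partial>?L)"
    proof (rule integral_mono_AE)
      show "integrable ?L (\<lambda>z. lam powr (p - 1) * (f z * (\<phi> (fst z) - \<phi> (snd z))))" using Hint by simp
      show "integrable ?L (\<lambda>z. indicator (A n) z * G z)"
        by (rule Bochner_Integration.integrable_bound[OF Gint]) (auto simp: indicator_def)
      show "AE z in ?L. lam powr (p - 1) * (f z * (\<phi> (fst z) - \<phi> (snd z))) \<le> indicator (A n) z * G z"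
        using AEu
      proof eventually_elim
        fix z assume z: "(fst z \<notin> \<Omega> \<longrightarrow> u (fst z) = 0) \<and> (snd z \<notin> \<Omega> \<longrightarrow> u (snd z) = 0)"
        define x y where "x = fst z" and "y = snd z"
        have ux: "x \<notin> \<Omega> \<Longrightarrow> u x = 0" and uy: "y \<notin> \<Omega> \<Longrightarrow> u y = 0" using z by (auto simp: x_def y_def)
        have lW: "0 \<le> lam * W x" "0 \<le> lam * W y" using lam W(1) by auto
        \<comment> \<open>If \<open>\<phi> y < \<phi> x\<close>, then \<open>\<phi> x\<close> equals
          \<open>u x - lam * W x\<close> while \<open>\<phi> y\<close> is at least
          \<open>u y - lam * W y\<close>, outside \<open>\<Omega>\<close> because
          \<open>W \<ge> 0\<close> there. So the difference of \<open>u\<close> exceeds that of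
          \<open>lam * W\<close>; the other case is symmetric.\<close>
        have key: "spow (lam * (W x - W y)) (p - 1) * (\<phi> x - \<phi> y) \<le> spow (u x - u y) (p - 1) * (\<phi> x - \<phi> y)"
        proof -
          consider "\<phi> x < \<phi> y" | "\<phi> x = \<phi> y" | "\<phi> y < \<phi> x" by linarith
          then show ?thesis
          proof cases
            case 1
            have "u x - u y \<le> lam * (W x - W y)"
              using 1 ux uy lW by (auto simp: \<phi>_def right_diff_distrib split: if_splits)
            then have "spow (u x - u y) (p - 1) \<le> spow (lam * (W x - W y)) (p - 1)" using p by (intro spow_mono) auto
            then show ?thesis using 1 by (intro mult_right_mono_neg) auto
          next
            case 3
            have "lam * (W x - W y) \<le> u x - u y"
              using 3 ux uy lW by (auto simp: \<phi>_def right_diff_distrib split: if_splits)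
            then have "spow (lam * (W x - W y)) (p - 1) \<le> spow (u x - u y) (p - 1)" using p by (intro spow_mono) auto
            then show ?thesis using 3 by (intro mult_right_mono) auto
          qed simp
        qed
        have "lam powr (p - 1) * (f z * (\<phi> x - \<phi> y)) = (indicator (A n) z * kk z) * (spow (lam * (W x - W y)) (p - 1) * (\<phi> x - \<phi> y))"
          using lam by (simp add: f_def spow_cmult x_def y_def)
        also have "\<dots> \<le> (indicator (A n) z * kk z) * (spow (u x - u y) (p - 1) * (\<phi> x - \<phi> y))"
          using key kk0[of z] by (intro mult_left_mono) auto
        also have "\<dots> = indicator (A n) z * G z" by (simp add: G_def x_def y_def)
        finally show "lam powr (p - 1) * (f z * (\<phi> (fst z) - \<phi> (snd z))) \<le> indicator (A n) z * G z"
          by (simp add: x_def y_def)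
      qed
    qed
    finally show ?thesis .
  qed
  have lim: "(\<lambda>n. \<integral>z. indicator (A n) z * G z \<partial>?L) \<longlonglongrightarrow> (\<integral>z. G z \<partial>?L)"
  proof (rule integral_dominated_convergence[where w = "\<lambda>z. norm (G z)"])
    show "AE z in ?L. (\<lambda>n. indicator (A n) z * G z) \<longlonglongrightarrow> G z"
      using Alim
    proof eventually_elim
      fix z assume "eventually (\<lambda>n. z \<in> A n) sequentially"
      then have "eventually (\<lambda>n. indicator (A n) z * G z = G z) sequentially"
        by eventually_elim simp
      then show "(\<lambda>n. indicator (A n) z * G z) \<longlonglongrightarrow> G z" by (rule tendsto_eventually)
    qed
    show "AE z in ?L. norm (indicator (A n) z * G z) \<le> norm (G z)" for n
      by (rule AE_I2) (auto simp: indicator_def)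
  qed (use Gint in auto)
  have "2 * lam powr (p - 1) * c * (\<integral>x. \<phi> x \<partial>lebesgue) \<le> (\<integral>z. G z \<partial>?L)"
    by (rule LIMSEQ_le_const[OF lim]) (use step in auto)
  then have "(2 * lam powr (p - 1) * c - K) * (\<integral>x. \<phi> x \<partial>lebesgue) \<le> 0"
    using EK by (simp add: left_diff_distrib)
  then have "(\<integral>x. \<phi> x \<partial>lebesgue) \<le> 0"
    using lam by (simp add: mult_le_0_iff)
  moreover have "0 \<le> (\<integral>x. \<phi> x \<partial>lebesgue)" using phi0 by (intro integral_nonneg_AE) auto
  ultimately have "(\<integral>x. \<phi> x \<partial>lebesgue) = 0" by simp
  then have "AE x in lebesgue. \<phi> x = 0"
    using integral_nonneg_eq_0_iff_AE[OF phi1] phi0 by auto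
  then show ?thesis
    by eventually_elim (auto simp: \<phi>_def max_def split: if_splits)
qed

subsection \<open>Exterior paraboloids\<close>

text \<open>The component \<open>\<psi> y \<bullet> e\<close> is positive on \<open>\<Omega>\<close>
  and 0 at \<open>b\<close>; its gradient \<open>N\<close> at \<open>b\<close> is Lipschitz in
  \<open>b\<close>, so the mean value theorem gives
  \<open>0 < (y - b) \<bullet> N + C * (norm (y - b))\<^sup>2\<close>. Dividing by
  \<open>norm N\<close> needs a lower bound uniform in \<open>b\<close>, which comes from
  invertibility of the derivative at \<open>x0\<close>.\<close>

lemma C11_chart_exterior:
  fixes \<Omega> :: "'a::euclidean_space set" and \<psi> :: "'a \<Rightarrow> 'a"
  assumes r: "0 < r" and ne: "norm e = 1" and inj: "inj_on \<psi> (ball x0 r)" and im: "\<psi> ` ball x0 r = D" and D: "open D"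
    and pos: "\<psi> ` (ball x0 r \<inter> \<Omega>) \<subseteq> {z. z \<bullet> e > 0}"
    and zero: "\<psi> ` (ball x0 r \<inter> frontier \<Omega>) \<subseteq> {z. z \<bullet> e = 0}"
    and c1: "C11_on (ball x0 r) \<psi>" and c2: "C11_on D (inv_into (ball x0 r) \<psi>)"
  shows "\<exists>\<kappa>>0. \<exists>r1>0. \<forall>b\<in>frontier \<Omega> \<inter> ball x0 r1. \<exists>n. norm n = 1 \<and> (\<forall>y\<in>\<Omega>. norm (y - b) < r1 \<longrightarrow> - \<kappa> * (norm (y - b))\<^sup>2 \<le> (y - b) \<bullet> n)"
proof -
  obtain f' L where f': "\<And>x. x \<in> ball x0 r \<Longrightarrow> (\<psi> has_derivative f' x) (at x)"
    and L: "\<And>x y. x \<in> ball x0 r \<Longrightarrow> y \<in> ball x0 r \<Longrightarrow> onorm (\<lambda>v. f' x v - f' y v) \<le> L * dist x y"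
    using c1 unfolding C11_on_def by blast
  obtain g' where g': "\<And>z. z \<in> D \<Longrightarrow> (inv_into (ball x0 r) \<psi> has_derivative g' z) (at z)"
    using c2 unfolding C11_on_def by blast
  have x0: "x0 \<in> ball x0 r" using r by simp
  have lin: "bounded_linear (f' x)" if "x \<in> ball x0 r" for x using f'[OF that] by (rule has_derivative_bounded_linear)
  have Lip: "\<bar>(f' x v - f' y v) \<bullet> e\<bar> \<le> \<bar>L\<bar> * norm e * norm (x - y) * norm v"
    if "x \<in> ball x0 r" "y \<in> ball x0 r" for x y v
  proof -
    have "norm (f' x v - f' y v) \<le> onorm (\<lambda>v. f' x v - f' y v) * norm v"
      using lin that by (intro onorm bounded_linear_sub) auto
    also have "\<dots> \<le> (L * dist x y) * norm v" using L[OF that] by (intro mult_right_mono) auto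
    also have "\<dots> \<le> (\<bar>L\<bar> * norm (x - y)) * norm v" 
      by (intro mult_right_mono) (auto simp: dist_norm intro!: mult_right_mono)
    finally have "norm (f' x v - f' y v) * norm e \<le> (\<bar>L\<bar> * norm (x - y)) * norm v * norm e" by (intro mult_right_mono) auto
    then show ?thesis using Cauchy_Schwarz_ineq2[of "f' x v - f' y v" e] by (simp add: mult_ac)
  qed
  \<comment> \<open>Differentiability of the inverse chart enters only through the chain rule: a
    left inverse of the derivative exists.\<close>
  have "inj (f' x0)"
  proof -
    have "((inv_into (ball x0 r) \<psi> \<circ> \<psi>) has_derivative (g' (\<psi> x0) \<circ> f' x0)) (at x0)"
      using f'[OF x0] g'[of "\<psi> x0"] x0 im by (intro diff_chain_at) auto
    moreover have "((inv_into (ball x0 r) \<psi> \<circ> \<psi>) has_derivative id) (at x0)"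
    proof (rule has_derivative_transform_within_open)
      show "(id has_derivative id) (at x0)" by (rule has_derivative_id)
      show "\<And>x. x \<in> ball x0 r \<Longrightarrow> id x = (inv_into (ball x0 r) \<psi> \<circ> \<psi>) x"
        using inj by (simp add: inv_into_f_f)
    qed (use x0 in auto)
    ultimately have "g' (\<psi> x0) \<circ> f' x0 = id" by (rule has_derivative_unique)
    then have "g' (\<psi> x0) (f' x0 v) = v" for v by (simp add: fun_eq_iff)
    then show ?thesis by (rule inj_on_inverseI)
  qed
  then have "surj (f' x0)"
    using lin[OF x0] by (intro linear_injective_imp_surjective) (auto intro: bounded_linear.linear)
  have e0: "e \<noteq> 0" using ne by auto
  obtain w where w: "f' x0 w = e" using \<open>surj (f' x0)\<close> by (metis surjD)
  have fw: "f' x0 w \<bullet> e > 0" using w e0 by simp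
  define E where "E = e \<bullet> e"
  have E: "0 < E" using e0 by (simp add: E_def)
  define C where "C = \<bar>L\<bar> * norm e"
  have C: "0 \<le> C" by (simp add: C_def)
  \<comment> \<open>The first bound keeps \<open>y\<close> in the chart; the second keeps the
    derivative in direction \<open>w\<close>, which is \<open>E\<close> at \<open>x0\<close>, above
    \<open>E / 2\<close> at \<open>b\<close>.\<close>
  define r1 where "r1 = min (r / 2) (E / (2 * (C * norm w + 1)))"
  have r1: "0 < r1" "2 * r1 \<le> r" "r1 * (C * norm w + 1) \<le> E / 2"
  proof -
    have "0 < C * norm w + 1" using C by (simp add: add_nonneg_pos)
    then show "0 < r1" using r E by (simp add: r1_def)
    show "2 * r1 \<le> r" by (simp add: r1_def)
    have "r1 \<le> E / (2 * (C * norm w + 1))" by (simp add: r1_def)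
    then show "r1 * (C * norm w + 1) \<le> E / 2" using \<open>0 < C * norm w + 1\<close> by (simp add: field_simps)
  qed
  \<comment> \<open>From \<open>E / 2 \<le> norm w * norm N\<close> the quotient of \<open>C\<close>
    by \<open>norm N\<close> is at most \<open>2 * C * norm w / E\<close>; adding 1 makes it
    positive.\<close>
  define \<kappa> where "\<kappa> = 2 * C * norm w / E + 1"
  have kap: "0 < \<kappa>" using C E by (simp add: \<kappa>_def add_nonneg_pos)
  show ?thesis
  proof (rule exI[of _ \<kappa>], rule conjI[OF kap], rule exI[of _ r1], rule conjI[OF r1(1)], rule ballI)
    fix b assume b: "b \<in> frontier \<Omega> \<inter> ball x0 r1"
    have bb: "b \<in> ball x0 r" using b r1 by auto
    define N where "N = (\<Sum>i\<in>Basis. (f' b i \<bullet> e) *\<^sub>R i)"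
    have N: "f' b v \<bullet> e = v \<bullet> N" for v
    proof -
      interpret bounded_linear "f' b" by (rule lin[OF bb])
      have "f' b v = f' b (\<Sum>i\<in>Basis. (v \<bullet> i) *\<^sub>R i)" by (simp add: euclidean_representation)
      also have "\<dots> = (\<Sum>i\<in>Basis. (v \<bullet> i) *\<^sub>R f' b i)" by (simp add: sum scaleR)
      finally show ?thesis by (simp add: N_def inner_sum_left inner_sum_right mult.commute)
    qed
    have "\<bar>(f' b w - f' x0 w) \<bullet> e\<bar> \<le> C * norm (b - x0) * norm w" unfolding C_def by (rule Lip[OF bb x0])
    also have "\<dots> \<le> r1 * (C * norm w + 1)"
    proof -
      have "norm (b - x0) \<le> r1" using b by (simp add: dist_norm norm_minus_commute)
      then have "norm (b - x0) * (C * norm w) \<le> r1 * (C * norm w)" using C by (intro mult_right_mono) auto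
      then show ?thesis using r1 by (simp add: algebra_simps)
    qed
    also have "\<dots> \<le> E / 2" by (rule r1)
    finally have "\<bar>w \<bullet> N - E\<bar> \<le> E / 2" using w N[of w] by (simp add: inner_diff_left E_def)
    then have "E / 2 \<le> w \<bullet> N" by linarith
    then have NE: "E / 2 \<le> norm w * norm N" using norm_cauchy_schwarz[of w N] by linarith
    then have N0: "0 < norm N" using E by (cases "N = 0") auto
    have main: "- (C * (norm (y - b))\<^sup>2) \<le> (y - b) \<bullet> N" if y: "y \<in> \<Omega>" "norm (y - b) < r1" for y
    proof -
      have "dist x0 y \<le> dist x0 b + dist b y" by (rule dist_triangle)
      then have yb: "y \<in> ball x0 r" using b y r1 by (simp add: dist_norm norm_minus_commute)
      define q where "q t = \<psi> (b + t *\<^sub>R (y - b)) \<bullet> e" for t :: real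
      have seg: "b + t *\<^sub>R (y - b) \<in> ball x0 r" if "0 \<le> t" "t \<le> 1" for t
      proof -
        have "b + t *\<^sub>R (y - b) = (1 - t) *\<^sub>R b + t *\<^sub>R y" by (simp add: algebra_simps)
        then show ?thesis using convexD[OF convex_ball bb yb, of "1 - t" t] that by simp
      qed
      have dq: "(q has_derivative (\<lambda>h. f' (b + t *\<^sub>R (y - b)) (h *\<^sub>R (y - b)) \<bullet> e)) (at t)" if "0 \<le> t" "t \<le> 1" for t
        unfolding q_def[abs_def]
      proof (rule has_derivative_inner_left)
        have "((\<lambda>t. b + t *\<^sub>R (y - b)) has_derivative (\<lambda>h. h *\<^sub>R (y - b))) (at t)"
          by (auto intro!: derivative_eq_intros)
        from diff_chain_at[OF this f'[OF seg[OF that]]]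
        show "((\<lambda>t. \<psi> (b + t *\<^sub>R (y - b))) has_derivative (\<lambda>h. f' (b + t *\<^sub>R (y - b)) (h *\<^sub>R (y - b)))) (at t)"
          by (simp add: o_def)
      qed
      have "\<exists>t\<in>{0<..<1}. q 1 - q 0 = (\<lambda>h. f' (b + t *\<^sub>R (y - b)) (h *\<^sub>R (y - b)) \<bullet> e) (1 - 0)"
        using dq by (intro mvt_simple[of 0 1 q "\<lambda>t h. f' (b + t *\<^sub>R (y - b)) (h *\<^sub>R (y - b)) \<bullet> e"])
          (auto intro: has_derivative_at_withinI)
      then obtain t where t: "0 < t" "t < 1" "q 1 - q 0 = f' (b + t *\<^sub>R (y - b)) (y - b) \<bullet> e" by auto
      have "\<psi> y \<in> {z. z \<bullet> e > 0}" using pos y yb by blast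
      then have q1: "0 < q 1" by (simp add: q_def)
      have "\<psi> b \<in> {z. z \<bullet> e = 0}" using zero b bb by blast
      then have q0: "q 0 = 0" by (simp add: q_def)
      have "\<bar>(f' (b + t *\<^sub>R (y - b)) (y - b) - f' b (y - b)) \<bullet> e\<bar> \<le> C * norm ((b + t *\<^sub>R (y - b)) - b) * norm (y - b)"
        unfolding C_def using t seg bb by (intro Lip) auto
      also have "\<dots> = (C * norm (y - b) * norm (y - b)) * t" using t by simp
      also have "\<dots> \<le> (C * norm (y - b) * norm (y - b)) * 1" using t C by (intro mult_left_mono) auto
      finally have "f' (b + t *\<^sub>R (y - b)) (y - b) \<bullet> e - f' b (y - b) \<bullet> e \<le> C * (norm (y - b))\<^sup>2"
        by (simp add: inner_diff_left abs_le_iff power2_eq_square)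
      then show ?thesis using t(3) q1 q0 N[of "y - b"] by linarith
    qed
    show "\<exists>n. norm n = 1 \<and> (\<forall>y\<in>\<Omega>. norm (y - b) < r1 \<longrightarrow> - \<kappa> * (norm (y - b))\<^sup>2 \<le> (y - b) \<bullet> n)"
    proof (intro exI[of _ "(1 / norm N) *\<^sub>R N"] conjI ballI impI)
      show "norm ((1 / norm N) *\<^sub>R N) = 1" using N0 by simp
      fix y assume y: "y \<in> \<Omega>" "norm (y - b) < r1"
      have ck: "C \<le> \<kappa> * norm N"
      proof -
        have "C = (2 * C / E) * (E / 2)" using E by simp
        also have "\<dots> \<le> (2 * C / E) * (norm w * norm N)" using NE C E by (intro mult_left_mono) auto
        also have "\<dots> \<le> \<kappa> * norm N" using N0 by (simp add: \<kappa>_def distrib_right mult.assoc)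
        finally show ?thesis .
      qed
      have "- \<kappa> * (norm (y - b))\<^sup>2 * norm N \<le> - (C * (norm (y - b))\<^sup>2)"
        using mult_right_mono[OF ck, of "(norm (y - b))\<^sup>2"] by (simp add: mult_ac)
      also have "\<dots> \<le> (y - b) \<bullet> N" by (rule main[OF y])
      finally have "- \<kappa> * (norm (y - b))\<^sup>2 \<le> (y - b) \<bullet> N / norm N" using N0 by (simp add: le_divide_eq)
      then show "- \<kappa> * (norm (y - b))\<^sup>2 \<le> (y - b) \<bullet> ((1 / norm N) *\<^sub>R N)" by simp
    qed
  qed
qed

text \<open>The frontier is compact, so finitely many charts cover it, and the largest opening and
  the smallest radius serve all of them.\<close>

lemma C11_boundary_exterior_paraboloid:
  fixes \<Omega> :: "'a::euclidean_space set"
  assumes bd: "bounded \<Omega>" and C11: "C11_boundary \<Omega>"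
  shows "\<exists>\<kappa>>0. \<exists>r>0. \<forall>b\<in>frontier \<Omega>. \<exists>n. norm n = 1 \<and> (\<forall>y\<in>\<Omega>. norm (y - b) < r \<longrightarrow> - \<kappa> * (norm (y - b))\<^sup>2 \<le> (y - b) \<bullet> n)"
proof -
  define P where "P x0 k r1 \<longleftrightarrow> 0 < k \<and> 0 < r1 \<and> (\<forall>b\<in>frontier \<Omega> \<inter> ball x0 r1. \<exists>n. norm n = 1 \<and>
      (\<forall>y\<in>\<Omega>. norm (y - b) < r1 \<longrightarrow> - k * (norm (y - b))\<^sup>2 \<le> (y - b) \<bullet> n))" for x0 k r1
  have ex: "\<exists>k r1. P x0 k r1" if "x0 \<in> frontier \<Omega>" for x0
    using bspec[OF C11[unfolded C11_boundary_def] that]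
  proof (elim exE conjE)
    fix r :: real and \<psi> :: "'a \<Rightarrow> 'a" and D e
    assume "r > 0" "norm e = 1" "open D" "inj_on \<psi> (ball x0 r)" "\<psi> ` ball x0 r = D"
      "\<psi> ` (ball x0 r \<inter> \<Omega>) \<subseteq> {z. z \<bullet> e > 0}" "\<psi> ` (ball x0 r \<inter> frontier \<Omega>) \<subseteq> {z. z \<bullet> e = 0}"
      "C11_on (ball x0 r) \<psi>" "C11_on D (inv_into (ball x0 r) \<psi>)"
    from C11_chart_exterior[OF this(1,2,4,5,3,6-9)] show ?thesis
      unfolding P_def by (elim exE conjE) (intro exI conjI)
  qed
  have "\<forall>x0\<in>frontier \<Omega>. \<exists>kr. P x0 (fst kr) (snd kr)"
  proof
    fix x0 assume "x0 \<in> frontier \<Omega>"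
    from ex[OF this] obtain k r1 where "P x0 k r1" by (elim exE)
    then show "\<exists>kr. P x0 (fst kr) (snd kr)" by (intro exI[of _ "(k, r1)"]) simp
  qed
  from bchoice[OF this] obtain F where F: "\<forall>x0\<in>frontier \<Omega>. P x0 (fst (F x0)) (snd (F x0))" ..
  define k where "k x = fst (F x)" for x
  define r where "r x = snd (F x)" for x
  have kr: "P x0 (k x0) (r x0)" if "x0 \<in> frontier \<Omega>" for x0
    using F that by (simp add: k_def r_def)
  have rpos: "0 < r x0" if "x0 \<in> frontier \<Omega>" for x0 using kr[OF that] by (simp add: P_def)
  have "compact (frontier \<Omega>)" using bd by (rule compact_frontier_bounded)
  moreover have "frontier \<Omega> \<subseteq> (\<Union>x\<in>frontier \<Omega>. ball x (r x))"
    using rpos by (intro subsetI UN_I) auto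
  ultimately obtain T where T: "T \<subseteq> frontier \<Omega>" "finite T" "frontier \<Omega> \<subseteq> (\<Union>x\<in>T. ball x (r x))"
    by (rule compactE_image[OF _ open_ball])
  \<comment> \<open>Inserting 1 here and in \<open>R\<close> keeps the sets nonempty and the maximum
    positive.\<close>
  define K where "K = Max (insert 1 (k ` T))"
  define R where "R = Min (insert 1 (r ` T))"
  have K: "0 < K" "\<And>x. x \<in> T \<Longrightarrow> k x \<le> K"
  proof -
    have "1 \<le> K" unfolding K_def using T by (intro Max_ge) auto
    then show "0 < K" by simp
    show "\<And>x. x \<in> T \<Longrightarrow> k x \<le> K" unfolding K_def using T by (intro Max_ge) auto
  qed
  have R: "0 < R" "\<And>x. x \<in> T \<Longrightarrow> R \<le> r x"
  proof -
    show "0 < R" unfolding R_def using T rpos by (subst Min_gr_iff) auto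
    show "\<And>x. x \<in> T \<Longrightarrow> R \<le> r x" unfolding R_def using T by (intro Min_le) auto
  qed
  show ?thesis
  proof (rule exI[of _ K], rule conjI[OF K(1)], rule exI[of _ R], rule conjI[OF R(1)], rule ballI)
    fix b assume b: "b \<in> frontier \<Omega>"
    then obtain x0 where x0: "x0 \<in> T" "b \<in> ball x0 (r x0)" using T by auto
    have "x0 \<in> frontier \<Omega>" using x0 T by auto
    from kr[OF this] have "\<forall>b\<in>frontier \<Omega> \<inter> ball x0 (r x0). \<exists>n. norm n = 1 \<and>
        (\<forall>y\<in>\<Omega>. norm (y - b) < r x0 \<longrightarrow> - k x0 * (norm (y - b))\<^sup>2 \<le> (y - b) \<bullet> n)"
      unfolding P_def by (elim conjE)
    from bspec[OF this IntI[OF b x0(2)]] obtain n where n': "norm n = 1 \<and>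
        (\<forall>y\<in>\<Omega>. norm (y - b) < r x0 \<longrightarrow> - k x0 * (norm (y - b))\<^sup>2 \<le> (y - b) \<bullet> n)" ..
    have n: "norm n = 1" "\<And>y. y \<in> \<Omega> \<Longrightarrow> norm (y - b) < r x0 \<Longrightarrow> - k x0 * (norm (y - b))\<^sup>2 \<le> (y - b) \<bullet> n"
      using n' by auto
    have "- K * (norm (y - b))\<^sup>2 \<le> (y - b) \<bullet> n" if y: "y \<in> \<Omega>" "norm (y - b) < R" for y
    proof -
      have "- K * (norm (y - b))\<^sup>2 \<le> - k x0 * (norm (y - b))\<^sup>2"
        using K(2)[OF x0(1)] by (intro mult_right_mono) auto
      also have "\<dots> \<le> (y - b) \<bullet> n" using n(2)[OF y(1)] y(2) R(2)[OF x0(1)] by simp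
      finally show ?thesis .
    qed
    then show "\<exists>n. norm n = 1 \<and> (\<forall>y\<in>\<Omega>. norm (y - b) < R \<longrightarrow> - K * (norm (y - b))\<^sup>2 \<le> (y - b) \<bullet> n)"
      using n(1) by blast
  qed
qed

text \<open>Doubling the opening leaves a quadratic margin. For \<open>t \<ge> 0\<close> the loss
  \<open>2 * k * t\<^sup>2\<close> is at most \<open>t\<close>. For \<open>t < 0\<close> the
  exterior condition gives \<open>\<bar>t\<bar> \<le> m / 8\<close>, so the point is almost
  tangential and \<open>2 * k * (m\<^sup>2 - t\<^sup>2)\<close> is at least
  \<open>3/2 * k * m\<^sup>2\<close>, of which \<open>t\<close> uses up at most
  \<open>k * m\<^sup>2\<close>.\<close>

lemma para_height_lower:
  fixes e b y :: "'a::euclidean_space"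
  assumes e: "norm e = 1" and k: "0 < k" and M: "8 * k * M \<le> 1" and y: "norm (y - b) < M"
    and ext: "- k * (norm (y - b))\<^sup>2 \<le> (y - b) \<bullet> e"
  shows "k / 2 * (norm (y - b))\<^sup>2 + \<tau> \<le> para_height (2 * k) e b \<tau> y"
proof -
  define z where "z = y - b"
  define t where "t = z \<bullet> e"
  define m where "m = norm z"
  have tm: "\<bar>t\<bar> \<le> m" using Cauchy_Schwarz_ineq2[of z e] e by (simp add: t_def m_def)
  have m0: "0 \<le> m" by (simp add: m_def)
  have km: "8 * k * m \<le> 1"
  proof -
    have "8 * k * m \<le> 8 * k * M" using y k by (intro mult_left_mono) (auto simp: m_def z_def)
    then show ?thesis using M by linarith
  qed
  have ext': "- (k * m\<^sup>2) \<le> t" using ext by (simp add: z_def t_def m_def)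
  have goal: "k / 2 * m\<^sup>2 \<le> t + 2 * k * (m\<^sup>2 - t\<^sup>2)"
  proof (cases "0 \<le> t")
    case True
    have "2 * k * t \<le> 2 * k * m" using tm k True by (intro mult_left_mono) auto
    also have "\<dots> \<le> 8 * k * m" using k m0 by (intro mult_right_mono) auto
    finally have "2 * k * t \<le> 1" using km by linarith
    then have "2 * k * t * t \<le> 1 * t" using True by (intro mult_right_mono) auto
    then have "2 * k * t\<^sup>2 \<le> t" by (simp add: power2_eq_square)
    moreover have "k / 2 * m\<^sup>2 \<le> 2 * k * m\<^sup>2" using k by (intro mult_right_mono) auto
    ultimately show ?thesis by (simp add: algebra_simps)
  next
    case False
    have "\<bar>t\<bar> \<le> k * m\<^sup>2" using False ext' by linarith
    also have "\<dots> = (8 * k * m) * (m / 8)" by (simp add: power2_eq_square)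
    also have "\<dots> \<le> 1 * (m / 8)" using km m0 by (intro mult_right_mono) auto
    finally have "\<bar>t\<bar> \<le> m / 8" by simp
    then have "\<bar>t\<bar>\<^sup>2 \<le> (m / 8)\<^sup>2" by (intro power_mono) auto
    then have t2: "t\<^sup>2 \<le> m\<^sup>2 / 64" by (simp add: power_divide)
    have "2 * k * (m\<^sup>2 * 3 / 4) \<le> 2 * k * (m\<^sup>2 - t\<^sup>2)"
      using t2 k zero_le_power2[of m] by (intro mult_left_mono) linarith+
    then show ?thesis using ext' by (simp add: algebra_simps)
  qed
  have "para_height (2 * k) e b \<tau> y = t + 2 * k * (m\<^sup>2 - t\<^sup>2) + \<tau>"
    unfolding para_height_def tang_sq_def z_def[symmetric] t_def m_def power2_norm_eq_inner ..
  then show ?thesis using goal unfolding m_def z_def by linarith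
qed

subsection \<open>The boundary estimate\<close>

text \<open>Near \<open>b\<close> the slope of the height is at most 2; outside the ball of radius
  \<open>M\<close> the constant \<open>\<rho>\<close> is at most
  \<open>\<rho> / M * norm (x - b)\<close>. The coefficient adds the two.\<close>

lemma barrier_le:
  fixes e b x :: "'a::euclidean_space"
  assumes e: "norm e = 1" and k: "0 < \<kappa>" "4 * \<kappa> * M \<le> 1" and M: "0 < M" and rho: "0 < \<rho>" and tau: "0 < \<tau>" and s: "0 < s"
  shows "barrier \<kappa> M \<rho> s e b \<tau> x \<le> ((2 + \<rho> / M) * norm (x - b) + \<tau>) powr s"
proof -
  define z where "z = x - b"
  have r: "0 \<le> \<rho> / M * norm z" using rho M by simp
  show ?thesis
  proof (cases "norm z < M")
    case True
    have "\<kappa> * tang_sq e z \<le> \<kappa> * (norm z)\<^sup>2" using tang_sq_bounds[OF e, of z] k by (intro mult_left_mono) auto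
    also have "\<dots> = (\<kappa> * norm z) * norm z" by (simp add: power2_eq_square)
    also have "\<dots> \<le> 1 * norm z"
    proof (intro mult_right_mono)
      have "\<kappa> * norm z \<le> \<kappa> * M" using True k by (intro mult_left_mono) auto
      moreover have "0 < \<kappa> * M" using k M by simp
      ultimately show "\<kappa> * norm z \<le> 1" using k by linarith
    qed auto
    finally have "\<kappa> * tang_sq e z \<le> norm z" by simp
    moreover have "z \<bullet> e \<le> norm z" using norm_cauchy_schwarz[of z e] e by simp
    ultimately have h: "para_height \<kappa> e b \<tau> x \<le> 2 * norm z + \<tau>" by (simp add: para_height_def z_def)
    have "min (max (para_height \<kappa> e b \<tau> x) 0) \<rho> \<le> max (para_height \<kappa> e b \<tau> x) 0" by simp
    also have "\<dots> \<le> 2 * norm z + \<tau>" using h tau by simp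
    also have "\<dots> \<le> (2 + \<rho> / M) * norm z + \<tau>" using r by (simp add: distrib_right)
    finally have "min (max (para_height \<kappa> e b \<tau> x) 0) \<rho> powr s \<le> ((2 + \<rho> / M) * norm z + \<tau>) powr s"
      using rho s by (intro powr_mono2) auto
    then show ?thesis using True by (simp add: barrier_def trunc_powr_def z_def)
  next
    case False
    have "\<rho> = \<rho> / M * M" using M by simp
    also have "\<dots> \<le> \<rho> / M * norm z" using False rho M by (intro mult_left_mono) auto
    also have "\<dots> \<le> (2 + \<rho> / M) * norm z + \<tau>" using tau by (simp add: distrib_right)
    finally have "\<rho> powr s \<le> ((2 + \<rho> / M) * norm z + \<tau>) powr s" using rho s by (intro powr_mono2) auto
    then show ?thesis using False by (simp add: barrier_def z_def)
  qed
qed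

lemma powr_lipschitz_above:
  fixes a x y s :: real
  assumes "0 < a" "a \<le> x" "a \<le> y" "0 < s" "s < 1"
  shows "\<bar>x powr s - y powr s\<bar> \<le> s * a powr (s - 1) * \<bar>x - y\<bar>"
proof -
  have main: "w powr s - v powr s \<le> s * a powr (s - 1) * (w - v)" if vw: "a \<le> v" "v < w" for v w
  proof -
    have "((\<lambda>x. x powr s) has_real_derivative s * x powr (s - 1)) (at x)" if "v \<le> x" for x
      using that vw assms by (auto intro!: derivative_eq_intros)
    then obtain z where z: "v < z" "z < w" "w powr s - v powr s = (w - v) * (s * z powr (s - 1))"
      using MVT2[of v w "\<lambda>x. x powr s" "\<lambda>x. s * x powr (s - 1)"] vw by blast
    have "z powr (s - 1) \<le> a powr (s - 1)" using z vw assms by (intro powr_mono2') auto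
    then have "(w - v) * (s * z powr (s - 1)) \<le> (w - v) * (s * a powr (s - 1))"
      using vw assms by (intro mult_left_mono) auto
    then show ?thesis using z by (simp add: mult_ac)
  qed
  have mono: "v powr s \<le> w powr s" if "a \<le> v" "v \<le> w" for v w using that assms by (intro powr_mono2) auto
  consider "x < y" | "x = y" | "y < x" by linarith
  then show ?thesis
  proof cases
    case 1 then show ?thesis using main[of x y] mono[of x y] assms by simp
  next
    case 3 then show ?thesis using main[of y x] mono[of y x] assms by simp
  qed simp
qed

text \<open>Cut-off heights over \<open>\<Omega>\<close> are at least
  \<open>min \<tau> \<rho>\<close>, where the power is Lipschitz. The constant degenerates as
  \<open>\<tau>\<close> tends to 0, which does no harm: it serves only to make the seminorm
  finite.\<close>

lemma barrier_lipschitz: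
  fixes \<Omega> :: "'a::euclidean_space set"
  assumes s: "0 < s" "s < 1" and k: "0 < \<kappa>" "4 * \<kappa> * M \<le> 1" and M: "0 < M" and rho: "0 < \<rho>" "\<rho> \<le> c1 * M\<^sup>2 / 4"
    and c1: "0 < c1" and e: "norm e = 1" and tau: "0 < \<tau>"
    and geo: "\<And>x. x \<in> \<Omega> \<Longrightarrow> norm (x - b) < M \<Longrightarrow> c1 * (norm (x - b))\<^sup>2 + \<tau> \<le> para_height \<kappa> e b \<tau> x"
  shows "\<exists>C\<ge>0. \<forall>x\<in>\<Omega>. \<forall>y\<in>\<Omega>. \<bar>barrier \<kappa> M \<rho> s e b \<tau> x - barrier \<kappa> M \<rho> s e b \<tau> y\<bar> \<le> C * norm (x - y)"
proof -
  let ?W = "barrier \<kappa> M \<rho> s e b \<tau>"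
  let ?h = "para_height \<kappa> e b \<tau>"
  define \<mu> where "\<mu> = min \<tau> \<rho>"
  have mu: "0 < \<mu>" using tau rho by (simp add: \<mu>_def)
  define C1 where "C1 = s * \<mu> powr (s - 1) * 3"
  define C2 where "C2 = \<rho> powr s * 2 / M"
  have C: "0 \<le> C1" "0 \<le> C2" using s M by (auto simp: C1_def C2_def)
  have hge: "\<tau> \<le> ?h x" if "x \<in> \<Omega>" "norm (x - b) < M" for x
  proof -
    have "0 \<le> c1 * (norm (x - b))\<^sup>2" using c1 by simp
    then show ?thesis using geo[OF that] by linarith
  qed
  have inner: "\<bar>?W x - ?W y\<bar> \<le> C1 * norm (x - y)"
    if x: "x \<in> \<Omega>" "norm (x - b) < M" and y: "y \<in> \<Omega>" "norm (y - b) < M" for x y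
  proof -
    define hx where "hx = min (?h x) \<rho>"
    define hy where "hy = min (?h y) \<rho>"
    have W: "?W x = hx powr s" "?W y = hy powr s"
      using x y hge[OF x] hge[OF y] tau by (auto simp: barrier_def trunc_powr_def hx_def hy_def)
    have "\<bar>hx powr s - hy powr s\<bar> \<le> s * \<mu> powr (s - 1) * \<bar>hx - hy\<bar>"
      using mu s hge[OF x] hge[OF y] by (intro powr_lipschitz_above) (auto simp: hx_def hy_def \<mu>_def)
    moreover have "\<bar>hx - hy\<bar> \<le> \<bar>?h x - ?h y\<bar>" unfolding hx_def hy_def by linarith
    moreover have "\<bar>?h x - ?h y\<bar> \<le> 3 * norm (x - y)"
    proof (rule para_height_diff_le[OF e])
      have "norm (x - y) \<le> norm (x - b) + norm (y - b)" using norm_triangle_ineq4[of "x - b" "y - b"] by simp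
      then show "norm (x - y) \<le> 2 * M" using x y by linarith
    qed (use k y in auto)
    ultimately have h3: "\<bar>hx - hy\<bar> \<le> 3 * norm (x - y)"
      and hs: "\<bar>hx powr s - hy powr s\<bar> \<le> s * \<mu> powr (s - 1) * \<bar>hx - hy\<bar>" by linarith+
    have "s * \<mu> powr (s - 1) * \<bar>hx - hy\<bar> \<le> s * \<mu> powr (s - 1) * (3 * norm (x - y))"
      using h3 s by (intro mult_left_mono) auto
    with hs have "\<bar>hx powr s - hy powr s\<bar> \<le> s * \<mu> powr (s - 1) * (3 * norm (x - y))" by linarith
    then show ?thesis using W by (simp add: C1_def mult.assoc)
  qed
  \<comment> \<open>A nonzero difference forces height below \<open>\<rho>\<close> at
    \<open>x\<close>, hence \<open>norm (x - b) \<le> M / 2\<close>, and the points are at least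
    \<open>M / 2\<close> apart.\<close>
  have mixed: "\<bar>?W x - ?W y\<bar> \<le> C2 * norm (x - y)"
    if x: "x \<in> \<Omega>" "norm (x - b) < M" and y: "\<not> norm (y - b) < M" for x y
  proof (cases "?W x = \<rho> powr s")
    case True
    then show ?thesis using y C by (simp add: barrier_def)
  next
    case False
    have "?h x < \<rho>"
    proof (rule ccontr)
      assume "\<not> ?h x < \<rho>"
      then show False using False x rho by (simp add: barrier_def trunc_powr_def)
    qed
    then have "c1 * (norm (x - b))\<^sup>2 \<le> c1 * (M / 2)\<^sup>2" using geo[OF x] tau rho by (simp add: power2_eq_square)
    then have "(norm (x - b))\<^sup>2 \<le> (M / 2)\<^sup>2" using c1 by simp
    then have "norm (x - b) \<le> M / 2" using M by (simp add: power2_le_iff_abs_le)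
    moreover have "norm (y - b) \<le> norm (x - y) + norm (x - b)"
      using norm_triangle_ineq[of "y - x" "x - b"] by (simp add: norm_minus_commute)
    ultimately have far: "M / 2 \<le> norm (x - y)" using y by linarith
    have "\<bar>?W x - ?W y\<bar> \<le> \<rho> powr s"
      using barrier_bounds[OF rho(1) s(1), of \<kappa> M e b \<tau> x] barrier_bounds[OF rho(1) s(1), of \<kappa> M e b \<tau> y] by linarith
    also have "\<dots> = C2 * (M / 2)" using M by (simp add: C2_def)
    also have "\<dots> \<le> C2 * norm (x - y)" using far C by (intro mult_left_mono) auto
    finally show ?thesis .
  qed
  show ?thesis
  proof (intro exI[of _ "C1 + C2"] conjI ballI)
    show "0 \<le> C1 + C2" using C by simp
    fix x y assume x: "x \<in> \<Omega>" and y: "y \<in> \<Omega>"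
    have nn: "0 \<le> C1 * norm (x - y)" "0 \<le> C2 * norm (x - y)" using C by auto
    consider "norm (x - b) < M" "norm (y - b) < M" | "norm (x - b) < M" "\<not> norm (y - b) < M"
      | "\<not> norm (x - b) < M" "norm (y - b) < M" | "\<not> norm (x - b) < M" "\<not> norm (y - b) < M" by blast
    then show "\<bar>?W x - ?W y\<bar> \<le> (C1 + C2) * norm (x - y)"
    proof cases
      case 1
      from inner[OF x this(1) y this(2)] show ?thesis using nn unfolding distrib_right by linarith
    next
      case 2
      from mixed[OF x this] show ?thesis using nn unfolding distrib_right by linarith
    next
      case 3
      from mixed[OF y this(2,1)] show ?thesis
        using nn unfolding distrib_right norm_minus_commute[of y x] by linarith
    next
      case 4 then show ?thesis using nn by (simp add: barrier_def distrib_right)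
    qed
  qed
qed

text \<open>The integrand is at most a constant times \<open>norm (x - y)\<close> to the power
  \<open>p * (1 - s) - N\<close>, N the dimension, which is integrable on bounded sets since
  \<open>s < 1\<close>.\<close>

lemma lipschitz_seminorm_finite:
  fixes \<Omega> :: "'a::euclidean_space set" and W :: "'a \<Rightarrow> real"
  assumes s: "0 < s" "s < 1" and p: "1 < p" and Om: "open \<Omega>" "bounded \<Omega>" and W: "W \<in> borel_measurable borel"
    and C: "0 \<le> C" and Lip: "\<And>x y. x \<in> \<Omega> \<Longrightarrow> y \<in> \<Omega> \<Longrightarrow> \<bar>W x - W y\<bar> \<le> C * norm (x - y)"
  shows "(\<integral>\<^sup>+ z. ennreal (indicator (\<Omega> \<times> \<Omega>) z * \<bar>W (fst z) - W (snd z)\<bar> powr p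
              / norm (fst z - snd z) powr (real DIM('a) + p * s)) \<partial>(lebesgue \<Otimes>\<^sub>M lebesgue)) < \<infinity>"
proof -
  obtain D where D: "0 < D" "\<And>x. x \<in> \<Omega> \<Longrightarrow> norm x \<le> D" using Om(2) unfolding bounded_pos by blast
  define a where "a = p - (real DIM('a) + p * s)"
  have a: "a = p * (1 - s) - real DIM('a)" by (simp add: a_def right_diff_distrib)
  have ps: "0 < p * (1 - s)" using p s by simp
  define I where "I = (\<integral>\<^sup>+(z::'a). ennreal (norm z powr a) * indicator {z. norm z \<le> 2 * D} z \<partial>lborel)"
  have I: "I < \<infinity>" unfolding I_def a using D ps by (intro nn_integral_norm_powr_inside_ball) auto
  have [measurable]: "\<Omega> \<in> sets lebesgue" using Om by auto
  have [measurable]: "W \<in> borel_measurable lebesgue" using W by (rule borel_lebesgue_measurable)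
  have [measurable]: "(\<lambda>z::'a \<times> 'a. norm (fst z - snd z) powr (real DIM('a) + p * s)) \<in> borel_measurable (lebesgue \<Otimes>\<^sub>M lebesgue)"
    by (rule borel_pair_lebesgue_measurable) measurable
  define f where "f z = ennreal (indicator (\<Omega> \<times> \<Omega>) z * \<bar>W (fst z) - W (snd z)\<bar> powr p
              / norm (fst z - snd z) powr (real DIM('a) + p * s))" for z
  have [measurable]: "f \<in> borel_measurable (lebesgue \<Otimes>\<^sub>M lebesgue)" unfolding f_def[abs_def] by measurable
  have "(\<integral>\<^sup>+ z. f z \<partial>(lebesgue \<Otimes>\<^sub>M lebesgue)) = (\<integral>\<^sup>+x. (\<integral>\<^sup>+y. f (x, y) \<partial>lebesgue) \<partial>lebesgue)"
    by (rule sigma_finite_measure.nn_integral_fst[OF sigma_finite_lebesgue, symmetric]) measurable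
  also have "\<dots> = (\<integral>\<^sup>+x. (\<integral>\<^sup>+y. ennreal (indicator (\<Omega> \<times> \<Omega>) (x, y) * \<bar>W x - W y\<bar> powr p
              / norm (x - y) powr (real DIM('a) + p * s)) \<partial>lebesgue) \<partial>lebesgue)"
    by (simp only: f_def fst_conv snd_conv)
  also have "\<dots> \<le> (\<integral>\<^sup>+x. ennreal (C powr p) * I * indicator \<Omega> x \<partial>lebesgue)"
  proof (rule nn_integral_mono)
    fix x :: 'a
    show "(\<integral>\<^sup>+y. ennreal (indicator (\<Omega> \<times> \<Omega>) (x, y) * \<bar>W x - W y\<bar> powr p
              / norm (x - y) powr (real DIM('a) + p * s)) \<partial>lebesgue) \<le> ennreal (C powr p) * I * indicator \<Omega> x"
    proof (cases "x \<in> \<Omega>")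
      case False
      then show ?thesis by simp
    next
      case x: True
      have "(\<integral>\<^sup>+y. ennreal (indicator (\<Omega> \<times> \<Omega>) (x, y) * \<bar>W x - W y\<bar> powr p
              / norm (x - y) powr (real DIM('a) + p * s)) \<partial>lebesgue)
        = (\<integral>\<^sup>+y. ennreal (indicator (\<Omega> \<times> \<Omega>) (x, y) * \<bar>W x - W y\<bar> powr p
              / norm (x - y) powr (real DIM('a) + p * s)) \<partial>lborel)"
        by (rule nn_integral_completion)
      also have "\<dots> \<le> (\<integral>\<^sup>+y. ennreal (C powr p) * (ennreal (norm (x - y) powr a) * indicator {z. norm z \<le> 2 * D} (x - y)) \<partial>lborel)"
      proof (rule nn_integral_mono)
        fix y :: 'a
        show "ennreal (indicator (\<Omega> \<times> \<Omega>) (x, y) * \<bar>W x - W y\<bar> powr p / norm (x - y) powr (real DIM('a) + p * s))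
          \<le> ennreal (C powr p) * (ennreal (norm (x - y) powr a) * indicator {z. norm z \<le> 2 * D} (x - y))"
        proof (cases "y \<in> \<Omega>")
          case False then show ?thesis by simp
        next
          case y: True
          have n: "norm (x - y) \<le> 2 * D" using D(2)[OF x] D(2)[OF y] norm_triangle_ineq4[of x y] by linarith
          have "\<bar>W x - W y\<bar> powr p \<le> (C * norm (x - y)) powr p" using Lip[OF x y] p by (intro powr_mono2) auto
          also have "\<dots> = C powr p * norm (x - y) powr p" by (rule powr_mult)
          finally have "\<bar>W x - W y\<bar> powr p / norm (x - y) powr (real DIM('a) + p * s)
             \<le> C powr p * norm (x - y) powr p / norm (x - y) powr (real DIM('a) + p * s)"
            by (intro divide_right_mono) auto
          also have "\<dots> = C powr p * norm (x - y) powr a"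
            by (simp only: a_def powr_diff times_divide_eq_right)
          finally have "ennreal (\<bar>W x - W y\<bar> powr p / norm (x - y) powr (real DIM('a) + p * s)) \<le> ennreal (C powr p * norm (x - y) powr a)"
            by (rule ennreal_leI)
          then show ?thesis using x y n by (simp add: ennreal_mult')
        qed
      qed
      also have "\<dots> = ennreal (C powr p) * (\<integral>\<^sup>+y. ennreal (norm (x - y) powr a) * indicator {z. norm z \<le> 2 * D} (x - y) \<partial>lborel)"
        by (rule nn_integral_cmult) measurable
      also have "(\<integral>\<^sup>+y. ennreal (norm (x - y) powr a) * indicator {z. norm z \<le> 2 * D} (x - y) \<partial>lborel)
        = (\<integral>\<^sup>+y. ennreal (norm (x - (x + y)) powr a) * indicator {z. norm z \<le> 2 * D} (x - (x + y)) \<partial>lborel)"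
        by (rule nn_integral_lborel_translate[symmetric]) measurable
      also have "\<dots> = I" unfolding I_def by (intro nn_integral_cong) (auto simp: indicator_def)
      finally show ?thesis using x by simp
    qed
  qed
  also have "\<dots> = ennreal (C powr p) * I * emeasure lebesgue \<Omega>"
    by (rule nn_integral_cmult_indicator) simp
  also have "\<dots> < \<infinity>"
    using I emeasure_bounded_finite[OF Om(2)] Om(1) by (simp add: ennreal_mult_less_top)
  finally show ?thesis unfolding f_def .
qed

text \<open>The measure preserving shear maps the level set, after translation, onto a
  hyperplane.\<close>

lemma para_height_level_null:
  fixes e b :: "'a::euclidean_space"
  assumes e: "norm e = 1"
  shows "AE y in lebesgue. para_height \<kappa> e b \<tau> y \<noteq> c"
proof -
  have "(\<integral>\<^sup>+y. indicator {y. para_height \<kappa> e b \<tau> y = c} y \<partial>lborel)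
    = (\<integral>\<^sup>+z. indicator {y. para_height \<kappa> e b \<tau> y = c} (b + z) \<partial>lborel)"
    by (rule nn_integral_lborel_translate[symmetric]) measurable
  also have "\<dots> = (\<integral>\<^sup>+z. indicator {w. e \<bullet> w = c - \<tau>} (z + (\<kappa> * tang_sq e z) *\<^sub>R e) \<partial>lborel)"
  proof (intro nn_integral_cong)
    fix z :: 'a
    have "e \<bullet> (z + (\<kappa> * tang_sq e z) *\<^sub>R e) = z \<bullet> e + \<kappa> * tang_sq e z"
      using e by (simp add: inner_add_right inner_commute norm_eq_1)
    then show "indicator {y. para_height \<kappa> e b \<tau> y = c} (b + z) = (indicator {w. e \<bullet> w = c - \<tau>} (z + (\<kappa> * tang_sq e z) *\<^sub>R e) :: ennreal)"
      by (auto simp: indicator_def para_height_def)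
  qed
  also have "\<dots> = (\<integral>\<^sup>+w. indicator {w. e \<bullet> w = c - \<tau>} w \<partial>lborel)"
    using e by (intro nn_integral_lborel_shear) (auto simp: tang_sq_shift)
  also have "\<dots> = 0"
  proof -
    have "e \<noteq> 0" using e by auto
    then have "negligible {w. e \<bullet> w = c - \<tau>}" by (intro negligible_hyperplane) auto
    then have "emeasure lebesgue {w. e \<bullet> w = c - \<tau>} = 0"
      by (simp add: negligible_iff_null_sets null_sets_def)
    moreover have "{w. e \<bullet> w = c - \<tau>} \<in> sets borel" by measurable
    ultimately show ?thesis by simp
  qed
  finally have "AE y in lborel. para_height \<kappa> e b \<tau> y \<noteq> c"
    by (subst (asm) nn_integral_0_iff_AE) (auto simp: indicator_def)
  then show ?thesis by (rule AE_completion)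
qed

text \<open>By Fubini the pairs of equal height form a null set. At unequal heights one of the two
  ratio conditions eventually fails, whatever the signs, and \<open>\<eta>\<close> drops below the
  distance.\<close>

lemma AE_eventually_sep_pairs:
  fixes e b :: "'a::euclidean_space"
  assumes e: "norm e = 1" and eps: "\<epsilon> \<longlonglongrightarrow> 0" and eta: "\<eta> \<longlonglongrightarrow> 0"
  shows "AE z in lebesgue \<Otimes>\<^sub>M lebesgue. eventually (\<lambda>n. z \<in> sep_pairs \<kappa> e b \<tau> (\<epsilon> n) (\<eta> n)) sequentially"
proof -
  interpret pair_sigma_finite "lebesgue :: 'a measure" "lebesgue :: 'a measure" by (rule pair_sigma_finite_lebesgue)
  let ?h = "para_height \<kappa> e b \<tau>"
  have [measurable]: "?h \<in> borel_measurable lebesgue" by (rule borel_lebesgue_measurable) measurable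
  have "AE z in lebesgue \<Otimes>\<^sub>M lebesgue. ?h (snd z) \<noteq> ?h (fst z)"
  proof (rule AE_pair_measure)
    show "{z \<in> space (lebesgue \<Otimes>\<^sub>M lebesgue). ?h (snd z) \<noteq> ?h (fst z)} \<in> sets (lebesgue \<Otimes>\<^sub>M lebesgue)"
      by measurable
    show "AE x in lebesgue. AE y in lebesgue. ?h (snd (x, y)) \<noteq> ?h (fst (x, y))"
      using para_height_level_null[OF e] by simp
  qed
  then show ?thesis
  proof eventually_elim
    fix z :: "'a \<times> 'a" assume z: "?h (snd z) \<noteq> ?h (fst z)"
    have "0 < norm (fst z - snd z)" using z by auto
    then have 1: "eventually (\<lambda>n. \<eta> n < norm (fst z - snd z)) sequentially"
      by (rule order_tendstoD(2)[OF eta])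
    have lim: "(\<lambda>n. (1 - \<epsilon> n) * h) \<longlonglongrightarrow> h" for h :: real
      using tendsto_mult[OF tendsto_diff[OF tendsto_const eps, of 1] tendsto_const[of h]] by simp
    have 2: "eventually (\<lambda>n. \<not> ((1 - \<epsilon> n) * ?h (fst z) < ?h (snd z) \<and> (1 - \<epsilon> n) * ?h (snd z) < ?h (fst z))) sequentially"
    proof (cases "?h (snd z) < ?h (fst z)")
      case True
      from order_tendstoD(1)[OF lim True] show ?thesis by eventually_elim simp
    next
      case False
      then have "?h (fst z) < ?h (snd z)" using z by simp
      from order_tendstoD(1)[OF lim this] show ?thesis by eventually_elim simp
    qed
    from 1 2 show "eventually (\<lambda>n. z \<in> sep_pairs \<kappa> e b \<tau> (\<epsilon> n) (\<eta> n)) sequentially"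
      by eventually_elim (auto simp: sep_pairs_def)
  qed
qed

section \<open>Symmetry in the sign of u, and the passage to the distance function\<close>

lemma Wsp0_uminus: "u \<in> Wsp0 s p \<Omega> \<Longrightarrow> (\<lambda>x. - u x) \<in> Wsp0 s p \<Omega>"
  by (simp add: Wsp0_def abs_minus_commute)

lemma weak_bounded_fplap_uminus:
  fixes u :: "'a::euclidean_space \<Rightarrow> real"
  assumes "weak_bounded_fplap s p \<Omega> u K"
  shows "weak_bounded_fplap s p \<Omega> (\<lambda>x. - u x) K"
proof -
  have neg: "frac_energy s p (\<lambda>x. - u x) \<phi> = - frac_energy s p u \<phi>" for \<phi> :: "'a \<Rightarrow> real"
    unfolding frac_energy_def integral_minus[symmetric]
  proof (rule Bochner_Integration.integral_cong[OF refl])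
    fix z :: "'a \<times> 'a"
    have "- u (fst z) - - u (snd z) = - (u (fst z) - u (snd z))" by simp
    then show "spow (- u (fst z) - - u (snd z)) (p - 1) * (\<phi> (fst z) - \<phi> (snd z)) / norm (fst z - snd z) powr (real DIM('a) + p * s)
      = - (spow (u (fst z) - u (snd z)) (p - 1) * (\<phi> (fst z) - \<phi> (snd z)) / norm (fst z - snd z) powr (real DIM('a) + p * s))"
      by (simp only: spow_minus mult_minus_left minus_divide_left)
  qed
  show ?thesis
    unfolding weak_bounded_fplap_def neg
  proof (intro ballI impI)
    fix \<phi> :: "'a \<Rightarrow> real" assume "\<phi> \<in> Wsp0 s p \<Omega>" "\<forall>x. 0 \<le> \<phi> x"
    then have "- K * (\<integral>x\<in>\<Omega>. \<phi> x \<partial>lebesgue) \<le> frac_energy s p u \<phi>" "frac_energy s p u \<phi> \<le> K * (\<integral>x\<in>\<Omega>. \<phi> x \<partial>lebesgue)"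
      using assms unfolding weak_bounded_fplap_def by auto
    then show "- K * (\<integral>x\<in>\<Omega>. \<phi> x \<partial>lebesgue) \<le> - frac_energy s p u \<phi> \<and> - frac_energy s p u \<phi> \<le> K * (\<integral>x\<in>\<Omega>. \<phi> x \<partial>lebesgue)"
      unfolding mult_minus_left by linarith
  qed
qed

text \<open>The segment from \<open>x\<close> to a nearest point of the complement meets the
  frontier, no farther away than that point.\<close>

lemma infdist_compl_attained_on_frontier:
  fixes \<Omega> :: "'a::euclidean_space set"
  assumes "open \<Omega>" "bounded \<Omega>" "x \<in> \<Omega>"
  shows "\<exists>b\<in>frontier \<Omega>. norm (x - b) \<le> infdist x (- \<Omega>)"
proof -
  have "\<Omega> \<noteq> UNIV" using assms(2) not_bounded_UNIV by auto
  then have ne: "- \<Omega> \<noteq> {}" by auto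
  obtain y where y: "y \<in> - \<Omega>" "infdist x (- \<Omega>) = dist x y"
    using infdist_attains_inf[of "- \<Omega>" x] assms ne by auto
  have "closed_segment x y \<inter> frontier \<Omega> \<noteq> {}"
    using y assms by (intro connected_Int_frontier) auto
  then obtain b where b: "b \<in> closed_segment x y" "b \<in> frontier \<Omega>" by auto
  then have "dist x b \<le> dist x y" using dist_in_closed_segment[of b x y] by (simp add: dist_commute)
  then show ?thesis using b y by (auto simp: dist_norm)
qed

text \<open>Comparison with one barrier bounds \<open>u\<close> by a multiple of the power of
  \<open>norm (x - b)\<close>, up to \<open>\<tau>\<close>. The barrier constants are uniform in
  \<open>b\<close>, so the best \<open>b\<close> may be chosen for each \<open>x\<close>, which
  turns this norm into the distance to the complement.\<close>

lemma frac_plap_upper_bound: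
  fixes s p :: real and \<Omega> :: "'a::euclidean_space set"
  assumes s: "0 < s" "s < 1" and p: "1 < p" and Om: "open \<Omega>" "bounded \<Omega>" "C11_boundary \<Omega>"
  shows "\<exists>c>0. \<exists>D>0. \<forall>K>0. \<forall>u\<in>Wsp0 s p \<Omega>. weak_bounded_fplap s p \<Omega> u K \<longrightarrow>
     (AE x in lebesgue. x \<in> \<Omega> \<longrightarrow> u x \<le> (K / c) powr (1 / (p - 1)) * (D * infdist x (- \<Omega>)) powr s)"
proof -
  obtain k r where k: "0 < k" and r: "0 < r" and ext: "\<forall>b\<in>frontier \<Omega>. \<exists>n. norm n = 1 \<and> (\<forall>y\<in>\<Omega>. norm (y - b) < r \<longrightarrow> - k * (norm (y - b))\<^sup>2 \<le> (y - b) \<bullet> n)"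
    using C11_boundary_exterior_paraboloid[OF Om(2,3)] by blast
  define \<kappa> where "\<kappa> = 2 * k"
  \<comment> \<open>The radius of the exterior paraboloids, shrunk so that
    \<open>8 * k * M \<le> 1\<close>; with \<open>\<kappa> = 2 * k\<close> this is also
    \<open>4 * \<kappa> * M \<le> 1\<close>.\<close>
  define M where "M = min r (1 / (8 * k))"
  have kap: "0 < \<kappa>" using k by (simp add: \<kappa>_def)
  have M: "0 < M" "M \<le> r" "8 * k * M \<le> 1"
  proof -
    show "0 < M" "M \<le> r" using r k by (auto simp: M_def)
    have "M \<le> 1 / (8 * k)" by (simp add: M_def)
    then show "8 * k * M \<le> 1" using k by (simp add: field_simps)
  qed
  have kM: "4 * \<kappa> * M \<le> 1" using M by (simp add: \<kappa>_def)
  define c1 where "c1 = k / 2"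
  have c1: "0 < c1" using k by (simp add: c1_def)
  have "bounded (closure \<Omega>)" using Om by (simp add: bounded_closure)
  then obtain B where B: "0 < B" "\<And>x. x \<in> closure \<Omega> \<Longrightarrow> norm x \<le> B" using bounded_pos by metis
  have L: "norm (x - b) \<le> 2 * B" if "x \<in> \<Omega>" "b \<in> frontier \<Omega>" for x b
  proof -
    have "x \<in> closure \<Omega>" "b \<in> closure \<Omega>" using that closure_subset by (auto simp: frontier_def)
    then show ?thesis using B(2)[of x] B(2)[of b] norm_triangle_ineq4[of x b] by linarith
  qed
  obtain \<rho> c where rho: "0 < \<rho>" "\<rho> \<le> c1 * M\<^sup>2 / 4" and c: "0 < c" and super:
    "\<forall>(\<Omega>::'a set) e b \<tau> \<epsilon> \<eta>. norm e = 1 \<longrightarrow> 0 < \<tau> \<longrightarrow> \<tau> \<le> M / 8 \<longrightarrow>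
      0 < \<epsilon> \<longrightarrow> \<epsilon> \<le> 1/2 \<longrightarrow> 0 < \<eta> \<longrightarrow> \<eta> \<le> M / 24 \<longrightarrow> \<eta> \<le> \<epsilon> * \<tau> / 3 \<longrightarrow>
      (\<forall>x\<in>\<Omega>. norm (x - b) < M \<longrightarrow> c1 * (norm (x - b))\<^sup>2 + \<tau> \<le> para_height \<kappa> e b \<tau> x) \<longrightarrow>
      (\<forall>x\<in>\<Omega>. norm (x - b) \<le> 2 * B) \<longrightarrow>
      (\<forall>x\<in>\<Omega>. c \<le> (\<integral>y. indicator (sep_pairs \<kappa> e b \<tau> \<epsilon> \<eta>) (x, y) * spow (barrier \<kappa> M \<rho> s e b \<tau> x - barrier \<kappa> M \<rho> s e b \<tau> y) (p - 1)
           * norm (x - y) powr (- (real DIM('a) + p * s)) \<partial>lborel))"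
    using barrier_supersolution[OF s p kap M(1) kM c1, of "2 * B", where 'a='a] B(1) by auto
  define D where "D = 2 + \<rho> / M"
  have D: "0 < D" using rho M by (simp add: D_def add_pos_pos)
  have main: "AE x in lebesgue. x \<in> \<Omega> \<longrightarrow> u x \<le> (K / c) powr (1 / (p - 1)) * (D * infdist x (- \<Omega>)) powr s"
    if K: "0 < K" and u: "u \<in> Wsp0 s p \<Omega>" and weak: "weak_bounded_fplap s p \<Omega> u K" for K u
  proof -
    \<comment> \<open>Chosen with \<open>lam powr (p - 1) * c = K\<close>; the factor 2 in the
      comparison then supplies the strict inequality \<open>K < 2 * K\<close>.\<close>
    define lam where "lam = (K / c) powr (1 / (p - 1))"
    have lam: "0 < lam" using K c by (simp add: lam_def)
    have lamp: "lam powr (p - 1) = K / c" using p K c by (simp add: lam_def powr_powr)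
    have one: "AE x in lebesgue. x \<in> \<Omega> \<longrightarrow> u x \<le> lam * (D * norm (x - b) + \<tau>) powr s"
      if b: "b \<in> frontier \<Omega>" and tau: "0 < \<tau>" "\<tau> \<le> M / 8" for b \<tau>
    proof -
      obtain e where e: "norm e = 1" and ee: "\<And>y. y \<in> \<Omega> \<Longrightarrow> norm (y - b) < r \<Longrightarrow> - k * (norm (y - b))\<^sup>2 \<le> (y - b) \<bullet> e"
        using ext b by metis
      have geo: "c1 * (norm (x - b))\<^sup>2 + \<tau> \<le> para_height \<kappa> e b \<tau> x" if "x \<in> \<Omega>" "norm (x - b) < M" for x
        unfolding c1_def \<kappa>_def using that M ee[of x] by (intro para_height_lower[OF e k M(3)]) auto
      let ?W = "barrier \<kappa> M \<rho> s e b \<tau>"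
      \<comment> \<open>The shift by 2 makes \<open>\<epsilon> n \<le> 1/2\<close> hold from
        \<open>n = 0\<close> on.\<close>
      define \<epsilon> where "\<epsilon> n = 1 / (real n + 2)" for n
      define \<eta> where "\<eta> n = min (M / 24) (\<epsilon> n * \<tau> / 3)" for n
      have eps: "0 < \<epsilon> n" "\<epsilon> n \<le> 1/2" for n by (auto simp: \<epsilon>_def field_simps)
      have eta: "0 < \<eta> n" "\<eta> n \<le> M / 24" "\<eta> n \<le> \<epsilon> n * \<tau> / 3" for n
        using M tau eps[of n] by (auto simp: \<eta>_def)
      have epslim: "\<epsilon> \<longlonglongrightarrow> 0"
        unfolding \<epsilon>_def[abs_def] using LIMSEQ_Suc[OF LIMSEQ_inverse_real_of_nat]
        by (simp add: inverse_eq_divide add.commute)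
      have etalim: "\<eta> \<longlonglongrightarrow> 0"
      proof (rule tendsto_sandwich[of "\<lambda>_. 0" _ _ "\<lambda>n. \<epsilon> n * \<tau> / 3"])
        show "(\<lambda>n. \<epsilon> n * \<tau> / 3) \<longlonglongrightarrow> 0" using tendsto_divide[OF tendsto_mult[OF epslim tendsto_const[of \<tau>]] tendsto_const[of 3]] by simp
      qed (use eta in \<open>auto intro!: always_eventually less_imp_le\<close>)
      obtain C where C: "0 \<le> C" "\<forall>x\<in>\<Omega>. \<forall>y\<in>\<Omega>. \<bar>?W x - ?W y\<bar> \<le> C * norm (x - y)"
        using barrier_lipschitz[OF s kap kM M(1) rho c1 e tau(1) geo] by blast
      have "AE x in lebesgue. x \<in> \<Omega> \<longrightarrow> u x \<le> lam * ?W x"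
      proof (rule comparison_with_barrier[OF s p Om(1,2) u weak, where A = "\<lambda>n. sep_pairs \<kappa> e b \<tau> (\<epsilon> n) (\<eta> n)" and B = "\<rho> powr s" and c = c])
        show "?W \<in> borel_measurable borel" by measurable
        show "0 \<le> ?W x" for x by (rule barrier_bounds[OF rho(1) s(1)])
        show "?W x \<le> \<rho> powr s" for x by (rule barrier_bounds[OF rho(1) s(1)])
        show "(\<integral>\<^sup>+ z. ennreal (indicator (\<Omega> \<times> \<Omega>) z * \<bar>?W (fst z) - ?W (snd z)\<bar> powr p
              / norm (fst z - snd z) powr (real DIM('a) + p * s)) \<partial>(lebesgue \<Otimes>\<^sub>M lebesgue)) < \<infinity>"
          using C by (intro lipschitz_seminorm_finite[OF s p Om(1,2)]) auto
        show "\<And>n x y. (x, y) \<in> sep_pairs \<kappa> e b \<tau> (\<epsilon> n) (\<eta> n) \<longleftrightarrow> (y, x) \<in> sep_pairs \<kappa> e b \<tau> (\<epsilon> n) (\<eta> n)"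
          by (rule sep_pairs_sym)
        show "\<And>n. \<exists>\<eta>'>0. \<forall>x y. (x, y) \<in> sep_pairs \<kappa> e b \<tau> (\<epsilon> n) (\<eta> n) \<longrightarrow> \<eta>' \<le> norm (x - y)"
          using eta(1) by (auto simp: sep_pairs_def)
        show "AE z in lebesgue \<Otimes>\<^sub>M lebesgue. eventually (\<lambda>n. z \<in> sep_pairs \<kappa> e b \<tau> (\<epsilon> n) (\<eta> n)) sequentially"
          by (rule AE_eventually_sep_pairs[OF e epslim etalim])
        show "c \<le> (\<integral>y. indicator (sep_pairs \<kappa> e b \<tau> (\<epsilon> n) (\<eta> n)) (x, y) * spow (?W x - ?W y) (p - 1)
           * norm (x - y) powr (- (real DIM('a) + p * s)) \<partial>lborel)" if "x \<in> \<Omega>" for n x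
          using super e tau eps[of n] eta[of n] geo L[OF _ b] that by blast
        show "0 < lam" by (rule lam)
        show "K < 2 * lam powr (p - 1) * c" using K c by (simp add: lamp)
      qed measurable
      then show ?thesis
      proof eventually_elim
        fix x assume ux: "x \<in> \<Omega> \<longrightarrow> u x \<le> lam * ?W x"
        have "lam * ?W x \<le> lam * (D * norm (x - b) + \<tau>) powr s"
          unfolding D_def using lam barrier_le[OF e kap kM M(1) rho(1) tau(1) s(1), of b x] by (intro mult_left_mono) auto
        then show "x \<in> \<Omega> \<longrightarrow> u x \<le> lam * (D * norm (x - b) + \<tau>) powr s" using ux by auto
      qed
    qed
    \<comment> \<open>Countably many points \<open>b\<close> and lifts
      \<open>M / (8 * (real n + 1))\<close> leave one common null set; density of \<open>T\<close>
      and continuity of the bound recover the nearest frontier point.\<close>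
    obtain T where T: "countable T" "T \<subseteq> frontier \<Omega>" "frontier \<Omega> \<subseteq> closure T"
      using separable by blast
    have "AE x in lebesgue. \<forall>b\<in>T. \<forall>n::nat. x \<in> \<Omega> \<longrightarrow> u x \<le> lam * (D * norm (x - b) + M / (8 * (real n + 1))) powr s"
      unfolding AE_ball_countable[OF T(1)] AE_all_countable
    proof (intro ballI allI)
      fix b and n :: nat assume "b \<in> T"
      have "M / (8 * (real n + 1)) \<le> M / 8" using M(1) by (intro divide_left_mono) auto
      then show "AE x in lebesgue. x \<in> \<Omega> \<longrightarrow> u x \<le> lam * (D * norm (x - b) + M / (8 * (real n + 1))) powr s"
        using T(2) \<open>b \<in> T\<close> M(1) by (intro one) auto
    qed
    then show ?thesis
    proof eventually_elim
      fix x assume A: "\<forall>b\<in>T. \<forall>n::nat. x \<in> \<Omega> \<longrightarrow> u x \<le> lam * (D * norm (x - b) + M / (8 * (real n + 1))) powr s"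
      show "x \<in> \<Omega> \<longrightarrow> u x \<le> (K / c) powr (1 / (p - 1)) * (D * infdist x (- \<Omega>)) powr s"
      proof
        assume x: "x \<in> \<Omega>"
        define \<delta> where "\<delta> = infdist x (- \<Omega>)"
        obtain b0 where b0: "b0 \<in> frontier \<Omega>" "norm (x - b0) \<le> \<delta>"
          using infdist_compl_attained_on_frontier[OF Om(1,2) x] by (auto simp: \<delta>_def)
        have step: "u x \<le> lam * (D * (\<delta> + 1 / (real n + 1)) + M / (8 * (real n + 1))) powr s" for n :: nat
        proof -
          have "b0 \<in> closure T" using b0 T by auto
          then obtain b where b: "b \<in> T" "dist b b0 < 1 / (real n + 1)"
            by (metis closure_approachable divide_pos_pos of_nat_0_le_iff add_nonneg_pos zero_less_one)
          have "norm (x - b) \<le> norm (x - b0) + norm (b0 - b)" using norm_triangle_ineq[of "x - b0" "b0 - b"] by simp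
          then have nb: "norm (x - b) \<le> \<delta> + 1 / (real n + 1)" using b b0 by (simp add: dist_norm norm_minus_commute)
          have "u x \<le> lam * (D * norm (x - b) + M / (8 * (real n + 1))) powr s" using A b x by blast
          also have "\<dots> \<le> lam * (D * (\<delta> + 1 / (real n + 1)) + M / (8 * (real n + 1))) powr s"
            using lam D M(1) nb s by (intro mult_left_mono powr_mono2 add_right_mono) auto
          finally show ?thesis .
        qed
        have d0: "0 \<le> \<delta>" by (simp add: \<delta>_def infdist_nonneg)
        have inv: "(\<lambda>n. 1 / (real n + 1)) \<longlonglongrightarrow> 0"
          using LIMSEQ_inverse_real_of_nat by (simp add: inverse_eq_divide add.commute)
        have "(\<lambda>n. M / 8 * (1 / (real n + 1))) \<longlonglongrightarrow> M / 8 * 0" by (intro tendsto_intros inv)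
        then have "(\<lambda>n. M / (8 * (real n + 1))) \<longlonglongrightarrow> 0" by simp
        then have lim: "(\<lambda>n. D * (\<delta> + 1 / (real n + 1)) + M / (8 * (real n + 1))) \<longlonglongrightarrow> D * (\<delta> + 0) + 0"
          by (intro tendsto_intros inv)
        have "(\<lambda>n. lam * (D * (\<delta> + 1 / (real n + 1)) + M / (8 * (real n + 1))) powr s) \<longlonglongrightarrow> lam * (D * (\<delta> + 0) + 0) powr s"
        proof (rule tendsto_mult_left, rule tendsto_powr'[OF lim tendsto_const])
          have "0 \<le> D * (\<delta> + 1 / (real n + 1)) + M / (8 * (real n + 1))" for n :: nat
            using D d0 M(1) by simp
          then show "D * (\<delta> + 0) + 0 \<noteq> 0 \<or> 0 < s \<and> (\<forall>\<^sub>F n in sequentially. 0 \<le> D * (\<delta> + 1 / (real n + 1)) + M / (8 * (real n + 1)))"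
            using s by simp
        qed
        then have "u x \<le> lam * (D * (\<delta> + 0) + 0) powr s"
          by (rule LIMSEQ_le_const) (use step in auto)
        then show "u x \<le> (K / c) powr (1 / (p - 1)) * (D * infdist x (- \<Omega>)) powr s"
          by (simp add: lam_def \<delta>_def)
      qed
    qed
  qed
  show ?thesis using c D main by blast
qed

theorem theorem4p4:
  fixes s p :: real and \<Omega> :: "('a::euclidean_space) set"
  assumes "0 < s" "s < 1" "1 < p"
    and "open \<Omega>" "connected \<Omega>" "\<Omega> \<noteq> {}" "bounded \<Omega>" "C11_boundary \<Omega>"
  shows "\<exists>C>0. \<forall>K>0. \<forall>u \<in> Wsp0 s p \<Omega>. weak_bounded_fplap s p \<Omega> u K \<longrightarrow>
           (AE x in lebesgue. x \<in> \<Omega> \<longrightarrow>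
              \<bar>u x\<bar> \<le> (C * K) powr (1 / (p - 1)) * infdist x (- \<Omega>) powr s)"
proof -
  obtain c D where c: "0 < c" and D: "0 < D" and upper: "\<And>K u. 0 < K \<Longrightarrow> u \<in> Wsp0 s p \<Omega> \<Longrightarrow> weak_bounded_fplap s p \<Omega> u K \<Longrightarrow>
     (AE x in lebesgue. x \<in> \<Omega> \<longrightarrow> u x \<le> (K / c) powr (1 / (p - 1)) * (D * infdist x (- \<Omega>)) powr s)"
    using frac_plap_upper_bound[OF assms(1-4,7,8)] by blast
  \<comment> \<open>The factor \<open>D powr s\<close> is moved inside the power
    \<open>1 / (p - 1)\<close>.\<close>
  define C where "C = D powr (s * (p - 1)) / c"
  have C: "0 < C" using c D by (simp add: C_def)
  have eq: "(K / c) powr (1 / (p - 1)) * (D * t) powr s = (C * K) powr (1 / (p - 1)) * t powr s" for K t :: real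
  proof -
    have "(C * K) powr (1 / (p - 1)) = (D powr (s * (p - 1)) * (K / c)) powr (1 / (p - 1))" by (simp add: C_def)
    also have "\<dots> = D powr s * (K / c) powr (1 / (p - 1))"
      using assms(3) by (simp only: powr_mult powr_powr) simp
    finally show ?thesis by (simp add: powr_mult)
  qed
  show ?thesis
  proof (intro exI[of _ C] conjI allI ballI impI)
    fix K :: real and u
    assume K: "0 < K" and u: "u \<in> Wsp0 s p \<Omega>" and weak: "weak_bounded_fplap s p \<Omega> u K"
    \<comment> \<open>\<open>spow\<close> is odd, so \<open>- u\<close> satisfies the same weak
      bound and supplies the estimate from below.\<close>
    from upper[OF K u weak] upper[OF K Wsp0_uminus[OF u] weak_bounded_fplap_uminus[OF weak]]
    show "AE x in lebesgue. x \<in> \<Omega> \<longrightarrow> \<bar>u x\<bar> \<le> (C * K) powr (1 / (p - 1)) * infdist x (- \<Omega>) powr s"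
      unfolding eq by eventually_elim auto
  qed (rule C)
qed

end
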